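(* Let $\mathfrak{J}=\begin{pmatrix}H&\alpha\\\beta&K\end{pmatrix}$ be a strong generalized almost complex structure on a smooth manifold $M$. In local coordinates $(U,(x^1,\dots,x^n))$ write $H\partial_i=H_i^j\partial_j$, $\alpha\,dx^i=\alpha^{ij}\partial_j$, $\beta\partial_i=\beta_{ij}dx^j$, $K\,dx^i=K^i_j\,dx^j$. Then $\mathfrak{J}$ is Courant-integrable if and only if, in all such local coordinates, the following hold for all $i,j,k\in\{1,\dots,\dim_{\mathbb{R}}M\}$ (summation over repeated indices; the six left-hand sides are the $k$-th components of $N(\partial_i,\partial_j)|_{TM}$, $N(\partial_i,\partial_j)|_{T^*M}$, $N(dx^i,dx^j)|_{TM}$, $N(dx^i,dx^j)|_{T^*M}$, $N(\partial_i,dx^j)|_{TM}$, $N(\partial_i,dx^j)|_{T^*M}$, respectively, where $N$ is the Nijenhuis tensor of $\mathfrak{J}$ with respect to the Courant bracket): (1) $$H_i^l\partial_lH_j^k-H_j^l\partial_lH_i^k+H_l^k(\partial_jH_i^l-\partial_iH_j^l)+\alpha^{lk}\big(\partial_j\beta_{il}-\partial_i\beta_{jl}-\tfrac12\partial_l(\beta_{ij}-\beta_{ji})\big)=0;$$ (2) $$\begin{aligned}&H_i^l\partial_l\beta_{jk}+\beta_{jl}\partial_kH_i^l-H_j^l\partial_l\beta_{ik}-\beta_{il}\partial_kH_j^l-\tfrac12\partial_k(\beta_{jl}H_i^l-\beta_{il}H_j^l)\\&+\beta_{lk}(\partial_jH_i^l-\partial_iH_j^l)+K_k^l\big(\partial_j\beta_{il}-\partial_i\beta_{jl}-\tfrac12\partial_l(\beta_{ij}-\beta_{ji})\big)=0;\end{aligned}$$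 (3) $$\alpha^{il}\partial_l\alpha^{jk}-\alpha^{jl}\partial_l\alpha^{ik}-\tfrac12\alpha^{lk}\partial_l(\alpha^{ij}-\alpha^{ji})=0;$$ (4) $$\begin{aligned}&\alpha^{il}\partial_lK_k^j+K_l^j\partial_k\alpha^{il}-\alpha^{jl}\partial_lK_k^i-K_l^i\partial_k\alpha^{jl}+\tfrac12\partial_k(K_l^i\alpha^{jl}-K_l^j\alpha^{il})\\&-\tfrac12K_k^l\partial_l(\alpha^{ij}-\alpha^{ji})=0;\end{aligned}$$ (5) $$H_i^l\partial_l\alpha^{jk}-\alpha^{jl}\partial_lH_i^k-H_l^k\partial_i\alpha^{jl}-\alpha^{lk}\big(\partial_iK_l^j+\tfrac12\partial_lH_i^j-\tfrac12\partial_lK_i^j\big)=0;$$ (6) $$\begin{aligned}&H_i^l\partial_lK_k^j+K_l^j\partial_kH_i^l-\alpha^{jl}\partial_l\beta_{ik}-\beta_{il}\partial_k\alpha^{jl}+\tfrac12\partial_k(\beta_{il}\alpha^{jl}-K_l^jH_i^l)\\&-\beta_{lk}\partial_i\alpha^{jl}-K_k^l\big(\partial_iK_l^j+\tfrac12\partial_lH_i^j-\tfrac12\partial_lK_i^j\big)=0.\end{aligned}$$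
   Context: For a smooth manifold $M$ let $E=TM\oplus T^*M$ with pairing $\langle X+\xi,Y+\eta\rangle=\iota_X\eta+\iota_Y\xi$. A strong generalized almost complex structure is a smooth bundle endomorphism $\mathfrak{J}$ of $E$ with $\mathfrak{J}^2=-\mathrm{Id}$ and $\langle\mathfrak{J}v,\mathfrak{J}w\rangle=\langle v,w\rangle$; in block form $H:TM\to TM$, $\alpha:T^*M\to TM$, $\beta:TM\to T^*M$, $K:T^*M\to T^*M$, so $\mathfrak{J}(X+\xi)=(HX+\alpha\xi)+(\beta X+K\xi)$. The Courant bracket is $[X+\xi,Y+\eta]_C=[X,Y]+\mathcal{L}_X\eta-\mathcal{L}_Y\xi-\frac12d(\iota_X\eta-\iota_Y\xi)$. The Nijenhuis tensor is $N(v,w)=[\mathfrak{J}v,\mathfrak{J}w]_C-\mathfrak{J}[\mathfrak{J}v,w]_C-\mathfrak{J}[v,\mathfrak{J}w]_C-[v,w]_C$ (a tensor for strong $\mathfrak{J}$), and $\mathfrak{J}$ is Courant-integrable iff $N\equiv0$. The symbols $|_{TM}$ and $|_{T^*M}$ denote the $TM$- and $T^*M$-components. *)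

theory Defs
  imports "HOL-Analysis.Analysis" "HOL-Library.Function_Algebras"
begin

instantiation "fun" :: (type, real_vector) real_vector
begin

definition "r *\<^sub>R f = (\<lambda>x. r *\<^sub>R f x)"

instance
  by standard (simp_all add: scaleR_fun_def fun_eq_iff scaleR_add_right scaleR_add_left)

end

lemma scaleR_fun_apply [simp]: "(r *\<^sub>R f) x = r *\<^sub>R f x"
  by (simp add: scaleR_fun_def)


section \<open>Smooth manifolds\<close>

text \<open>\<open>C\<^sup>k\<close> and smooth maps between Euclidean spaces; only used for open \<open>S\<close>.\<close>

primrec Ck_on :: "nat \<Rightarrow> 'a::euclidean_space set \<Rightarrow> ('a \<Rightarrow> 'b::real_normed_vector) \<Rightarrow> bool" where
  "Ck_on 0 S f \<longleftrightarrow> continuous_on S f"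
| "Ck_on (Suc k) S f \<longleftrightarrow>
     (\<forall>x\<in>S. f differentiable (at x)) \<and>
     (\<forall>v. Ck_on k S (\<lambda>x. frechet_derivative f (at x) v))"

definition smooth_on :: "'a::euclidean_space set \<Rightarrow> ('a \<Rightarrow> 'b::real_normed_vector) \<Rightarrow> bool" where
  "smooth_on S f \<longleftrightarrow> (\<forall>k. Ck_on k S f)"

text \<open>A chart is a pair \<open>(U, \<phi>)\<close>; the values of \<open>\<phi>\<close> outside \<open>U\<close> are irrelevant.
  The manifold is the whole type \<open>'m\<close>, its dimension is \<open>CARD('n)\<close>.\<close>

type_synonym ('m, 'n) chart = "'m set \<times> ('m \<Rightarrow> real ^ 'n)"

abbreviation chart_inv :: "('m, 'n) chart \<Rightarrow> real ^ 'n \<Rightarrow> 'm" where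
  "chart_inv c \<equiv> inv_into (fst c) (snd c)"

definition is_chart :: "('m::topological_space, 'n::finite) chart \<Rightarrow> bool" where
  "is_chart c \<longleftrightarrow> open (fst c) \<and> open (snd c ` fst c) \<and>
     homeomorphism (fst c) (snd c ` fst c) (snd c) (chart_inv c)"

definition smooth_compatible ::
  "('m, 'n::finite) chart \<Rightarrow> ('m, 'n) chart \<Rightarrow> bool" where
  "smooth_compatible c d \<longleftrightarrow>
     smooth_on (snd c ` (fst c \<inter> fst d)) (snd d \<circ> chart_inv c) \<and>
     smooth_on (snd d ` (fst c \<inter> fst d)) (snd c \<circ> chart_inv d)"

text \<open>A smooth structure is a maximal smooth atlas, so its elements are all the local
  coordinate systems of the manifold.\<close>

definition smooth_structure ::
  "('m::{t2_space, second_countable_topology}, 'n::finite) chart set \<Rightarrow> bool" where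
  "smooth_structure A \<longleftrightarrow>
     (\<forall>c\<in>A. is_chart c) \<and> (\<Union>c\<in>A. fst c) = UNIV \<and>
     (\<forall>c\<in>A. \<forall>d\<in>A. smooth_compatible c d) \<and>
     (\<forall>c. is_chart c \<and> (\<forall>d\<in>A. smooth_compatible c d) \<longrightarrow> c \<in> A)"

definition smooth_fun :: "('m, 'n::finite) chart set \<Rightarrow> 'm set \<Rightarrow> ('m \<Rightarrow> real) \<Rightarrow> bool" where
  "smooth_fun A U f \<longleftrightarrow> (\<forall>c\<in>A. smooth_on (snd c ` (fst c \<inter> U)) (f \<circ> chart_inv c))"

definition smooth_near ::
  "('m::topological_space, 'n::finite) chart set \<Rightarrow> 'm \<Rightarrow> ('m \<Rightarrow> real) \<Rightarrow> bool" where
  "smooth_near A p f \<longleftrightarrow> (\<exists>U. open U \<and> p \<in> U \<and> smooth_fun A U f)"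


section \<open>The generalized tangent bundle\<close>

text \<open>Tangent vectors at \<open>p\<close> are the derivations of the functions smooth near \<open>p\<close>
  (locality follows from the Leibniz rule, so these are the derivations of the germs).
  So that distinct HOL functions represent distinct vectors and covectors, they are required
  to vanish on arguments outside their intended domain.\<close>

type_synonym 'm tvec = "('m \<Rightarrow> real) \<Rightarrow> real"
type_synonym 'm cvec = "'m tvec \<Rightarrow> real"
type_synonym 'm gvec = "'m tvec \<times> 'm cvec"

definition tangent_space ::
  "('m::topological_space, 'n::finite) chart set \<Rightarrow> 'm \<Rightarrow> 'm tvec set" where
  "tangent_space A p = {X.
     (\<forall>f g. smooth_near A p f \<and> smooth_near A p g \<longrightarrow>
        X (\<lambda>q. f q + g q) = X f + X g \<and>
        X (\<lambda>q. f q * g q) = f p * X g + g p * X f) \<and>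
     (\<forall>r f. smooth_near A p f \<longrightarrow> X (\<lambda>q. r * f q) = r * X f) \<and>
     (\<forall>f. \<not> smooth_near A p f \<longrightarrow> X f = 0)}"

definition cotangent_space ::
  "('m::topological_space, 'n::finite) chart set \<Rightarrow> 'm \<Rightarrow> 'm cvec set" where
  "cotangent_space A p = {\<xi>.
     (\<forall>v\<in>tangent_space A p. \<forall>w\<in>tangent_space A p. \<xi> (v + w) = \<xi> v + \<xi> w) \<and>
     (\<forall>r. \<forall>v\<in>tangent_space A p. \<xi> (r *\<^sub>R v) = r * \<xi> v) \<and>
     (\<forall>v. v \<notin> tangent_space A p \<longrightarrow> \<xi> v = 0)}"

definition gen_tangent_space ::
  "('m::topological_space, 'n::finite) chart set \<Rightarrow> 'm \<Rightarrow> 'm gvec set" where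
  "gen_tangent_space A p = tangent_space A p \<times> cotangent_space A p"

definition pairing :: "'m gvec \<Rightarrow> 'm gvec \<Rightarrow> real" where
  "pairing v w = snd w (fst v) + snd v (fst w)"

text \<open>Smooth vector fields, 1-forms and sections of \<open>TM \<oplus> T*M\<close> over an open set \<open>U\<close>;
  values outside \<open>U\<close> are irrelevant.\<close>

definition smooth_vector_field ::
  "('m::topological_space, 'n::finite) chart set \<Rightarrow> 'm set \<Rightarrow> ('m \<Rightarrow> 'm tvec) \<Rightarrow> bool" where
  "smooth_vector_field A U X \<longleftrightarrow>
     (\<forall>p\<in>U. X p \<in> tangent_space A p) \<and>
     (\<forall>V f. open V \<and> V \<subseteq> U \<and> smooth_fun A V f \<longrightarrow> smooth_fun A V (\<lambda>q. X q f))"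

definition smooth_one_form ::
  "('m::topological_space, 'n::finite) chart set \<Rightarrow> 'm set \<Rightarrow> ('m \<Rightarrow> 'm cvec) \<Rightarrow> bool" where
  "smooth_one_form A U \<xi> \<longleftrightarrow>
     (\<forall>p\<in>U. \<xi> p \<in> cotangent_space A p) \<and>
     (\<forall>V Y. open V \<and> V \<subseteq> U \<and> smooth_vector_field A V Y \<longrightarrow> smooth_fun A V (\<lambda>q. \<xi> q (Y q)))"

definition smooth_section ::
  "('m::topological_space, 'n::finite) chart set \<Rightarrow> 'm set \<Rightarrow> ('m \<Rightarrow> 'm gvec) \<Rightarrow> bool" where
  "smooth_section A U s \<longleftrightarrow>
     smooth_vector_field A U (\<lambda>q. fst (s q)) \<and> smooth_one_form A U (\<lambda>q. snd (s q))"

definition exterior_d ::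
  "('m::topological_space, 'n::finite) chart set \<Rightarrow> ('m \<Rightarrow> real) \<Rightarrow> 'm \<Rightarrow> 'm cvec" where
  "exterior_d A f p = (\<lambda>v. if v \<in> tangent_space A p then v f else 0)"

definition lie_bracket ::
  "('m::topological_space, 'n::finite) chart set \<Rightarrow> ('m \<Rightarrow> 'm tvec) \<Rightarrow> ('m \<Rightarrow> 'm tvec)
   \<Rightarrow> 'm \<Rightarrow> 'm tvec" where
  "lie_bracket A X Y p =
     (\<lambda>f. if smooth_near A p f then X p (\<lambda>q. Y q f) - Y p (\<lambda>q. X q f) else 0)"

text \<open>\<open>(\<L>\<^sub>X \<eta>)(Y) = X(\<eta>(Y)) - \<eta>([X, Y])\<close>; the value at \<open>p\<close> depends only on \<open>Y p\<close>, so it is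
  evaluated on \<open>v\<close> through local extensions \<open>Y\<close> of \<open>v\<close>.\<close>

definition lie_derivative ::
  "('m::topological_space, 'n::finite) chart set \<Rightarrow> ('m \<Rightarrow> 'm tvec) \<Rightarrow> ('m \<Rightarrow> 'm cvec)
   \<Rightarrow> 'm \<Rightarrow> 'm cvec" where
  "lie_derivative A X \<eta> p =
     (\<lambda>v. if v \<in> tangent_space A p
          then (THE r. \<forall>V Y. open V \<and> p \<in> V \<and> smooth_vector_field A V Y \<and> Y p = v \<longrightarrow>
                  r = X p (\<lambda>q. \<eta> q (Y q)) - \<eta> p (lie_bracket A X Y p))
          else 0)"

definition courant_bracket ::
  "('m::topological_space, 'n::finite) chart set \<Rightarrow> ('m \<Rightarrow> 'm gvec) \<Rightarrow> ('m \<Rightarrow> 'm gvec)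
   \<Rightarrow> 'm \<Rightarrow> 'm gvec" where
  "courant_bracket A v w p =
     (let X = (\<lambda>q. fst (v q)); \<xi> = (\<lambda>q. snd (v q)); Y = (\<lambda>q. fst (w q)); \<eta> = (\<lambda>q. snd (w q))
      in (lie_bracket A X Y p,
          lie_derivative A X \<eta> p - lie_derivative A Y \<xi> p
            - (1/2) *\<^sub>R exterior_d A (\<lambda>q. \<eta> q (X q) - \<xi> q (Y q)) p))"


section \<open>Generalized almost complex structures\<close>

text \<open>A smooth endomorphism of \<open>TM \<oplus> T*M\<close> is a family of linear maps of the fibres that
  takes smooth local sections to smooth local sections.\<close>

definition smooth_bundle_endo ::
  "('m::topological_space, 'n::finite) chart set \<Rightarrow> ('m \<Rightarrow> 'm gvec \<Rightarrow> 'm gvec) \<Rightarrow> bool" where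
  "smooth_bundle_endo A J \<longleftrightarrow>
     (\<forall>p. \<forall>v\<in>gen_tangent_space A p. J p v \<in> gen_tangent_space A p \<and>
        (\<forall>w\<in>gen_tangent_space A p. J p (v + w) = J p v + J p w) \<and>
        (\<forall>r. J p (r *\<^sub>R v) = r *\<^sub>R J p v)) \<and>
     (\<forall>U s. open U \<and> smooth_section A U s \<longrightarrow> smooth_section A U (\<lambda>q. J q (s q)))"

definition strong_gen_almost_complex ::
  "('m::topological_space, 'n::finite) chart set \<Rightarrow> ('m \<Rightarrow> 'm gvec \<Rightarrow> 'm gvec) \<Rightarrow> bool" where
  "strong_gen_almost_complex A J \<longleftrightarrow> smooth_bundle_endo A J \<and>
     (\<forall>p. \<forall>v\<in>gen_tangent_space A p. J p (J p v) = - v \<and>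
        (\<forall>w\<in>gen_tangent_space A p. pairing (J p v) (J p w) = pairing v w))"

definition nijenhuis ::
  "('m::topological_space, 'n::finite) chart set \<Rightarrow> ('m \<Rightarrow> 'm gvec \<Rightarrow> 'm gvec)
   \<Rightarrow> ('m \<Rightarrow> 'm gvec) \<Rightarrow> ('m \<Rightarrow> 'm gvec) \<Rightarrow> 'm \<Rightarrow> 'm gvec" where
  "nijenhuis A J v w p =
     courant_bracket A (\<lambda>q. J q (v q)) (\<lambda>q. J q (w q)) p
     - J p (courant_bracket A (\<lambda>q. J q (v q)) w p)
     - J p (courant_bracket A v (\<lambda>q. J q (w q)) p)
     - courant_bracket A v w p"

definition courant_integrable ::
  "('m::topological_space, 'n::finite) chart set \<Rightarrow> ('m \<Rightarrow> 'm gvec \<Rightarrow> 'm gvec) \<Rightarrow> bool" where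
  "courant_integrable A J \<longleftrightarrow>
     (\<forall>v w. smooth_section A UNIV v \<and> smooth_section A UNIV w \<longrightarrow> (\<forall>p. nijenhuis A J v w p = 0))"

definition block_H :: "('m \<Rightarrow> 'm gvec \<Rightarrow> 'm gvec) \<Rightarrow> 'm \<Rightarrow> 'm tvec \<Rightarrow> 'm tvec" where
  "block_H J p X = fst (J p (X, 0))"

definition block_alpha :: "('m \<Rightarrow> 'm gvec \<Rightarrow> 'm gvec) \<Rightarrow> 'm \<Rightarrow> 'm cvec \<Rightarrow> 'm tvec" where
  "block_alpha J p \<xi> = fst (J p (0, \<xi>))"

definition block_beta :: "('m \<Rightarrow> 'm gvec \<Rightarrow> 'm gvec) \<Rightarrow> 'm \<Rightarrow> 'm tvec \<Rightarrow> 'm cvec" where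
  "block_beta J p X = snd (J p (X, 0))"

definition block_K :: "('m \<Rightarrow> 'm gvec \<Rightarrow> 'm gvec) \<Rightarrow> 'm \<Rightarrow> 'm cvec \<Rightarrow> 'm cvec" where
  "block_K J p \<xi> = snd (J p (0, \<xi>))"


section \<open>Local coordinates\<close>

text \<open>The coordinate function \<open>x\<^sup>i\<close>, the field \<open>\<partial>\<^sub>i\<close> and the form \<open>dx\<^sup>i\<close> of a chart, to be used
  at points of its domain only. For \<open>f\<close> smooth near \<open>p\<close>, the partial derivative of \<open>f\<close> at \<open>p\<close>
  is \<open>coord_vec A c i p f\<close>.\<close>

definition coord_fun :: "('m, 'n::finite) chart \<Rightarrow> 'n \<Rightarrow> 'm \<Rightarrow> real" where
  "coord_fun c i q = snd c q $ i"

definition coord_vec ::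
  "('m::topological_space, 'n::finite) chart set \<Rightarrow> ('m, 'n) chart \<Rightarrow> 'n \<Rightarrow> 'm \<Rightarrow> 'm tvec" where
  "coord_vec A c i p =
     (\<lambda>f. if smooth_near A p f
          then frechet_derivative (f \<circ> chart_inv c) (at (snd c p)) (axis i 1) else 0)"

definition coord_form ::
  "('m::topological_space, 'n::finite) chart set \<Rightarrow> ('m, 'n) chart \<Rightarrow> 'n \<Rightarrow> 'm \<Rightarrow> 'm cvec" where
  "coord_form A c i = exterior_d A (coord_fun c i)"

definition vec_comp ::
  "('m::topological_space, 'n::finite) chart set \<Rightarrow> ('m, 'n) chart \<Rightarrow> 'n \<Rightarrow> 'm \<Rightarrow> 'm tvec \<Rightarrow> real" where
  "vec_comp A c k p X = coord_form A c k p X"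

definition form_comp ::
  "('m::topological_space, 'n::finite) chart set \<Rightarrow> ('m, 'n) chart \<Rightarrow> 'n \<Rightarrow> 'm \<Rightarrow> 'm cvec \<Rightarrow> real" where
  "form_comp A c k p \<xi> = \<xi> (coord_vec A c k p)"

text \<open>\<open>H i j\<close>, \<open>\<alpha> i j\<close>, \<open>\<beta> i j\<close>, \<open>K i j\<close> stand for \<open>H\<^sub>i\<^sup>j\<close>, \<open>\<alpha>\<^sup>i\<^sup>j\<close>, \<open>\<beta>\<^sub>i\<^sub>j\<close>, \<open>K\<^sup>i\<^sub>j\<close>: the first index
  is always that of the frame element to which the block is applied.\<close>

definition coeff_H ::
  "('m::topological_space, 'n::finite) chart set \<Rightarrow> ('m \<Rightarrow> 'm gvec \<Rightarrow> 'm gvec) \<Rightarrow> ('m, 'n) chart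
   \<Rightarrow> 'n \<Rightarrow> 'n \<Rightarrow> 'm \<Rightarrow> real" where
  "coeff_H A J c i j p = vec_comp A c j p (block_H J p (coord_vec A c i p))"

definition coeff_alpha ::
  "('m::topological_space, 'n::finite) chart set \<Rightarrow> ('m \<Rightarrow> 'm gvec \<Rightarrow> 'm gvec) \<Rightarrow> ('m, 'n) chart
   \<Rightarrow> 'n \<Rightarrow> 'n \<Rightarrow> 'm \<Rightarrow> real" where
  "coeff_alpha A J c i j p = vec_comp A c j p (block_alpha J p (coord_form A c i p))"

definition coeff_beta ::
  "('m::topological_space, 'n::finite) chart set \<Rightarrow> ('m \<Rightarrow> 'm gvec \<Rightarrow> 'm gvec) \<Rightarrow> ('m, 'n) chart
   \<Rightarrow> 'n \<Rightarrow> 'n \<Rightarrow> 'm \<Rightarrow> real" where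
  "coeff_beta A J c i j p = form_comp A c j p (block_beta J p (coord_vec A c i p))"

definition coeff_K ::
  "('m::topological_space, 'n::finite) chart set \<Rightarrow> ('m \<Rightarrow> 'm gvec \<Rightarrow> 'm gvec) \<Rightarrow> ('m, 'n) chart
   \<Rightarrow> 'n \<Rightarrow> 'n \<Rightarrow> 'm \<Rightarrow> real" where
  "coeff_K A J c i j p = form_comp A c j p (block_K J p (coord_form A c i p))"

text \<open>The frame fields \<open>\<partial>\<^sub>i\<close> and \<open>dx\<^sup>i\<close> as local sections of \<open>TM \<oplus> T*M\<close>.\<close>

definition frame_vec ::
  "('m::topological_space, 'n::finite) chart set \<Rightarrow> ('m, 'n) chart \<Rightarrow> 'n \<Rightarrow> 'm \<Rightarrow> 'm gvec" where
  "frame_vec A c i q = (coord_vec A c i q, 0)"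

definition frame_form ::
  "('m::topological_space, 'n::finite) chart set \<Rightarrow> ('m, 'n) chart \<Rightarrow> 'n \<Rightarrow> 'm \<Rightarrow> 'm gvec" where
  "frame_form A c i q = (0, coord_form A c i q)"

text \<open>The left-hand sides of the six equations at the point \<open>p\<close>. The parameter \<open>D l f\<close> is the
  partial derivative \<open>\<partial>\<^sub>l f\<close> as a function on the manifold.\<close>

context
  fixes D :: "'n::finite \<Rightarrow> ('m \<Rightarrow> real) \<Rightarrow> 'm \<Rightarrow> real"
    and H \<alpha> \<beta> K :: "'n \<Rightarrow> 'n \<Rightarrow> 'm \<Rightarrow> real"
begin

definition lhs1 :: "'n \<Rightarrow> 'n \<Rightarrow> 'n \<Rightarrow> 'm \<Rightarrow> real" where
  "lhs1 i j k p =
     (\<Sum>l\<in>UNIV. H i l p * D l (H j k) p - H j l p * D l (H i k) p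
        + H l k p * (D j (H i l) p - D i (H j l) p)
        + \<alpha> l k p * (D j (\<beta> i l) p - D i (\<beta> j l) p - 1/2 * D l (\<lambda>q. \<beta> i j q - \<beta> j i q) p))"

definition lhs2 :: "'n \<Rightarrow> 'n \<Rightarrow> 'n \<Rightarrow> 'm \<Rightarrow> real" where
  "lhs2 i j k p =
     (\<Sum>l\<in>UNIV. H i l p * D l (\<beta> j k) p + \<beta> j l p * D k (H i l) p
        - H j l p * D l (\<beta> i k) p - \<beta> i l p * D k (H j l) p)
     - 1/2 * D k (\<lambda>q. \<Sum>l\<in>UNIV. \<beta> j l q * H i l q - \<beta> i l q * H j l q) p
     + (\<Sum>l\<in>UNIV. \<beta> l k p * (D j (H i l) p - D i (H j l) p)
        + K l k p * (D j (\<beta> i l) p - D i (\<beta> j l) p - 1/2 * D l (\<lambda>q. \<beta> i j q - \<beta> j i q) p))"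

definition lhs3 :: "'n \<Rightarrow> 'n \<Rightarrow> 'n \<Rightarrow> 'm \<Rightarrow> real" where
  "lhs3 i j k p =
     (\<Sum>l\<in>UNIV. \<alpha> i l p * D l (\<alpha> j k) p - \<alpha> j l p * D l (\<alpha> i k) p
        - 1/2 * \<alpha> l k p * D l (\<lambda>q. \<alpha> i j q - \<alpha> j i q) p)"

definition lhs4 :: "'n \<Rightarrow> 'n \<Rightarrow> 'n \<Rightarrow> 'm \<Rightarrow> real" where
  "lhs4 i j k p =
     (\<Sum>l\<in>UNIV. \<alpha> i l p * D l (K j k) p + K j l p * D k (\<alpha> i l) p
        - \<alpha> j l p * D l (K i k) p - K i l p * D k (\<alpha> j l) p)
     + 1/2 * D k (\<lambda>q. \<Sum>l\<in>UNIV. K i l q * \<alpha> j l q - K j l q * \<alpha> i l q) p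
     - (\<Sum>l\<in>UNIV. 1/2 * K l k p * D l (\<lambda>q. \<alpha> i j q - \<alpha> j i q) p)"

definition lhs5 :: "'n \<Rightarrow> 'n \<Rightarrow> 'n \<Rightarrow> 'm \<Rightarrow> real" where
  "lhs5 i j k p =
     (\<Sum>l\<in>UNIV. H i l p * D l (\<alpha> j k) p - \<alpha> j l p * D l (H i k) p - H l k p * D i (\<alpha> j l) p
        - \<alpha> l k p * (D i (K j l) p + 1/2 * D l (H i j) p - 1/2 * D l (K j i) p))"

definition lhs6 :: "'n \<Rightarrow> 'n \<Rightarrow> 'n \<Rightarrow> 'm \<Rightarrow> real" where
  "lhs6 i j k p =
     (\<Sum>l\<in>UNIV. H i l p * D l (K j k) p + K j l p * D k (H i l) p
        - \<alpha> j l p * D l (\<beta> i k) p - \<beta> i l p * D k (\<alpha> j l) p)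
     + 1/2 * D k (\<lambda>q. \<Sum>l\<in>UNIV. \<beta> i l q * \<alpha> j l q - K j l q * H i l q) p
     - (\<Sum>l\<in>UNIV. \<beta> l k p * D i (\<alpha> j l) p
        + K l k p * (D i (K j l) p + 1/2 * D l (H i j) p - 1/2 * D l (K j i) p))"

end

end

theory Submission
  imports Defs
begin

text \<open>By Hadamard's lemma a derivation at \<open>p\<close> is determined by its values on coordinate functions, so
  smooth fields and forms near \<open>p\<close> correspond to their tuples of smooth components, and the Courant
  bracket at \<open>p\<close> is a first-order bilinear expression in these components. Evaluating it on the
  frame \<open>\<partial>\<^sub>i, dx\<^sup>i\<close> and its images under \<open>J\<close> gives the six left-hand sides. The Leibniz rule of the
  bracket makes \<open>N\<close> linear over smooth functions for strong \<open>J\<close>; hence \<open>N\<close> vanishes on all sections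
  iff it vanishes on the frames of all charts, where local frames are made global by a cut-off
  function that only has to be nonzero at the point considered.\<close>

section \<open>Smooth maps between Euclidean spaces\<close>

text \<open>Tangent vectors act on functions defined on the whole manifold, while charts, coordinate
  frames and the coefficients of \<open>J\<close> are meaningful only on an open piece of it and
  have arbitrary values elsewhere. Identities between fields therefore hold only near a point, and
  equality of functions is weakened throughout to equality on some neighbourhood; locality of
  derivations makes this enough for computing derivatives at the point. Infinite differentiability
  is essential: for functions of class \<open>C^k\<close> the quotients in Hadamard's lemma lose one
  order, and the space of derivations is larger than the span of the partial derivatives.
  Tensoriality of \<open>N\<close> is not automatic either. Unlike the Lie bracket, the Courant
  bracket has a Leibniz rule with an extra multiple of \<open>df\<close>, and only the compatibility
  of \<open>J\<close> with the pairing removes it. Since the bracket is antisymmetric, all of this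
  has to be shown for the second argument only.\<close>

lemma has_derivative_cong_open:
  assumes "open S" "x \<in> S" "\<And>y. y \<in> S \<Longrightarrow> f y = g y"
  shows "(f has_derivative f') (at x) \<longleftrightarrow> (g has_derivative f') (at x)"
  using has_derivative_transform_within_open[of f f' x UNIV S g]
    has_derivative_transform_within_open[of g f' x UNIV S f] assms by auto

lemma frechet_derivative_cong_open:
  assumes "open S" "x \<in> S" "\<And>y. y \<in> S \<Longrightarrow> f y = g y"
  shows "frechet_derivative f (at x) = frechet_derivative g (at x)"
  unfolding frechet_derivative_def using has_derivative_cong_open[OF assms] by simp

lemma Ck_on_cong:
  assumes "open S" "Ck_on k S f" "\<And>x. x \<in> S \<Longrightarrow> f x = g x"
  shows "Ck_on k S g"
  using assms(2,3)
proof (induction k arbitrary: f g)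
  case 0
  then show ?case by (simp cong: continuous_on_cong)
next
  case (Suc k)
  have "g differentiable at x" if "x \<in> S" for x
  proof -
    obtain D where "(f has_derivative D) (at x)"
      using Suc.prems(1) \<open>x \<in> S\<close> by (auto simp: differentiable_def)
    then have "(g has_derivative D) (at x)"
      using has_derivative_cong_open[OF assms(1) that, of f g D] Suc.prems(2) by blast
    then show ?thesis by (auto simp: differentiable_def)
  qed
  moreover have "Ck_on k S (\<lambda>x. frechet_derivative g (at x) v)" for v
    by (rule Suc.IH[of "\<lambda>x. frechet_derivative f (at x) v"])
      (use Suc.prems frechet_derivative_cong_open[OF assms(1), of _ f g] in auto)
  ultimately show ?case by simp
qed

text \<open>\<open>Ck_on\<close> is phrased with \<open>frechet_derivative\<close>, a choice
  operator; uniqueness of derivatives lets any explicitly given derivative take its place. The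
  differentiation rules below enter through this form.\<close>

lemma Ck_on_SucI:
  assumes "open S" and der: "\<And>x. x \<in> S \<Longrightarrow> (f has_derivative F x) (at x)"
    and C: "\<And>v. Ck_on k S (\<lambda>x. F x v)"
  shows "Ck_on (Suc k) S f"
proof -
  have "Ck_on k S (\<lambda>x. frechet_derivative f (at x) v)" for v
  proof (rule Ck_on_cong[OF assms(1) C])
    fix x assume "x \<in> S"
    then show "F x v = frechet_derivative f (at x) v"
      using frechet_derivative_at[OF der] by metis
  qed
  then show ?thesis
    using der by (auto simp: differentiable_def)
qed

lemma Ck_on_has_derivative:
  "Ck_on (Suc k) S f \<Longrightarrow> x \<in> S \<Longrightarrow> (f has_derivative frechet_derivative f (at x)) (at x)"
  by (simp add: frechet_derivative_works)

lemma Ck_on_subset: "Ck_on k S f \<Longrightarrow> T \<subseteq> S \<Longrightarrow> Ck_on k T f"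
  by (induction k arbitrary: f) (auto intro: continuous_on_subset)

text \<open>Continuity and differentiability at a point are decided on any neighbourhood of it, so
  smoothness can be checked one point at a time. This later turns chartwise smoothness into a
  property of germs.\<close>

lemma Ck_on_local:
  assumes "\<And>x. x \<in> S \<Longrightarrow> \<exists>T. open T \<and> x \<in> T \<and> Ck_on k T f"
  shows "Ck_on k S f"
  using assms
proof (induction k arbitrary: f)
  case 0
  show ?case
    unfolding Ck_on.simps
  proof (rule continuous_at_imp_continuous_on, rule ballI)
    fix x assume "x \<in> S"
    with 0 obtain T where "open T" "x \<in> T" "continuous_on T f" by auto
    then show "isCont f x" by (simp add: continuous_on_eq_continuous_at)
  qed
next
  case (Suc k)
  have "f differentiable at x" if "x \<in> S" for x
    using Suc.prems[OF that] by auto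
  moreover have "Ck_on k S (\<lambda>x. frechet_derivative f (at x) v)" for v
    by (rule Suc.IH) (use Suc.prems in force)
  ultimately show ?case by simp
qed

text \<open>The only content is that differentiable maps are continuous. Product and chain rules
  need the loss of one order for the factor that stays undifferentiated.\<close>

lemma Ck_on_SucD: "Ck_on (Suc k) S f \<Longrightarrow> Ck_on k S f"
proof (induction k arbitrary: f)
  case 0
  then show ?case
    by (auto intro!: continuous_at_imp_continuous_on differentiable_imp_continuous_within)
qed auto

lemma Ck_on_const: "Ck_on k S (\<lambda>x. c)"
  by (induction k arbitrary: c) auto

lemma Ck_on_bounded_linear:
  assumes "bounded_linear L" "open S" "Ck_on k S f"
  shows "Ck_on k S (\<lambda>x. L (f x))"
  using assms(3)
proof (induction k arbitrary: f)
  case 0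
  then show ?case
    using assms(1) by (simp add: bounded_linear.continuous_on)
next
  case (Suc k)
  show ?case
  proof (rule Ck_on_SucI[OF assms(2)])
    show "((\<lambda>x. L (f x)) has_derivative (\<lambda>v. L (frechet_derivative f (at x) v))) (at x)"
      if "x \<in> S" for x
      by (rule bounded_linear.has_derivative[OF assms(1) Ck_on_has_derivative[OF Suc.prems that]])
    show "Ck_on k S (\<lambda>x. L (frechet_derivative f (at x) v))" for v
      using Suc.prems by (intro Suc.IH) simp
  qed
qed

lemma Ck_on_add:
  assumes "open S" "Ck_on k S f" "Ck_on k S g"
  shows "Ck_on k S (\<lambda>x. f x + g x)"
  using assms(2,3)
proof (induction k arbitrary: f g)
  case 0
  then show ?case by (auto intro: continuous_intros)
next
  case (Suc k)
  show ?case
  proof (rule Ck_on_SucI[OF assms(1)])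
    show "((\<lambda>x. f x + g x) has_derivative
        (\<lambda>v. frechet_derivative f (at x) v + frechet_derivative g (at x) v)) (at x)"
      if "x \<in> S" for x
      by (rule has_derivative_add[OF Ck_on_has_derivative[OF Suc.prems(1) that]
            Ck_on_has_derivative[OF Suc.prems(2) that]])
    show "Ck_on k S (\<lambda>x. frechet_derivative f (at x) v + frechet_derivative g (at x) v)" for v
      using Suc.prems by (intro Suc.IH) simp_all
  qed
qed

lemma Ck_on_bilinear:
  assumes "bounded_bilinear B" "open S" "Ck_on k S f" "Ck_on k S g"
  shows "Ck_on k S (\<lambda>x. B (f x) (g x))"
  using assms(3,4)
proof (induction k arbitrary: f g)
  case 0
  then show ?case by (auto intro: bounded_bilinear.continuous_on[OF assms(1)])
next
  case (Suc k)
  show ?case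
  proof (rule Ck_on_SucI[OF assms(2)])
    show "((\<lambda>x. B (f x) (g x)) has_derivative
        (\<lambda>v. B (f x) (frechet_derivative g (at x) v) + B (frechet_derivative f (at x) v) (g x))) (at x)"
      if "x \<in> S" for x
      by (rule bounded_bilinear.FDERIV[OF assms(1) Ck_on_has_derivative[OF Suc.prems(1) that]
            Ck_on_has_derivative[OF Suc.prems(2) that]])
    \<comment> \<open>Each summand is again \<open>B\<close> of two maps, one of them
      undifferentiated and lowered by one order, so the induction hypothesis applies to
      both.\<close>
    show "Ck_on k S (\<lambda>x. B (f x) (frechet_derivative g (at x) v) + B (frechet_derivative f (at x) v) (g x))" for v
      using Suc.prems Ck_on_SucD[OF Suc.prems(1)] Ck_on_SucD[OF Suc.prems(2)]
      by (intro Ck_on_add[OF assms(2)] Suc.IH) simp_all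
  qed
qed

lemma Ck_on_sum:
  assumes "open S" "\<And>i. i \<in> I \<Longrightarrow> Ck_on k S (f i)"
  shows "Ck_on k S (\<lambda>x. \<Sum>i\<in>I. f i x)"
proof (cases "finite I")
  case True
  then show ?thesis using assms(2)
    by (induction I) (auto intro: Ck_on_const Ck_on_add[OF assms(1)])
qed (simp add: Ck_on_const)

lemma Ck_on_compose:
  fixes f :: "'a::euclidean_space \<Rightarrow> 'b::euclidean_space" and g :: "'b \<Rightarrow> 'c::real_normed_vector"
  assumes "open S" "open T" "f ` S \<subseteq> T" "Ck_on k S f" "Ck_on k T g"
  shows "Ck_on k S (\<lambda>x. g (f x))"
  using assms(4,5)
proof (induction k arbitrary: g)
  case 0
  then show ?case
    using assms(3) by (auto intro: continuous_on_compose2)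
next
  case (Suc k)
  have fT: "f x \<in> T" if "x \<in> S" for x
    using assms(3) that by auto
  show ?case
  proof (rule Ck_on_SucI[OF assms(1)])
    fix x assume x: "x \<in> S"
    have lin: "linear (frechet_derivative g (at (f x)))"
      by (rule has_derivative_linear[OF Ck_on_has_derivative[OF Suc.prems(2) fT[OF x]]])
    \<comment> \<open>In the chain rule both the base point and the direction depend on
      \<open>x\<close>, while \<open>Ck_on\<close> controls derivatives in a fixed direction only.
      Expanding the direction in \<open>Basis\<close> leaves sums of scalar factors times
      derivatives in fixed directions.\<close>
    have eq: "frechet_derivative g (at (f x)) w =
        (\<Sum>b\<in>Basis. (w \<bullet> b) *\<^sub>R frechet_derivative g (at (f x)) b)" for w
    proof -
      have "frechet_derivative g (at (f x)) w =
          frechet_derivative g (at (f x)) (\<Sum>b\<in>Basis. (w \<bullet> b) *\<^sub>R b)"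
        by (simp only: euclidean_representation)
      also have "\<dots> = (\<Sum>b\<in>Basis. (w \<bullet> b) *\<^sub>R frechet_derivative g (at (f x)) b)"
        by (simp only: linear_sum[OF lin] linear_scale[OF lin])
      finally show ?thesis .
    qed
    have "((\<lambda>x. g (f x)) has_derivative
        (\<lambda>v. frechet_derivative g (at (f x)) (frechet_derivative f (at x) v))) (at x)"
      by (rule has_derivative_compose[OF Ck_on_has_derivative[OF Suc.prems(1) x]
            Ck_on_has_derivative[OF Suc.prems(2) fT[OF x]]])
    then show "((\<lambda>x. g (f x)) has_derivative (\<lambda>v. \<Sum>b\<in>Basis.
        (frechet_derivative f (at x) v \<bullet> b) *\<^sub>R frechet_derivative g (at (f x)) b)) (at x)"
      by (rule has_derivative_eq_rhs) (rule ext, rule eq)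
  next
    fix v
    have "Ck_on k S (\<lambda>x. frechet_derivative g (at (f x)) b)" for b
      using Suc.prems Ck_on_SucD[OF Suc.prems(1)]
      by (intro Suc.IH[of "\<lambda>y. frechet_derivative g (at y) b"]) simp_all
    moreover have "Ck_on k S (\<lambda>x. frechet_derivative f (at x) v \<bullet> b)" for b
      using Suc.prems by (intro Ck_on_bounded_linear[OF bounded_linear_inner_left assms(1)]) simp
    ultimately show "Ck_on k S (\<lambda>x. \<Sum>b\<in>Basis.
      (frechet_derivative f (at x) v \<bullet> b) *\<^sub>R frechet_derivative g (at (f x)) b)"
      by (intro Ck_on_sum[OF assms(1)] Ck_on_bilinear[OF bounded_bilinear_scaleR assms(1)])
  qed
qed

section \<open>Closure properties of smooth maps\<close>

lemma smooth_on_cong: "open S \<Longrightarrow> smooth_on S f \<Longrightarrow> (\<And>x. x \<in> S \<Longrightarrow> f x = g x) \<Longrightarrow> smooth_on S g"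
  unfolding smooth_on_def using Ck_on_cong by blast

lemma smooth_on_subset: "smooth_on S f \<Longrightarrow> T \<subseteq> S \<Longrightarrow> smooth_on T f"
  unfolding smooth_on_def using Ck_on_subset by blast

lemma smooth_on_local:
  assumes "\<And>x. x \<in> S \<Longrightarrow> \<exists>T. open T \<and> x \<in> T \<and> smooth_on T f"
  shows "smooth_on S f"
  unfolding smooth_on_def using assms by (intro allI Ck_on_local) (auto simp: smooth_on_def)

lemma smooth_on_const: "smooth_on S (\<lambda>x. c)"
  unfolding smooth_on_def by (simp add: Ck_on_const)

lemma smooth_on_bounded_linear:
  "bounded_linear L \<Longrightarrow> open S \<Longrightarrow> smooth_on S f \<Longrightarrow> smooth_on S (\<lambda>x. L (f x))"
  unfolding smooth_on_def by (simp add: Ck_on_bounded_linear)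

lemma smooth_on_add:
  "open S \<Longrightarrow> smooth_on S f \<Longrightarrow> smooth_on S g \<Longrightarrow> smooth_on S (\<lambda>x. f x + g x)"
  unfolding smooth_on_def by (simp add: Ck_on_add)

lemma smooth_on_mult:
  fixes f g :: "'a::euclidean_space \<Rightarrow> real"
  shows "open S \<Longrightarrow> smooth_on S f \<Longrightarrow> smooth_on S g \<Longrightarrow> smooth_on S (\<lambda>x. f x * g x)"
  unfolding smooth_on_def by (simp add: Ck_on_bilinear[OF bounded_bilinear_mult])

lemma smooth_on_compose:
  fixes f :: "'a::euclidean_space \<Rightarrow> 'b::euclidean_space" and g :: "'b \<Rightarrow> 'c::real_normed_vector"
  assumes "open S" "open T" "f ` S \<subseteq> T" "smooth_on S f" "smooth_on T g"
  shows "smooth_on S (\<lambda>x. g (f x))"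
  using assms Ck_on_compose unfolding smooth_on_def by blast

lemma Ck_on_id: "Ck_on k S (\<lambda>x. x)"
proof (cases k)
  case (Suc k')
  then show ?thesis
    by (simp add: Ck_on_const frechet_derivative_at[OF has_derivative_ident, symmetric])
qed simp

lemma smooth_on_linear:
  fixes L :: "'a::euclidean_space \<Rightarrow> 'b::real_normed_vector"
  assumes "bounded_linear L"
  shows "smooth_on S L"
  using smooth_on_bounded_linear[OF assms open_UNIV, of "\<lambda>x. x"] Ck_on_id smooth_on_subset
  unfolding smooth_on_def by blast

lemma smooth_on_differentiable: "smooth_on S f \<Longrightarrow> x \<in> S \<Longrightarrow> f differentiable at x"
  unfolding smooth_on_def using Ck_on.simps(2) by blast

lemma smooth_on_frechet_derivative:
  "smooth_on S f \<Longrightarrow> smooth_on S (\<lambda>x. frechet_derivative f (at x) v)"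
  unfolding smooth_on_def using Ck_on.simps(2) by blast

lemma smooth_on_continuous_on: "smooth_on S f \<Longrightarrow> continuous_on S f"
  unfolding smooth_on_def using Ck_on.simps(1) by blast

subsection \<open>Hadamard's lemma\<close>

text \<open>The weight \<open>t ^ m\<close> makes the family closed under differentiation in \<open>x\<close>.\<close>

lemma smooth_on_radial_integral:
  fixes h :: "'a::euclidean_space \<Rightarrow> real"
  assumes "smooth_on (ball a r) h"
  shows "smooth_on (ball a r) (\<lambda>x. integral {0..1} (\<lambda>t. t ^ m * h (a + t *\<^sub>R (x - a))))"
proof -
  \<comment> \<open>A ball is star-shaped about its centre, so the whole segment of integration
    stays where \<open>h\<close> is smooth.\<close>
  have inb: "a + t *\<^sub>R (x - a) \<in> ball a r" if "x \<in> ball a r" "t \<in> {0..1}" for x t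
  proof -
    have "t * norm (x - a) \<le> 1 * norm (x - a)"
      using that(2) by (intro mult_right_mono) auto
    then show ?thesis
      using that by (auto simp: dist_norm norm_minus_commute)
  qed
  have cont: "continuous_on (ball a r \<times> {0..1}) (\<lambda>(x, t). t ^ n * g (a + t *\<^sub>R (x - a)))"
    if g: "smooth_on (ball a r) g" for g :: "'a \<Rightarrow> real" and n
  proof -
    have "continuous_on (ball a r \<times> {0..1}) (\<lambda>z. g (a + snd z *\<^sub>R (fst z - a)))"
      by (rule continuous_on_compose2[OF smooth_on_continuous_on[OF g]])
        (use inb in \<open>auto intro!: continuous_intros\<close>)
    then show ?thesis
      unfolding case_prod_beta by (intro continuous_intros)
  qed
  have der: "((\<lambda>x. integral {0..1} (\<lambda>t. t ^ n * g (a + t *\<^sub>R (x - a)))) has_derivative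
      (\<lambda>v. integral {0..1} (\<lambda>t. t ^ Suc n * frechet_derivative g (at (a + t *\<^sub>R (x - a))) v))) (at x)"
    if g: "smooth_on (ball a r) g" and x: "x \<in> ball a r" for g :: "'a \<Rightarrow> real" and n x
  proof -
    \<comment> \<open>Differentiation under the integral asks for the derivative as a continuous
      family of bounded operators. \<open>Blinfun\<close> is meaningful only where its argument is
      bounded linear, hence the side conditions of the fact \<open>G\<close>.\<close>
    define G where "G = (\<lambda>x t. Blinfun (\<lambda>v. t ^ Suc n * frechet_derivative g (at (a + t *\<^sub>R (x - a))) v))"
    have bl: "bounded_linear (\<lambda>v. t ^ Suc n * frechet_derivative g (at (a + t *\<^sub>R (x - a))) v)"
      if "x \<in> ball a r" "t \<in> {0..1}" for x t
      using smooth_on_differentiable[OF g inb[OF that]]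
      by (intro bounded_linear_const_mult) (simp add: frechet_derivative_works has_derivative_bounded_linear)
    have G: "blinfun_apply (G x t) = (\<lambda>v. t ^ Suc n * frechet_derivative g (at (a + t *\<^sub>R (x - a))) v)"
      if "x \<in> ball a r" "t \<in> {0..1}" for x t
      unfolding G_def using bl[OF that] by (rule bounded_linear_Blinfun_apply)
    have contG: "continuous_on (ball a r \<times> {0..1}) (\<lambda>(x, t). G x t)"
      unfolding case_prod_beta
    \<comment> \<open>In finite dimension, continuity in operator norm reduces to continuity at each
      basis vector.\<close>
    proof (rule continuous_on_blinfun_componentwise)
      fix i :: 'a
      have "continuous_on (ball a r \<times> {0..1})
          (\<lambda>(x, t). t ^ Suc n * frechet_derivative g (at (a + t *\<^sub>R (x - a))) i)"
        by (rule cont[OF smooth_on_frechet_derivative[OF g]])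
      then show "continuous_on (ball a r \<times> {0..1}) (\<lambda>z. blinfun_apply (G (fst z) (snd z)) i)"
        by (rule continuous_on_eq) (auto simp: G)
    qed
    have "((\<lambda>x. integral (cbox 0 1) (\<lambda>t. t ^ n * g (a + t *\<^sub>R (x - a)))) has_derivative
        integral (cbox 0 1) (G x)) (at x within ball a r)"
    proof (rule leibniz_rule)
      fix y t assume y: "y \<in> ball a r" and t: "t \<in> cbox 0 (1::real)"
      then have t': "t \<in> {0..1}" by simp
      have g': "(g has_derivative frechet_derivative g (at (a + t *\<^sub>R (y - a)))) (at (a + t *\<^sub>R (y - a)))"
        using smooth_on_differentiable[OF g inb[OF y t']] by (simp add: frechet_derivative_works)
      then interpret D: bounded_linear "frechet_derivative g (at (a + t *\<^sub>R (y - a)))"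
        by (rule has_derivative_bounded_linear)
      \<comment> \<open>The inner map has derivative \<open>t *\<^sub>R v\<close>; pulling this
        \<open>t\<close> out raises the weight from \<open>n\<close> to
        \<open>Suc n\<close>.\<close>
      have "((\<lambda>y. t ^ n * g (a + t *\<^sub>R (y - a))) has_derivative
          (\<lambda>v. t ^ n * frechet_derivative g (at (a + t *\<^sub>R (y - a))) (t *\<^sub>R v))) (at y within ball a r)"
        by (rule has_derivative_mult_right)
          (rule has_derivative_compose[where f = "\<lambda>y. a + t *\<^sub>R (y - a)" and g = g, OF _ g'], auto intro!: derivative_eq_intros)
      then show "((\<lambda>y. t ^ n * g (a + t *\<^sub>R (y - a))) has_derivative blinfun_apply (G y t)) (at y within ball a r)"
        by (simp add: G[OF y t'] D.scale mult_ac)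
    next
      fix y assume y: "y \<in> ball a r"
      have "continuous_on {0..1} (\<lambda>t. case (y, t) of (x, t) \<Rightarrow> t ^ n * g (a + t *\<^sub>R (x - a)))"
        by (rule continuous_on_compose2[OF cont[OF g]]) (use y in \<open>auto intro!: continuous_intros\<close>)
      then show "(\<lambda>t. t ^ n * g (a + t *\<^sub>R (y - a))) integrable_on cbox 0 1"
        by (auto intro!: integrable_continuous_interval)
    qed (use x contG in auto)
    moreover have "blinfun_apply (integral (cbox 0 1) (G x)) v = 
        integral {0..1} (\<lambda>t. t ^ Suc n * frechet_derivative g (at (a + t *\<^sub>R (x - a))) v)" for v
    proof -
      have "continuous_on {0..1} (\<lambda>t. case (x, t) of (x, t) \<Rightarrow> G x t)"
        by (rule continuous_on_compose2[OF contG]) (use x in \<open>auto intro!: continuous_intros\<close>)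
      then have "G x integrable_on cbox 0 1"
        by (auto intro!: integrable_continuous_interval)
      then have "blinfun_apply (integral (cbox 0 1) (G x)) v = integral (cbox 0 1) (\<lambda>t. blinfun_apply (G x t) v)"
        by (rule blinfun_apply_integral)
      also have "\<dots> = integral {0..1} (\<lambda>t. t ^ Suc n * frechet_derivative g (at (a + t *\<^sub>R (x - a))) v)"
        unfolding cbox_interval by (rule integral_cong) (simp only: G[OF x])
      finally show ?thesis .
    qed
    ultimately show ?thesis
      unfolding at_within_open[OF x open_ball] cbox_interval
      by (elim has_derivative_eq_rhs) (rule ext)
  qed
  \<comment> \<open>Differentiation changes both weight and integrand, so the induction is general
    in \<open>n\<close> and \<open>g\<close>.\<close>
  have "Ck_on k (ball a r) (\<lambda>x. integral {0..1} (\<lambda>t. t ^ n * g (a + t *\<^sub>R (x - a))))"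
    if "smooth_on (ball a r) g" for g :: "'a \<Rightarrow> real" and n k
    using that
  proof (induction k arbitrary: n g)
    case 0
    have "isCont (\<lambda>x. integral {0..1} (\<lambda>t. t ^ n * g (a + t *\<^sub>R (x - a)))) x" if "x \<in> ball a r" for x
      using der[OF 0 that] by (rule has_derivative_continuous)
    then show ?case by (auto intro: continuous_at_imp_continuous_on)
  next
    case (Suc k)
    show ?case
      by (rule Ck_on_SucI[OF open_ball der[OF Suc.prems]])
        (assumption, rule Suc.IH[OF smooth_on_frechet_derivative[OF Suc.prems]])
  qed
  then show ?thesis using assms by (auto simp: smooth_on_def)
qed

text \<open>By the fundamental theorem along the segment from \<open>a\<close> to \<open>x\<close>,
  the difference \<open>f x - f a\<close> is the integral of the derivative in direction
  \<open>x - a\<close>, which linearity splits into coordinates. The functions \<open>g i\<close>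
  are averages of partial derivatives along the segment, hence smooth, and at \<open>x = a\<close>
  the average is over a constant.\<close>

lemma hadamard:
  fixes f :: "real ^ 'n::finite \<Rightarrow> real"
  assumes f: "smooth_on (ball a r) f"
  shows "\<exists>g. (\<forall>i. smooth_on (ball a r) (g i) \<and> g i a = frechet_derivative f (at a) (axis i 1)) \<and>
    (\<forall>x\<in>ball a r. f x = f a + (\<Sum>i\<in>UNIV. (x $ i - a $ i) * g i x))"
proof -
  define g where "g = (\<lambda>i x. integral {0..1} (\<lambda>t. frechet_derivative f (at (a + t *\<^sub>R (x - a))) (axis i 1)))"
  have "smooth_on (ball a r) (g i)" for i
    using smooth_on_radial_integral[OF smooth_on_frechet_derivative[OF f], of 0 "axis i 1"]
    by (simp add: g_def)
  moreover have "g i a = frechet_derivative f (at a) (axis i 1)" for i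
    by (simp add: g_def)
  moreover have "f x = f a + (\<Sum>i\<in>UNIV. (x $ i - a $ i) * g i x)" if x: "x \<in> ball a r" for x
  proof -
    have inb: "a + t *\<^sub>R (x - a) \<in> ball a r" if "t \<in> {0..1}" for t
    proof -
      have "t * norm (x - a) \<le> 1 * norm (x - a)"
        using that by (intro mult_right_mono) auto
      then show ?thesis
        using that x by (auto simp: dist_norm norm_minus_commute)
    qed
    have D: "(f has_derivative frechet_derivative f (at (a + t *\<^sub>R (x - a)))) (at (a + t *\<^sub>R (x - a)))"
      if "t \<in> {0..1}" for t
      using smooth_on_differentiable[OF f inb[OF that]] by (simp add: frechet_derivative_works)
    have lin: "frechet_derivative f (at (a + t *\<^sub>R (x - a))) (x - a) =
       (\<Sum>i\<in>UNIV. (x $ i - a $ i) * frechet_derivative f (at (a + t *\<^sub>R (x - a))) (axis i 1))"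
      if "t \<in> {0..1}" for t
    proof -
      have lin: "linear (frechet_derivative f (at (a + t *\<^sub>R (x - a))))"
        by (rule has_derivative_linear[OF D[OF that]])
      have "frechet_derivative f (at (a + t *\<^sub>R (x - a))) (x - a) =
          frechet_derivative f (at (a + t *\<^sub>R (x - a))) (\<Sum>i\<in>UNIV. (x - a) $ i *s axis i 1)"
        by (simp only: basis_expansion)
      also have "\<dots> = (\<Sum>i\<in>UNIV. (x - a) $ i * frechet_derivative f (at (a + t *\<^sub>R (x - a))) (axis i 1))"
        by (simp only: linear_sum[OF lin] linear_scale[OF lin] scalar_mult_eq_scaleR real_scaleR_def)
      finally show ?thesis by simp
    qed
    have "((\<lambda>t. frechet_derivative f (at (a + t *\<^sub>R (x - a))) (x - a)) has_integral
       f (a + 1 *\<^sub>R (x - a)) - f (a + 0 *\<^sub>R (x - a))) {0..1}"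
    proof (rule fundamental_theorem_of_calculus)
      fix t :: real assume t: "t \<in> {0..1}"
      interpret D: bounded_linear "frechet_derivative f (at (a + t *\<^sub>R (x - a)))"
        using D[OF t] by (rule has_derivative_bounded_linear)
      have "((\<lambda>t. f (a + t *\<^sub>R (x - a))) has_derivative
         (\<lambda>s. frechet_derivative f (at (a + t *\<^sub>R (x - a))) (s *\<^sub>R (x - a)))) (at t within {0..1})"
        by (rule has_derivative_compose[where f = "\<lambda>t. a + t *\<^sub>R (x - a)" and g = f, OF _ D[OF t]]) (auto intro!: derivative_eq_intros)
      then show "((\<lambda>t. f (a + t *\<^sub>R (x - a))) has_vector_derivative
         frechet_derivative f (at (a + t *\<^sub>R (x - a))) (x - a)) (at t within {0..1})"
        by (simp add: has_vector_derivative_def D.scale)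
    qed simp
    then have "f x - f a = integral {0..1} (\<lambda>t. frechet_derivative f (at (a + t *\<^sub>R (x - a))) (x - a))"
      by (simp add: integral_unique)
    also have "\<dots> = integral {0..1} (\<lambda>t. \<Sum>i\<in>UNIV. (x $ i - a $ i) *
        frechet_derivative f (at (a + t *\<^sub>R (x - a))) (axis i 1))"
      by (rule integral_cong) (rule lin)
    also have "\<dots> = (\<Sum>i\<in>UNIV. (x $ i - a $ i) * g i x)"
    proof (subst integral_sum)
      fix i :: 'n
      have "continuous_on {0..1} (\<lambda>t. frechet_derivative f (at (a + t *\<^sub>R (x - a))) (axis i 1))"
        by (rule continuous_on_compose2[OF smooth_on_continuous_on[OF smooth_on_frechet_derivative[OF f]]])
          (use inb in \<open>auto intro!: continuous_intros\<close>)
      then show "(\<lambda>t. (x $ i - a $ i) * frechet_derivative f (at (a + t *\<^sub>R (x - a))) (axis i 1)) integrable_on {0..1}"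
        by (intro integrable_continuous_interval continuous_intros)
    qed (auto simp: g_def)
    finally show ?thesis by simp
  qed
  ultimately show ?thesis by blast
qed

subsection \<open>Bump functions\<close>

text \<open>The powers of \<open>1/t\<close> make the family closed under differentiation, also at \<open>0\<close>.\<close>

definition flat_exp :: "nat \<Rightarrow> real \<Rightarrow> real" where
  "flat_exp n t = (if t > 0 then inverse t ^ n * exp (- inverse t) else 0)"

text \<open>With \<open>x = 1 / t\<close> this says that the exponential beats every power at
  infinity; on the left the function is zero.\<close>

lemma flat_exp_tendsto_0: "(flat_exp n \<longlongrightarrow> 0) (at 0)"
proof -
  have "((\<lambda>x::real. x ^ n / exp x) \<longlongrightarrow> 0) at_top"
    by (rule tendsto_power_div_exp_0)
  then have "((\<lambda>t::real. (inverse t) ^ n / exp (inverse t)) \<longlongrightarrow> 0) (at_right 0)"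
    by (rule filterlim_compose[OF _ filterlim_inverse_at_top_right])
  then have "(flat_exp n \<longlongrightarrow> 0) (at_right 0)"
    by (rule Lim_transform_eventually)
      (auto simp: flat_exp_def eventually_at_right_field exp_minus divide_inverse intro: exI[of _ 1])
  moreover have "(flat_exp n \<longlongrightarrow> 0) (at_left 0)"
    by (rule Lim_transform_eventually[of "\<lambda>_. 0"])
      (auto simp: flat_exp_def eventually_at_left_field intro: exI[of _ "-1"])
  ultimately show ?thesis by (simp add: filterlim_at_split)
qed

lemma flat_exp_has_derivative:
  "(flat_exp n has_real_derivative (flat_exp (Suc (Suc n)) t - n * flat_exp (Suc n) t)) (at t)"
proof -
  consider "t > 0" | "t < 0" | "t = 0" by linarith
  then show ?thesis
  proof cases
    case 1
    have inv: "(inverse has_real_derivative - (inverse t * inverse t)) (at t)"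
      using DERIV_inverse[of t] 1 by (simp add: power2_eq_square)
    have "((\<lambda>t. inverse t ^ n * exp (- inverse t)) has_real_derivative
        (real n * (- (inverse t * inverse t) * inverse t ^ (n - 1)) * exp (- inverse t)
         + exp (- inverse t) * - (- (inverse t * inverse t)) * inverse t ^ n)) (at t)"
      using DERIV_mult[OF DERIV_power[OF inv, of n] DERIV_fun_exp[OF DERIV_minus[OF inv]]] by simp
    also have "real n * (- (inverse t * inverse t) * inverse t ^ (n - 1)) * exp (- inverse t)
         + exp (- inverse t) * - (- (inverse t * inverse t)) * inverse t ^ n
         = flat_exp (Suc (Suc n)) t - n * flat_exp (Suc n) t"
      \<comment> \<open>For \<open>n = 0\<close> the truncated exponent \<open>n - 1\<close> is
        harmless because of the factor \<open>real n\<close>.\<close>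
      using 1 by (cases n) (simp_all add: flat_exp_def algebra_simps)
    finally show ?thesis
      by (rule has_field_derivative_transform_within_open[of _ _ _ "{0<..}"])
        (use 1 in \<open>auto simp: flat_exp_def\<close>)
  next
    case 2
    have "((\<lambda>t. 0) has_real_derivative (flat_exp (Suc (Suc n)) t - n * flat_exp (Suc n) t)) (at t)"
      using 2 by (simp add: flat_exp_def)
    then show ?thesis
      by (rule has_field_derivative_transform_within_open[of _ _ _ "{..<0}"])
        (use 2 in \<open>auto simp: flat_exp_def\<close>)
  next
    case 3
    \<comment> \<open>The difference quotient at 0 is the next member of the family, so its limit is
      already known.\<close>
    have "(flat_exp n (0 + h) - flat_exp n 0) / h = flat_exp (Suc n) h" for h
      by (simp add: flat_exp_def divide_inverse)
    then have "(flat_exp n has_real_derivative 0) (at 0)"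
      using flat_exp_tendsto_0[of "Suc n"] unfolding DERIV_def by (simp only:)
    then show ?thesis using 3 by (simp add: flat_exp_def)
  qed
qed

lemma smooth_on_flat_exp: "smooth_on S (flat_exp n)"
proof -
  have "Ck_on k UNIV (flat_exp n)" for k
  proof (induction k arbitrary: n)
    case 0
    then show ?case
      using DERIV_isCont[OF flat_exp_has_derivative]
      by (auto intro!: continuous_at_imp_continuous_on)
  next
    case (Suc k)
    have "(flat_exp n has_derivative
        (\<lambda>v. (flat_exp (Suc (Suc n)) t - n * flat_exp (Suc n) t) * v)) (at t)" for t
      using flat_exp_has_derivative[of n t] by (simp add: has_field_derivative_def)
    note der = this
    have "Ck_on k UNIV (\<lambda>t. (flat_exp (Suc (Suc n)) t + flat_exp (Suc n) t * (- real n)) * v)" for v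
      by (intro Ck_on_bounded_linear[OF bounded_linear_mult_left] Ck_on_add Suc.IH open_UNIV)
    then have "Ck_on k UNIV (\<lambda>t. (flat_exp (Suc (Suc n)) t - n * flat_exp (Suc n) t) * v)" for v
      by (simp add: mult.commute[of _ "real n"])
    then show ?case by (rule Ck_on_SucI[OF open_UNIV der])
  qed
  then show ?thesis
    unfolding smooth_on_def by (auto intro: Ck_on_subset)
qed

lemma smooth_bump:
  fixes a :: "'a::euclidean_space"
  assumes "r > 0"
  obtains b :: "'a \<Rightarrow> real"
  where "\<And>S. smooth_on S b" "b a \<noteq> 0" "\<And>x. x \<notin> cball a r \<Longrightarrow> b x = 0"
proof
  \<comment> \<open>The quadratic is positive exactly on the open ball around \<open>a\<close>.
    Smoothness of \<open>flat_exp 0\<close> at 0 then gives smoothness of the composite across the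
    bounding sphere.\<close>
  let ?q = "\<lambda>x. r\<^sup>2 + (- 1) * ((x - a) \<bullet> (x - a))"
  have lin: "smooth_on UNIV (\<lambda>x. x - a)"
    unfolding diff_conv_add_uminus
    by (intro smooth_on_add smooth_on_const smooth_on_linear bounded_linear_ident open_UNIV)
  then have "smooth_on UNIV (\<lambda>x. (x - a) \<bullet> (x - a))"
    unfolding smooth_on_def by (auto intro!: Ck_on_bilinear[OF bounded_bilinear_inner])
  then have "smooth_on UNIV ?q"
    by (intro smooth_on_add smooth_on_mult smooth_on_const open_UNIV)
  then have *: "smooth_on UNIV (\<lambda>x. flat_exp 0 (?q x))"
    by (rule smooth_on_compose[OF open_UNIV open_UNIV _ _ smooth_on_flat_exp, rotated]) simp
  show "smooth_on S (\<lambda>x. flat_exp 0 (?q x))" for S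
    using smooth_on_subset[OF *] by simp
  show "flat_exp 0 (?q a) \<noteq> 0" using assms by (simp add: flat_exp_def)
  show "flat_exp 0 (?q x) = 0" if "x \<notin> cball a r" for x
  proof -
    have "r\<^sup>2 < (norm (x - a))\<^sup>2"
      using that assms by (intro power_strict_mono) (auto simp: dist_norm norm_minus_commute)
    then show ?thesis by (simp add: flat_exp_def power2_norm_eq_inner)
  qed
qed

text \<open>Vectors and covectors are HOL functions, so an expansion in a frame is a sum in a
  function type and has to be evaluated argumentwise.\<close>

lemma sum_fun_apply: "(\<Sum>i\<in>I. f i) x = (\<Sum>i\<in>I. f i x)"
  for f :: "'i \<Rightarrow> 'a \<Rightarrow> 'b::comm_monoid_add"
  by (induction I rule: infinite_finite_induct) auto

section \<open>Germs of functions, vector fields and forms on a manifold\<close>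

locale smooth_manifold =
  fixes A :: "('m::{t2_space, second_countable_topology}, 'n::finite) chart set"
  assumes smooth_structure: "smooth_structure A"
begin

lemma chart_cover: obtains c where "c \<in> A" "p \<in> fst c"
proof -
  have "p \<in> (\<Union>c\<in>A. fst c)"
    using smooth_structure by (simp add: smooth_structure_def)
  then show ?thesis using that by auto
qed

context
  fixes c assumes c: "c \<in> A"
begin

lemma chart: "open (fst c)" "open (snd c ` fst c)"
    "homeomorphism (fst c) (snd c ` fst c) (snd c) (chart_inv c)"
  using smooth_structure c by (auto simp: smooth_structure_def is_chart_def)

lemma chart_inv_chart: "q \<in> fst c \<Longrightarrow> chart_inv c (snd c q) = q"
  using chart(3) by (simp add: homeomorphism_def)

lemma chart_continuous: "continuous_on (fst c) (snd c)"
  using chart(3) by (simp add: homeomorphism_def)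

lemma open_chart_image:
  assumes "open W" "W \<subseteq> fst c"
  shows "open (snd c ` W)"
proof -
  have "openin (top_of_set (fst c)) W"
    using assms by (simp add: openin_open_eq chart)
  then have "openin (top_of_set (snd c ` fst c)) (snd c ` W)"
    by (rule homeomorphism_imp_open_map[OF chart(3)])
  then show ?thesis by (simp add: openin_open_eq chart)
qed

lemma open_chart_vimage: "open T \<Longrightarrow> open {q \<in> fst c. snd c q \<in> T}"
  using continuous_open_preimage[OF chart_continuous chart(1), of T]
  by (simp add: vimage_def Int_def)

lemma smooth_transition:
  assumes "d \<in> A"
  shows "smooth_on (snd d ` (fst d \<inter> fst c)) (snd c \<circ> chart_inv d)"
  using smooth_structure c assms by (auto simp: smooth_structure_def smooth_compatible_def)

end

text \<open>\<open>smooth_fun\<close> tests every chart of the atlas; since transition maps are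
  smooth, one chart around \<open>p\<close> decides, after shrinking to a neighbourhood inside its
  domain.\<close>

lemma smooth_near_iff:
  assumes c: "c \<in> A" and p: "p \<in> fst c"
  shows "smooth_near A p f \<longleftrightarrow>
    (\<exists>W. open W \<and> p \<in> W \<and> W \<subseteq> fst c \<and> smooth_on (snd c ` W) (f \<circ> chart_inv c))"
proof
  assume "smooth_near A p f"
  then obtain U where "open U" "p \<in> U" "smooth_fun A U f"
    by (auto simp: smooth_near_def)
  then show "\<exists>W. open W \<and> p \<in> W \<and> W \<subseteq> fst c \<and> smooth_on (snd c ` W) (f \<circ> chart_inv c)"
    using c p chart(1)[OF c] by (intro exI[of _ "fst c \<inter> U"]) (auto simp: smooth_fun_def)
next
  assume "\<exists>W. open W \<and> p \<in> W \<and> W \<subseteq> fst c \<and> smooth_on (snd c ` W) (f \<circ> chart_inv c)"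
  then obtain W where W: "open W" "p \<in> W" "W \<subseteq> fst c" "smooth_on (snd c ` W) (f \<circ> chart_inv c)"
    by blast
  have "smooth_on (snd d ` (fst d \<inter> W)) (f \<circ> chart_inv d)" if d: "d \<in> A" for d
  proof (rule smooth_on_cong)
    show o: "open (snd d ` (fst d \<inter> W))"
      by (rule open_chart_image[OF d]) (use W chart(1)[OF d] in auto)
    show "smooth_on (snd d ` (fst d \<inter> W)) (\<lambda>x. (f \<circ> chart_inv c) ((snd c \<circ> chart_inv d) x))"
    proof (rule smooth_on_compose[OF o open_chart_image[OF c W(1,3)] _ _ W(4)])
      show "(snd c \<circ> chart_inv d) ` snd d ` (fst d \<inter> W) \<subseteq> snd c ` W"
        by (auto simp: chart_inv_chart[OF d])
      show "smooth_on (snd d ` (fst d \<inter> W)) (snd c \<circ> chart_inv d)"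
        by (rule smooth_on_subset[OF smooth_transition[OF c d]]) (use W in auto)
    qed
  qed (use W in \<open>auto simp: chart_inv_chart[OF c] chart_inv_chart[OF d] subset_iff\<close>)
  then show "smooth_near A p f"
    using W by (auto simp: smooth_near_def smooth_fun_def)
qed

lemma smooth_near_eventually: "smooth_near A p f \<Longrightarrow> \<forall>\<^sub>F q in nhds p. smooth_near A q f"
  unfolding smooth_near_def eventually_nhds by blast

lemma smooth_fun_iff:
  assumes "open U"
  shows "smooth_fun A U f \<longleftrightarrow> (\<forall>p\<in>U. smooth_near A p f)"
proof
  assume "smooth_fun A U f"
  then show "\<forall>p\<in>U. smooth_near A p f"
    using assms by (auto simp: smooth_near_def)
next
  assume R: "\<forall>p\<in>U. smooth_near A p f"
  show "smooth_fun A U f"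
    unfolding smooth_fun_def
  proof (intro ballI smooth_on_local)
    fix c x assume c: "c \<in> A" and "x \<in> snd c ` (fst c \<inter> U)"
    then obtain p where p: "p \<in> fst c" "p \<in> U" "x = snd c p" by auto
    then obtain W where W: "open W" "p \<in> W" "W \<subseteq> fst c" "smooth_on (snd c ` W) (f \<circ> chart_inv c)"
      using R smooth_near_iff[OF c p(1)] by blast
    then show "\<exists>T. open T \<and> x \<in> T \<and> smooth_on T (f \<circ> chart_inv c)"
      using p open_chart_image[OF c W(1,3)] by blast
  qed
qed

text \<open>Smoothness belongs to the germ. A formula valid only inside a chart can thus stand for a
  function with arbitrary values elsewhere.\<close>

lemma smooth_near_cong:
  assumes "smooth_near A p f" "\<forall>\<^sub>F q in nhds p. f q = g q"
  shows "smooth_near A p g"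
proof -
  obtain c where c: "c \<in> A" "p \<in> fst c" by (rule chart_cover)
  obtain W where W: "open W" "p \<in> W" "W \<subseteq> fst c" "smooth_on (snd c ` W) (f \<circ> chart_inv c)"
    using assms(1) smooth_near_iff[OF c] by blast
  obtain V where V: "open V" "p \<in> V" "\<And>q. q \<in> V \<Longrightarrow> f q = g q"
    using assms(2) unfolding eventually_nhds by blast
  have "smooth_on (snd c ` (W \<inter> V)) (g \<circ> chart_inv c)"
  proof (rule smooth_on_cong)
    show "open (snd c ` (W \<inter> V))"
      by (rule open_chart_image[OF c(1)]) (use W V in auto)
    show "smooth_on (snd c ` (W \<inter> V)) (f \<circ> chart_inv c)"
      by (rule smooth_on_subset[OF W(4)]) auto
  qed (use W V in \<open>auto simp: chart_inv_chart[OF c(1)] subset_iff\<close>)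
  moreover have "open (W \<inter> V)" "p \<in> W \<inter> V" "W \<inter> V \<subseteq> fst c"
    using W V by auto
  ultimately show ?thesis
    unfolding smooth_near_iff[OF c] by blast
qed

lemma smooth_near_const: "smooth_near A p (\<lambda>q. r)"
  unfolding smooth_near_def smooth_fun_def by (auto simp: o_def smooth_on_const intro: exI[of _ UNIV])

text \<open>Sum and product need the same passage to the common domain of two coordinate
  expressions; \<open>h\<close> abstracts the operation.\<close>

lemma smooth_near_lift2:
  assumes f: "smooth_near A p f" and g: "smooth_near A p g"
    and h: "\<And>S (u :: real^'n \<Rightarrow> real) v. open S \<Longrightarrow> smooth_on S u \<Longrightarrow> smooth_on S v \<Longrightarrow>
      smooth_on S (\<lambda>x. h (u x) (v x))"
  shows "smooth_near A p (\<lambda>q. h (f q) (g q))"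
proof -
  obtain c where c: "c \<in> A" "p \<in> fst c" by (rule chart_cover)
  obtain W where W: "open W" "p \<in> W" "W \<subseteq> fst c" "smooth_on (snd c ` W) (f \<circ> chart_inv c)"
    using f smooth_near_iff[OF c] by blast
  obtain V where V: "open V" "p \<in> V" "V \<subseteq> fst c" "smooth_on (snd c ` V) (g \<circ> chart_inv c)"
    using g smooth_near_iff[OF c] by blast
  have WV: "open (W \<inter> V)" "p \<in> W \<inter> V" "W \<inter> V \<subseteq> fst c"
    using W V by auto
  have "smooth_on (snd c ` (W \<inter> V)) (\<lambda>x. h ((f \<circ> chart_inv c) x) ((g \<circ> chart_inv c) x))"
    by (intro h open_chart_image[OF c(1)] WV smooth_on_subset[OF W(4)] smooth_on_subset[OF V(4)]) auto
  with WV show ?thesis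
    unfolding smooth_near_iff[OF c] by (auto simp: o_def)
qed

lemma smooth_near_add:
  "smooth_near A p f \<Longrightarrow> smooth_near A p g \<Longrightarrow> smooth_near A p (\<lambda>q. f q + g q)"
  by (rule smooth_near_lift2[of p f g "(+)"]) (auto intro: smooth_on_add)

lemma smooth_near_mult:
  "smooth_near A p f \<Longrightarrow> smooth_near A p g \<Longrightarrow> smooth_near A p (\<lambda>q. f q * g q)"
  by (rule smooth_near_lift2[of p f g "(*)"]) (auto intro: smooth_on_mult)

lemma smooth_near_diff:
  assumes "smooth_near A p f" "smooth_near A p g"
  shows "smooth_near A p (\<lambda>q. f q - g q)"
  using smooth_near_add[OF assms(1) smooth_near_mult[OF smooth_near_const[of p "-1"] assms(2)]] by simp

lemma smooth_near_sum:
  assumes "\<And>i. i \<in> I \<Longrightarrow> smooth_near A p (f i)"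
  shows "smooth_near A p (\<lambda>q. \<Sum>i\<in>I. f i q)"
proof (cases "finite I")
  case True
  then show ?thesis
    using assms by (induction I) (auto intro: smooth_near_const smooth_near_add)
qed (simp add: smooth_near_const)

lemmas smooth_near_intros =
  smooth_near_const smooth_near_add smooth_near_mult smooth_near_diff smooth_near_sum

lemma smooth_near_comp:
  assumes c: "c \<in> A" "p \<in> fst c" and S: "open S" "snd c p \<in> S" and u: "smooth_on S u"
  shows "smooth_near A p (\<lambda>q. u (snd c q))"
proof -
  let ?W = "{q \<in> fst c. snd c q \<in> S}"
  have W: "open ?W" "p \<in> ?W" "?W \<subseteq> fst c"
    using open_chart_vimage[OF c(1) S(1)] c S by auto
  have "smooth_on (snd c ` ?W) ((\<lambda>q. u (snd c q)) \<circ> chart_inv c)"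
    by (rule smooth_on_cong[OF open_chart_image[OF c(1) W(1,3)] smooth_on_subset[OF u]])
      (auto simp: chart_inv_chart[OF c(1)])
  with W show ?thesis unfolding smooth_near_iff[OF c] by blast
qed

lemma smooth_near_coord_fun:
  assumes "c \<in> A" "p \<in> fst c"
  shows "smooth_near A p (coord_fun c k)"
proof -
  have "coord_fun c k = (\<lambda>q. snd c q $ k)"
    by (simp add: coord_fun_def fun_eq_iff)
  then show ?thesis
    using smooth_near_comp[OF assms open_UNIV UNIV_I smooth_on_linear[OF bounded_linear_vec_nth[of k]]]
    by simp
qed

lemma eventually_in_chart: "c \<in> A \<Longrightarrow> p \<in> fst c \<Longrightarrow> \<forall>\<^sub>F q in nhds p. q \<in> fst c"
  using chart(1)[of c] by (rule eventually_nhds_in_open)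

lemma smooth_near_frechet:
  assumes c: "c \<in> A" "p \<in> fst c" and f: "smooth_near A p f"
  shows "((f \<circ> chart_inv c) has_derivative frechet_derivative (f \<circ> chart_inv c) (at (snd c p))) (at (snd c p))"
proof -
  obtain W where W: "open W" "p \<in> W" "W \<subseteq> fst c" "smooth_on (snd c ` W) (f \<circ> chart_inv c)"
    using f smooth_near_iff[OF c] by blast
  then have "(f \<circ> chart_inv c) differentiable at (snd c p)"
    by (intro smooth_on_differentiable[OF W(4)]) auto
  then show ?thesis by (simp add: frechet_derivative_works)
qed

section \<open>Partial derivatives in a chart as derivations\<close>

lemma coord_vec_eq:
  assumes "smooth_near A p f" "((f \<circ> chart_inv c) has_derivative f') (at (snd c p))"
  shows "coord_vec A c i p f = f' (axis i 1)"
  using assms by (simp add: coord_vec_def frechet_derivative_at[OF assms(2), symmetric])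

lemma coord_vec_frechet:
  assumes "smooth_near A p f"
  shows "coord_vec A c i p f = frechet_derivative (f \<circ> chart_inv c) (at (snd c p)) (axis i 1)"
  using assms by (simp add: coord_vec_def)

lemma coord_vec_not_smooth: "\<not> smooth_near A p f \<Longrightarrow> coord_vec A c i p f = 0"
  by (simp add: coord_vec_def)

lemma coord_vec_coord_fun:
  assumes c: "c \<in> A" "p \<in> fst c"
  shows "coord_vec A c i p (coord_fun c k) = (if k = i then 1 else 0)"
proof -
  have "((\<lambda>x. x $ k) has_derivative (\<lambda>x. x $ k)) (at (snd c p))"
    by (rule bounded_linear_imp_has_derivative[OF bounded_linear_vec_nth])
  then have "((coord_fun c k \<circ> chart_inv c) has_derivative (\<lambda>x. x $ k)) (at (snd c p))"
    by (rule has_derivative_transform_within_open[OF _ chart(2)[OF c(1)]])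
      (use c in \<open>auto simp: coord_fun_def chart_inv_chart\<close>)
  from coord_vec_eq[OF smooth_near_coord_fun[OF c] this, of i]
  show ?thesis by (simp add: axis_def)
qed

text \<open>Since \<open>f\<close> stays smooth near points close to \<open>p\<close>,
  \<open>coord_vec\<close> takes the derivative branch of its definition on a whole neighbourhood
  and equals a smooth function of the coordinates there.\<close>

lemma smooth_near_coord_vec:
  assumes c: "c \<in> A" "p \<in> fst c" and f: "smooth_near A p f"
  shows "smooth_near A p (\<lambda>q. coord_vec A c i q f)"
proof -
  obtain W where W: "open W" "p \<in> W" "W \<subseteq> fst c" "smooth_on (snd c ` W) (f \<circ> chart_inv c)"
    using f smooth_near_iff[OF c] by blast
  have "smooth_near A p (\<lambda>q. (\<lambda>x. frechet_derivative (f \<circ> chart_inv c) (at x) (axis i 1)) (snd c q))"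
    by (rule smooth_near_comp[OF c open_chart_image[OF c(1) W(1,3)] _ smooth_on_frechet_derivative[OF W(4)]])
      (use W in auto)
  then show ?thesis
    by (rule smooth_near_cong)
      (use smooth_near_eventually[OF f] in eventually_elim, simp add: coord_vec_frechet)
qed

lemma coord_vec_tangent:
  assumes c: "c \<in> A" "p \<in> fst c"
  shows "coord_vec A c i p \<in> tangent_space A p"
  unfolding tangent_space_def mem_Collect_eq
proof (intro conjI allI impI; (elim conjE)?)
  fix f g assume fg: "smooth_near A p f" "smooth_near A p g"
  note der = smooth_near_frechet[OF c fg(1)] smooth_near_frechet[OF c fg(2)]
  show "coord_vec A c i p (\<lambda>q. f q + g q) = coord_vec A c i p f + coord_vec A c i p g"
    using has_derivative_add[OF der] fg
    by (subst coord_vec_eq[OF smooth_near_add[OF fg]]) (auto simp: o_def coord_vec_frechet)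
  show "coord_vec A c i p (\<lambda>q. f q * g q) = f p * coord_vec A c i p g + g p * coord_vec A c i p f"
    using has_derivative_mult[OF der] fg
    by (subst coord_vec_eq[OF smooth_near_mult[OF fg]])
      (auto simp: o_def coord_vec_frechet chart_inv_chart[OF c] mult.commute)
next
  fix r f assume f: "smooth_near A p f"
  show "coord_vec A c i p (\<lambda>q. r * f q) = r * coord_vec A c i p f"
    using has_derivative_mult_right[OF smooth_near_frechet[OF c f], of r] f
    by (subst coord_vec_eq[OF smooth_near_mult[OF smooth_near_const f]])
      (auto simp: o_def coord_vec_frechet)
qed (simp add: coord_vec_not_smooth)

subsection \<open>Tangent and cotangent vectors\<close>

context
  fixes p X assumes X: "X \<in> tangent_space A p"
begin

lemma tangent_add: "smooth_near A p f \<Longrightarrow> smooth_near A p g \<Longrightarrow> X (\<lambda>q. f q + g q) = X f + X g"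
  using X by (simp add: tangent_space_def)

lemma tangent_mult:
  "smooth_near A p f \<Longrightarrow> smooth_near A p g \<Longrightarrow> X (\<lambda>q. f q * g q) = f p * X g + g p * X f"
  using X by (simp add: tangent_space_def)

lemma tangent_scale: "smooth_near A p f \<Longrightarrow> X (\<lambda>q. r * f q) = r * X f"
  using X by (simp add: tangent_space_def)

lemma tangent_not_smooth: "\<not> smooth_near A p f \<Longrightarrow> X f = 0"
  using X by (simp add: tangent_space_def)

lemma tangent_const: "X (\<lambda>q. r) = 0"
proof -
  \<comment> \<open>Leibniz on \<open>1 * 1 = 1\<close> gives \<open>X 1 = 2 * X 1\<close>.\<close>
  have "X (\<lambda>q. 1 * 1) = 1 * X (\<lambda>q. 1) + 1 * X (\<lambda>q. 1)"
    by (rule tangent_mult[OF smooth_near_const smooth_near_const])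
  then have "X (\<lambda>q. 1) = 0" by simp
  then show ?thesis
    using tangent_scale[OF smooth_near_const, of r 1] by simp
qed

lemma tangent_diff:
  assumes "smooth_near A p f" "smooth_near A p g"
  shows "X (\<lambda>q. f q - g q) = X f - X g"
  using tangent_add[OF assms(1) smooth_near_mult[OF smooth_near_const[of p "-1"] assms(2)]]
    tangent_scale[OF assms(2), of "-1"] by simp

lemma tangent_sum:
  assumes "\<And>i. i \<in> I \<Longrightarrow> smooth_near A p (f i)"
  shows "X (\<lambda>q. \<Sum>i\<in>I. f i q) = (\<Sum>i\<in>I. X (f i))"
proof (cases "finite I")
  case True
  then show ?thesis
    using assms by (induction I) (simp_all add: tangent_const tangent_add smooth_near_sum)
qed (simp add: tangent_const)

text \<open>The indicator function of a neighbourhood of \<open>p\<close> is smooth near \<open>p\<close>, and this is all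
  the cut-off needed for locality.\<close>

lemma tangent_local:
  assumes "\<forall>\<^sub>F q in nhds p. f q = g q"
  shows "X f = X g"
proof (cases "smooth_near A p f")
  case True
  have g: "smooth_near A p g"
    by (rule smooth_near_cong[OF True assms])
  let ?\<chi> = "\<lambda>q. if f q = g q then 1 else 0 :: real"
  have chi: "smooth_near A p ?\<chi>"
    by (rule smooth_near_cong[OF smooth_near_const[of p 1]]) (use assms in eventually_elim, simp)
  have "f p = g p"
    using assms by (rule eventually_nhds_x_imp_x)
  \<comment> \<open>The product vanishes at every point of the manifold, so \<open>X\<close> of it
    is known without presupposing locality. On the right, \<open>?\<chi> p = 1\<close> and
    \<open>f p - g p = 0\<close>.\<close>
  have "X (\<lambda>q. ?\<chi> q * (f q - g q)) = ?\<chi> p * X (\<lambda>q. f q - g q) + (f p - g p) * X ?\<chi>"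
    by (rule tangent_mult[OF chi smooth_near_diff[OF True g]])
  moreover have "(\<lambda>q. ?\<chi> q * (f q - g q)) = (\<lambda>q. 0)"
    by (simp add: fun_eq_iff)
  ultimately have "X (\<lambda>q. f q - g q) = 0"
    using tangent_const[of 0] \<open>f p = g p\<close> by simp
  then show ?thesis
    by (simp add: tangent_diff[OF True g])
next
  case False
  \<comment> \<open>If \<open>f\<close> is not smooth near \<open>p\<close>, neither is
    \<open>g\<close>, and both values are the default 0.\<close>
  have "\<forall>\<^sub>F q in nhds p. g q = f q"
    using assms by eventually_elim simp
  then have "\<not> smooth_near A p g"
    using False smooth_near_cong by blast
  with False show ?thesis by (simp add: tangent_not_smooth)
qed

text \<open>Constants are killed, and in Hadamard's form of the remainder each coordinate difference
  vanishes at \<open>p\<close>. In the Leibniz rule only the derivative of that difference survives,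
  multiplied by \<open>g i\<close> at \<open>p\<close>, which is the partial derivative of
  \<open>f\<close>.\<close>

lemma tangent_expand:
  assumes c: "c \<in> A" "p \<in> fst c" and f: "smooth_near A p f"
  shows "X f = (\<Sum>k\<in>UNIV. X (coord_fun c k) * coord_vec A c k p f)"
proof -
  obtain W where W: "open W" "p \<in> W" "W \<subseteq> fst c" "smooth_on (snd c ` W) (f \<circ> chart_inv c)"
    using f smooth_near_iff[OF c] by blast
  \<comment> \<open>Hadamard's lemma holds on a ball in coordinate space. The resulting identity for
    \<open>f\<close> is valid only near \<open>p\<close>, which is why \<open>tangent_local\<close>
    precedes the computation.\<close>
  obtain r where r: "r > 0" "ball (snd c p) r \<subseteq> snd c ` W"
    using open_chart_image[OF c(1) W(1,3)] W(2) openE[of "snd c ` W" "snd c p"] by blast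
  obtain g where g: "\<And>i. smooth_on (ball (snd c p) r) (g i)"
      "\<And>i. g i (snd c p) = coord_vec A c i p f"
      "\<And>x. x \<in> ball (snd c p) r \<Longrightarrow> f (chart_inv c x) =
         f (chart_inv c (snd c p)) + (\<Sum>i\<in>UNIV. (x $ i - snd c p $ i) * g i x)"
    using hadamard[OF smooth_on_subset[OF W(4) r(2)]] unfolding coord_vec_frechet[OF f] o_apply by blast
  have sg: "smooth_near A p (\<lambda>q. g i (snd c q))" for i
    by (rule smooth_near_comp[OF c open_ball _ g(1)]) (use r in auto)
  have sc: "smooth_near A p (\<lambda>q. coord_fun c i q - coord_fun c i p)" for i
    by (intro smooth_near_diff smooth_near_coord_fun c smooth_near_const)
  have "\<forall>\<^sub>F q in nhds p. q \<in> {q \<in> fst c. snd c q \<in> ball (snd c p) r}"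
    by (rule eventually_nhds_in_open[OF open_chart_vimage[OF c(1) open_ball]]) (use c r in auto)
  then have "\<forall>\<^sub>F q in nhds p. f q =
      f p + (\<Sum>i\<in>UNIV. (coord_fun c i q - coord_fun c i p) * g i (snd c q))"
  proof eventually_elim
    case (elim q)
    then show ?case
      using g(3)[of "snd c q"] c by (simp add: chart_inv_chart coord_fun_def)
  qed
  then have "X f = X (\<lambda>q. f p + (\<Sum>i\<in>UNIV. (coord_fun c i q - coord_fun c i p) * g i (snd c q)))"
    by (rule tangent_local)
  also have "\<dots> = (\<Sum>i\<in>UNIV. X (\<lambda>q. (coord_fun c i q - coord_fun c i p) * g i (snd c q)))"
    by (subst tangent_add)
      (auto intro!: smooth_near_intros sg sc simp: tangent_const tangent_sum smooth_near_mult sg sc)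
  also have "\<dots> = (\<Sum>i\<in>UNIV. X (coord_fun c i) * coord_vec A c i p f)"
  proof (rule sum.cong[OF refl])
    fix i
    have "X (\<lambda>q. coord_fun c i q - coord_fun c i p) = X (coord_fun c i)"
      using tangent_diff[OF smooth_near_coord_fun[OF c] smooth_near_const] by (simp add: tangent_const)
    then show "X (\<lambda>q. (coord_fun c i q - coord_fun c i p) * g i (snd c q)) =
        X (coord_fun c i) * coord_vec A c i p f"
      unfolding tangent_mult[OF sc sg] by (simp add: g(2))
  qed
  finally show ?thesis .
qed

text \<open>On functions that are not smooth near \<open>p\<close> both sides are 0 by convention,
  so the expansion is an equality of HOL functions.\<close>

lemma tangent_eq_sum:
  assumes c: "c \<in> A" "p \<in> fst c"
  shows "X = (\<Sum>k\<in>UNIV. X (coord_fun c k) *\<^sub>R coord_vec A c k p)"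
proof
  fix f
  have *: "(\<Sum>k\<in>UNIV. X (coord_fun c k) *\<^sub>R coord_vec A c k p) f =
      (\<Sum>k\<in>UNIV. X (coord_fun c k) * coord_vec A c k p f)"
    by (simp add: sum_fun_apply)
  show "X f = (\<Sum>k\<in>UNIV. X (coord_fun c k) *\<^sub>R coord_vec A c k p) f"
    unfolding *
    by (cases "smooth_near A p f")
      (auto simp: tangent_expand[OF c] tangent_not_smooth coord_vec_not_smooth)
qed

end

section \<open>Linear algebra in the fibres\<close>

lemma tangent_space_zero: "0 \<in> tangent_space A p"
  by (simp add: tangent_space_def)

lemma tangent_space_add:
  "X \<in> tangent_space A p \<Longrightarrow> Y \<in> tangent_space A p \<Longrightarrow> X + Y \<in> tangent_space A p"
  by (auto simp: tangent_space_def algebra_simps)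

lemma tangent_space_scaleR: "X \<in> tangent_space A p \<Longrightarrow> r *\<^sub>R X \<in> tangent_space A p"
  by (auto simp: tangent_space_def algebra_simps)

lemma tangent_space_sum:
  "(\<And>i. i \<in> I \<Longrightarrow> X i \<in> tangent_space A p) \<Longrightarrow> (\<Sum>i\<in>I. X i) \<in> tangent_space A p"
  by (induction I rule: infinite_finite_induct) (auto intro: tangent_space_zero tangent_space_add)

lemma cotangent_space_zero: "0 \<in> cotangent_space A p"
  by (simp add: cotangent_space_def)

lemma cotangent_space_add:
  "\<xi> \<in> cotangent_space A p \<Longrightarrow> \<eta> \<in> cotangent_space A p \<Longrightarrow> \<xi> + \<eta> \<in> cotangent_space A p"
  by (auto simp: cotangent_space_def algebra_simps)

lemma cotangent_space_scaleR: "\<xi> \<in> cotangent_space A p \<Longrightarrow> r *\<^sub>R \<xi> \<in> cotangent_space A p"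
  by (auto simp: cotangent_space_def algebra_simps)

lemma cotangent_space_diff:
  "\<xi> \<in> cotangent_space A p \<Longrightarrow> \<eta> \<in> cotangent_space A p \<Longrightarrow> \<xi> - \<eta> \<in> cotangent_space A p"
  by (auto simp: cotangent_space_def algebra_simps)

lemma gen_tangent_space_zero: "0 \<in> gen_tangent_space A p"
  by (simp add: gen_tangent_space_def tangent_space_zero cotangent_space_zero zero_prod_def)

lemma gen_tangent_space_add:
  "u \<in> gen_tangent_space A p \<Longrightarrow> v \<in> gen_tangent_space A p \<Longrightarrow> u + v \<in> gen_tangent_space A p"
  by (auto simp: gen_tangent_space_def tangent_space_add cotangent_space_add)

lemma gen_tangent_space_scaleR: "u \<in> gen_tangent_space A p \<Longrightarrow> r *\<^sub>R u \<in> gen_tangent_space A p"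
  by (auto simp: gen_tangent_space_def tangent_space_scaleR cotangent_space_scaleR)

lemma gen_tangent_space_diff:
  "u \<in> gen_tangent_space A p \<Longrightarrow> v \<in> gen_tangent_space A p \<Longrightarrow> u - v \<in> gen_tangent_space A p"
  using gen_tangent_space_add[OF _ gen_tangent_space_scaleR[of v p "-1"], of u] by simp

lemma gen_tangent_space_sum:
  "(\<And>i. i \<in> I \<Longrightarrow> u i \<in> gen_tangent_space A p) \<Longrightarrow> (\<Sum>i\<in>I. u i) \<in> gen_tangent_space A p"
  by (induction I rule: infinite_finite_induct) (auto intro: gen_tangent_space_zero gen_tangent_space_add)

lemma cotangent_add:
  "\<xi> \<in> cotangent_space A p \<Longrightarrow> X \<in> tangent_space A p \<Longrightarrow> Y \<in> tangent_space A p \<Longrightarrow>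
    \<xi> (X + Y) = \<xi> X + \<xi> Y"
  unfolding cotangent_space_def by blast

lemma cotangent_scaleR:
  "\<xi> \<in> cotangent_space A p \<Longrightarrow> X \<in> tangent_space A p \<Longrightarrow> \<xi> (r *\<^sub>R X) = r * \<xi> X"
  unfolding cotangent_space_def by blast

lemma cotangent_zero: "\<xi> \<in> cotangent_space A p \<Longrightarrow> \<xi> 0 = 0"
  using cotangent_scaleR[OF _ tangent_space_zero, of \<xi> p 0] by (simp only: scaleR_zero_left mult_zero_left)

lemma cotangent_sum_scaleR:
  assumes \<xi>: "\<xi> \<in> cotangent_space A p" and X: "\<And>i. i \<in> I \<Longrightarrow> X i \<in> tangent_space A p"
  shows "\<xi> (\<Sum>i\<in>I. r i *\<^sub>R X i) = (\<Sum>i\<in>I. r i * \<xi> (X i))"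
  using X
proof (induction I rule: infinite_finite_induct)
  case (insert i I)
  have Xi: "X i \<in> tangent_space A p" and S: "(\<Sum>i\<in>I. r i *\<^sub>R X i) \<in> tangent_space A p"
    by (simp_all add: insert.prems tangent_space_sum tangent_space_scaleR)
  have "\<xi> (r i *\<^sub>R X i + (\<Sum>i\<in>I. r i *\<^sub>R X i)) = r i * \<xi> (X i) + \<xi> (\<Sum>i\<in>I. r i *\<^sub>R X i)"
    by (simp only: cotangent_add[OF \<xi> tangent_space_scaleR[OF Xi] S] cotangent_scaleR[OF \<xi> Xi])
  moreover have "\<xi> (\<Sum>i\<in>I. r i *\<^sub>R X i) = (\<Sum>i\<in>I. r i * \<xi> (X i))"
    by (rule insert.IH) (simp add: insert.prems)
  ultimately show ?case
    by (simp only: sum.insert[OF insert.hyps])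
qed (simp_all only: cotangent_zero[OF \<xi>] sum.infinite sum.empty not_False_eq_True)

lemma exterior_d_cotangent: "exterior_d A f p \<in> cotangent_space A p"
  by (auto simp: cotangent_space_def exterior_d_def tangent_space_add tangent_space_scaleR)

lemma exterior_d_apply: "X \<in> tangent_space A p \<Longrightarrow> exterior_d A f p X = X f"
  by (simp add: exterior_d_def)

lemma coord_form_cotangent: "coord_form A c k p \<in> cotangent_space A p"
  by (simp add: coord_form_def exterior_d_cotangent)

lemma coord_form_apply: "X \<in> tangent_space A p \<Longrightarrow> coord_form A c k p X = X (coord_fun c k)"
  by (simp add: coord_form_def exterior_d_apply)

lemma cotangent_expand:
  assumes c: "c \<in> A" "p \<in> fst c" and \<xi>: "\<xi> \<in> cotangent_space A p" and X: "X \<in> tangent_space A p"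
  shows "\<xi> X = (\<Sum>k\<in>UNIV. X (coord_fun c k) * \<xi> (coord_vec A c k p))"
proof -
  have "\<xi> X = \<xi> (\<Sum>k\<in>UNIV. X (coord_fun c k) *\<^sub>R coord_vec A c k p)"
    by (rule arg_cong[of _ _ \<xi>, OF tangent_eq_sum[OF X c]])
  also have "\<dots> = (\<Sum>k\<in>UNIV. X (coord_fun c k) * \<xi> (coord_vec A c k p))"
    by (rule cotangent_sum_scaleR[OF \<xi> coord_vec_tangent[OF c]])
  finally show ?thesis .
qed

lemma cotangent_eq_sum:
  assumes c: "c \<in> A" "p \<in> fst c" and \<xi>: "\<xi> \<in> cotangent_space A p"
  shows "\<xi> = (\<Sum>k\<in>UNIV. \<xi> (coord_vec A c k p) *\<^sub>R coord_form A c k p)"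
proof
  fix X
  show "\<xi> X = (\<Sum>k\<in>UNIV. \<xi> (coord_vec A c k p) *\<^sub>R coord_form A c k p) X"
  proof (cases "X \<in> tangent_space A p")
    case True
    then show ?thesis
      by (subst cotangent_expand[OF c \<xi> True]) (simp add: sum_fun_apply coord_form_apply mult.commute)
  next
    case False
    then show ?thesis
      using \<xi> by (simp add: sum_fun_apply cotangent_space_def coord_form_def exterior_d_def)
  qed
qed

text \<open>The bracket rules below are identities of generalized vectors; once both sides are known
  to lie in the fibre, this reduces them to finitely many identities of real numbers.\<close>

lemma gvec_eqI:
  assumes c: "c \<in> A" "p \<in> fst c"
    and uv: "u \<in> gen_tangent_space A p" "v \<in> gen_tangent_space A p"
    and "\<And>k. fst u (coord_fun c k) = fst v (coord_fun c k)"
    and "\<And>k. snd u (coord_vec A c k p) = snd v (coord_vec A c k p)"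
  shows "u = v"
proof (rule prod_eqI)
  have u: "fst u \<in> tangent_space A p" "snd u \<in> cotangent_space A p"
    and v: "fst v \<in> tangent_space A p" "snd v \<in> cotangent_space A p"
    using uv by (auto simp: gen_tangent_space_def)
  show "fst u = fst v"
    by (rule trans[OF tangent_eq_sum[OF u(1) c] trans[OF _ tangent_eq_sum[OF v(1) c, symmetric]]])
      (simp only: assms(5))
  show "snd u = snd v"
    by (rule trans[OF cotangent_eq_sum[OF c u(2)] trans[OF _ cotangent_eq_sum[OF c v(2), symmetric]]])
      (simp only: assms(6))
qed

subsection \<open>Germs of smooth fields\<close>

text \<open>Leaving the domain existential makes smoothness a property of the germ, so fields can be
  combined without tracking a common domain.\<close>

definition vf_near :: "'m \<Rightarrow> ('m \<Rightarrow> 'm tvec) \<Rightarrow> bool" where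
  "vf_near p X \<longleftrightarrow> (\<exists>U. open U \<and> p \<in> U \<and> smooth_vector_field A U X)"

definition form_near :: "'m \<Rightarrow> ('m \<Rightarrow> 'm cvec) \<Rightarrow> bool" where
  "form_near p \<xi> \<longleftrightarrow> (\<exists>U. open U \<and> p \<in> U \<and> smooth_one_form A U \<xi>)"

lemma vf_near_eventually: "vf_near p X \<Longrightarrow> \<forall>\<^sub>F q in nhds p. vf_near q X"
  unfolding vf_near_def eventually_nhds by blast

lemma form_near_eventually: "form_near p \<xi> \<Longrightarrow> \<forall>\<^sub>F q in nhds p. form_near q \<xi>"
  unfolding form_near_def eventually_nhds by blast

lemma vf_near_tangent: "vf_near p X \<Longrightarrow> X p \<in> tangent_space A p"
  unfolding vf_near_def smooth_vector_field_def by blast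

lemma form_near_cotangent: "form_near p \<xi> \<Longrightarrow> \<xi> p \<in> cotangent_space A p"
  unfolding form_near_def smooth_one_form_def by blast

lemma smooth_near_vf:
  assumes X: "vf_near p X" and f: "smooth_near A p f"
  shows "smooth_near A p (\<lambda>q. X q f)"
proof -
  obtain U where U: "open U" "p \<in> U" "smooth_vector_field A U X"
    using X unfolding vf_near_def by blast
  obtain V where V: "open V" "p \<in> V" "\<And>q. q \<in> V \<Longrightarrow> smooth_near A q f"
    using smooth_near_eventually[OF f] unfolding eventually_nhds by blast
  have UV: "open (U \<inter> V)" "p \<in> U \<inter> V"
    using U V by auto
  have "smooth_fun A (U \<inter> V) f"
    unfolding smooth_fun_iff[OF UV(1)] using V by blast
  then have "smooth_fun A (U \<inter> V) (\<lambda>q. X q f)"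
    using U(3) UV(1) unfolding smooth_vector_field_def by blast
  then show ?thesis
    using UV unfolding smooth_near_def by blast
qed

lemma smooth_near_form:
  assumes \<xi>: "form_near p \<xi>" and X: "vf_near p X"
  shows "smooth_near A p (\<lambda>q. \<xi> q (X q))"
proof -
  obtain U where U: "open U" "p \<in> U" "smooth_one_form A U \<xi>"
    using \<xi> unfolding form_near_def by blast
  obtain V where V: "open V" "p \<in> V" "smooth_vector_field A V X"
    using X unfolding vf_near_def by blast
  have UV: "open (U \<inter> V)" "p \<in> U \<inter> V"
    using U V by auto
  have "smooth_vector_field A (U \<inter> V) X"
    using V(3) unfolding smooth_vector_field_def by auto
  then have "smooth_fun A (U \<inter> V) (\<lambda>q. \<xi> q (X q))"
    using U(3) UV(1) unfolding smooth_one_form_def by blast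
  then show ?thesis
    using UV unfolding smooth_near_def by blast
qed

lemma smooth_vector_field_iff:
  assumes "open U"
  shows "smooth_vector_field A U X \<longleftrightarrow> (\<forall>p\<in>U. vf_near p X)"
proof
  assume R: "\<forall>p\<in>U. vf_near p X"
  show "smooth_vector_field A U X"
    unfolding smooth_vector_field_def
  proof (intro conjI allI impI ballI; (elim conjE)?)
    show "X p \<in> tangent_space A p" if "p \<in> U" for p
      using R that vf_near_tangent by blast
    fix V f assume V: "open V" "V \<subseteq> U" "smooth_fun A V f"
    then show "smooth_fun A V (\<lambda>q. X q f)"
      using R smooth_near_vf by (auto simp: smooth_fun_iff)
  qed
qed (use assms vf_near_def in blast)

lemma smooth_one_form_iff:
  assumes "open U"
  shows "smooth_one_form A U \<xi> \<longleftrightarrow> (\<forall>p\<in>U. form_near p \<xi>)"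
proof
  assume R: "\<forall>p\<in>U. form_near p \<xi>"
  show "smooth_one_form A U \<xi>"
    unfolding smooth_one_form_def
  proof (intro conjI allI impI ballI; (elim conjE)?)
    show "\<xi> p \<in> cotangent_space A p" if "p \<in> U" for p
      using R that form_near_cotangent by blast
    fix V Y assume V: "open V" "V \<subseteq> U" "smooth_vector_field A V Y"
    then show "smooth_fun A V (\<lambda>q. \<xi> q (Y q))"
      using R smooth_near_form by (auto simp: smooth_fun_iff smooth_vector_field_iff)
  qed
qed (use assms form_near_def in blast)

text \<open>In one direction \<open>X\<close> is tested on coordinate functions. Conversely,
  \<open>tangent_expand\<close> writes \<open>X q f\<close> as a sum of products of these components
  with partial derivatives of \<open>f\<close>, all of them smooth.\<close>

lemma vf_near_iff:
  assumes c: "c \<in> A" "p \<in> fst c"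
  shows "vf_near p X \<longleftrightarrow> (\<forall>\<^sub>F q in nhds p. X q \<in> tangent_space A q) \<and>
    (\<forall>k. smooth_near A p (\<lambda>q. X q (coord_fun c k)))"
proof
  assume X: "vf_near p X"
  show "(\<forall>\<^sub>F q in nhds p. X q \<in> tangent_space A q) \<and>
    (\<forall>k. smooth_near A p (\<lambda>q. X q (coord_fun c k)))"
  proof (intro conjI allI)
    show "\<forall>\<^sub>F q in nhds p. X q \<in> tangent_space A q"
      using vf_near_eventually[OF X] by eventually_elim (rule vf_near_tangent)
    show "smooth_near A p (\<lambda>q. X q (coord_fun c k))" for k
      by (rule smooth_near_vf[OF X smooth_near_coord_fun[OF c]])
  qed
next
  assume R: "(\<forall>\<^sub>F q in nhds p. X q \<in> tangent_space A q) \<and>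
    (\<forall>k. smooth_near A p (\<lambda>q. X q (coord_fun c k)))"
  have "\<forall>\<^sub>F q in nhds p. q \<in> fst c \<and> X q \<in> tangent_space A q \<and>
     (\<forall>k. smooth_near A q (\<lambda>q. X q (coord_fun c k)))"
    \<comment> \<open>Only finitely many indices occur, so one neighbourhood serves all
      components.\<close>
    using R by (intro eventually_conj eventually_in_chart[OF c] eventually_all_finite smooth_near_eventually) auto
  then obtain U where U': "open U" "p \<in> U" "\<forall>q\<in>U. q \<in> fst c \<and> X q \<in> tangent_space A q \<and>
     (\<forall>k. smooth_near A q (\<lambda>q. X q (coord_fun c k)))"
    unfolding eventually_nhds by (elim exE conjE)
  then have U: "open U" "p \<in> U" "\<And>q. q \<in> U \<Longrightarrow> q \<in> fst c"
      "\<And>q. q \<in> U \<Longrightarrow> X q \<in> tangent_space A q"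
      "\<And>q k. q \<in> U \<Longrightarrow> smooth_near A q (\<lambda>q. X q (coord_fun c k))"
    by simp_all
  have "smooth_vector_field A U X"
    unfolding smooth_vector_field_def
  proof (intro conjI allI impI ballI U(4); (elim conjE)?)
    fix V f assume V: "open V" "V \<subseteq> U" "smooth_fun A V f"
    then have f: "smooth_near A q f" if "q \<in> V" for q
      using that by (simp add: smooth_fun_iff)
    have "smooth_near A q (\<lambda>q. X q f)" if q: "q \<in> V" for q
    proof (rule smooth_near_cong)
      show "smooth_near A q (\<lambda>q. \<Sum>k\<in>UNIV. X q (coord_fun c k) * coord_vec A c k q f)"
        using q V(2) f by (intro smooth_near_intros smooth_near_coord_vec c(1) U) auto
      have "\<forall>\<^sub>F q in nhds q. q \<in> V"
        by (rule eventually_nhds_in_open[OF V(1) q])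
      then show "\<forall>\<^sub>F q in nhds q. (\<Sum>k\<in>UNIV. X q (coord_fun c k) * coord_vec A c k q f) = X q f"
      proof eventually_elim
        case (elim q)
        then have "q \<in> U"
          using V(2) by auto
        from tangent_expand[OF U(4)[OF this] c(1) U(3)[OF this] f[OF elim]] show ?case
          by (rule sym)
      qed
    qed
    then show "smooth_fun A V (\<lambda>q. X q f)"
      using V(1) by (simp add: smooth_fun_iff)
  qed
  then show "vf_near p X"
    using U(1,2) unfolding vf_near_def by blast
qed

lemma vf_near_coord_vec:
  assumes c: "c \<in> A" "p \<in> fst c"
  shows "vf_near p (coord_vec A c i)"
  unfolding vf_near_iff[OF c]
proof (intro conjI allI)
  show "\<forall>\<^sub>F q in nhds p. coord_vec A c i q \<in> tangent_space A q"
    using eventually_in_chart[OF c] by eventually_elim (rule coord_vec_tangent[OF c(1)])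
  show "smooth_near A p (\<lambda>q. coord_vec A c i q (coord_fun c k))" for k
    by (rule smooth_near_coord_vec[OF c smooth_near_coord_fun[OF c]])
qed

text \<open>Dual to \<open>vf_near_iff\<close>: the evaluation on an arbitrary smooth field is
  controlled by \<open>cotangent_expand\<close>.\<close>

lemma form_near_iff:
  assumes c: "c \<in> A" "p \<in> fst c"
  shows "form_near p \<xi> \<longleftrightarrow> (\<forall>\<^sub>F q in nhds p. \<xi> q \<in> cotangent_space A q) \<and>
    (\<forall>k. smooth_near A p (\<lambda>q. \<xi> q (coord_vec A c k q)))"
proof
  assume \<xi>: "form_near p \<xi>"
  show "(\<forall>\<^sub>F q in nhds p. \<xi> q \<in> cotangent_space A q) \<and>
    (\<forall>k. smooth_near A p (\<lambda>q. \<xi> q (coord_vec A c k q)))"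
  proof (intro conjI allI)
    show "\<forall>\<^sub>F q in nhds p. \<xi> q \<in> cotangent_space A q"
      using form_near_eventually[OF \<xi>] by eventually_elim (rule form_near_cotangent)
    show "smooth_near A p (\<lambda>q. \<xi> q (coord_vec A c k q))" for k
      by (rule smooth_near_form[OF \<xi> vf_near_coord_vec[OF c]])
  qed
next
  assume R: "(\<forall>\<^sub>F q in nhds p. \<xi> q \<in> cotangent_space A q) \<and>
    (\<forall>k. smooth_near A p (\<lambda>q. \<xi> q (coord_vec A c k q)))"
  have "\<forall>\<^sub>F q in nhds p. q \<in> fst c \<and> \<xi> q \<in> cotangent_space A q \<and>
     (\<forall>k. smooth_near A q (\<lambda>q. \<xi> q (coord_vec A c k q)))"
    using R by (intro eventually_conj eventually_in_chart[OF c] eventually_all_finite smooth_near_eventually) auto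
  then obtain U where U': "open U" "p \<in> U" "\<forall>q\<in>U. q \<in> fst c \<and> \<xi> q \<in> cotangent_space A q \<and>
     (\<forall>k. smooth_near A q (\<lambda>q. \<xi> q (coord_vec A c k q)))"
    unfolding eventually_nhds by (elim exE conjE)
  then have U: "open U" "p \<in> U" "\<And>q. q \<in> U \<Longrightarrow> q \<in> fst c"
      "\<And>q. q \<in> U \<Longrightarrow> \<xi> q \<in> cotangent_space A q"
      "\<And>q k. q \<in> U \<Longrightarrow> smooth_near A q (\<lambda>q. \<xi> q (coord_vec A c k q))"
    by simp_all
  have "smooth_one_form A U \<xi>"
    unfolding smooth_one_form_def
  proof (intro conjI allI impI ballI U(4); (elim conjE)?)
    fix V Y assume V: "open V" "V \<subseteq> U" "smooth_vector_field A V Y"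
    have Y: "vf_near q Y" if "q \<in> V" for q
      using V that unfolding vf_near_def by blast
    have "smooth_near A q (\<lambda>q. \<xi> q (Y q))" if q: "q \<in> V" for q
    proof (rule smooth_near_cong)
      show "smooth_near A q (\<lambda>q. \<Sum>k\<in>UNIV. Y q (coord_fun c k) * \<xi> q (coord_vec A c k q))"
        using q V(2) by (intro smooth_near_sum smooth_near_mult smooth_near_vf[OF Y] smooth_near_coord_fun[OF c(1)] U) auto
      have "\<forall>\<^sub>F q in nhds q. q \<in> V"
        by (rule eventually_nhds_in_open[OF V(1) q])
      then show "\<forall>\<^sub>F q in nhds q. (\<Sum>k\<in>UNIV. Y q (coord_fun c k) * \<xi> q (coord_vec A c k q)) = \<xi> q (Y q)"
      proof eventually_elim
        case (elim q)
        then have "q \<in> U"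
          using V(2) by auto
        from cotangent_expand[OF c(1) U(3)[OF this] U(4)[OF this] vf_near_tangent[OF Y[OF elim]]] show ?case
          by (rule sym)
      qed
    qed
    then show "smooth_fun A V (\<lambda>q. \<xi> q (Y q))"
      using V(1) by (simp add: smooth_fun_iff)
  qed
  then show "form_near p \<xi>"
    using U(1,2) unfolding form_near_def by blast
qed

subsection \<open>The Lie bracket and the Lie derivative\<close>

context
  fixes p X Y assumes X: "vf_near p X" and Y: "vf_near p Y"
begin

lemma lie_bracket_apply:
  "smooth_near A p f \<Longrightarrow> lie_bracket A X Y p f = X p (\<lambda>q. Y q f) - Y p (\<lambda>q. X q f)"
  by (simp add: lie_bracket_def)

lemma lie_bracket_tangent: "lie_bracket A X Y p \<in> tangent_space A p"
proof -
  note Xp = vf_near_tangent[OF X] and Yp = vf_near_tangent[OF Y]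
  have add: "Z p (\<lambda>q. W q (\<lambda>q. f q + g q)) = Z p (\<lambda>q. W q f) + Z p (\<lambda>q. W q g)"
    if "vf_near p Z" "vf_near p W" "smooth_near A p f" "smooth_near A p g" for Z W f g
  proof -
    have "\<forall>\<^sub>F q in nhds p. W q (\<lambda>q. f q + g q) = W q f + W q g"
      using vf_near_eventually[OF that(2)] smooth_near_eventually[OF that(3)] smooth_near_eventually[OF that(4)]
      by eventually_elim (rule tangent_add[OF vf_near_tangent])
    then show ?thesis
      using tangent_local[OF vf_near_tangent[OF that(1)]]
        tangent_add[OF vf_near_tangent[OF that(1)] smooth_near_vf[OF that(2,3)] smooth_near_vf[OF that(2,4)]]
      by simp
  qed
  \<comment> \<open>The terms \<open>W p g * Z p f\<close> and \<open>W p f * Z p g\<close> are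
    exchanged when \<open>Z\<close> and \<open>W\<close> trade places, so they cancel in the
    commutator and leave the Leibniz rule.\<close>
  have mult: "Z p (\<lambda>q. W q (\<lambda>q. f q * g q)) =
      f p * Z p (\<lambda>q. W q g) + W p g * Z p f + (g p * Z p (\<lambda>q. W q f) + W p f * Z p g)"
    if "vf_near p Z" "vf_near p W" "smooth_near A p f" "smooth_near A p g" for Z W f g
  proof -
    note Z = vf_near_tangent[OF that(1)] and fg = that(3,4)
    note Wf = smooth_near_vf[OF that(2,3)] and Wg = smooth_near_vf[OF that(2,4)]
    have "\<forall>\<^sub>F q in nhds p. W q (\<lambda>q. f q * g q) = f q * W q g + g q * W q f"
      using vf_near_eventually[OF that(2)] smooth_near_eventually[OF that(3)] smooth_near_eventually[OF that(4)]
      by eventually_elim (rule tangent_mult[OF vf_near_tangent])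
    then have "Z p (\<lambda>q. W q (\<lambda>q. f q * g q)) = Z p (\<lambda>q. f q * W q g + g q * W q f)"
      by (rule tangent_local[OF Z])
    then show ?thesis
      by (simp add: tangent_add[OF Z] tangent_mult[OF Z] smooth_near_mult fg Wf Wg)
  qed
  have scale: "Z p (\<lambda>q. W q (\<lambda>q. r * f q)) = r * Z p (\<lambda>q. W q f)"
    if "vf_near p Z" "vf_near p W" "smooth_near A p f" for Z W f r
  proof -
    have "\<forall>\<^sub>F q in nhds p. W q (\<lambda>q. r * f q) = r * W q f"
      using vf_near_eventually[OF that(2)] smooth_near_eventually[OF that(3)]
      by eventually_elim (rule tangent_scale[OF vf_near_tangent])
    then have "Z p (\<lambda>q. W q (\<lambda>q. r * f q)) = Z p (\<lambda>q. r * W q f)"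
      by (rule tangent_local[OF vf_near_tangent[OF that(1)]])
    then show ?thesis
      by (simp add: tangent_scale[OF vf_near_tangent[OF that(1)] smooth_near_vf[OF that(2,3)]])
  qed
  show ?thesis
    unfolding tangent_space_def mem_Collect_eq
  proof (intro conjI allI impI; (elim conjE)?)
    fix f g assume fg: "smooth_near A p f" "smooth_near A p g"
    show "lie_bracket A X Y p (\<lambda>q. f q + g q) = lie_bracket A X Y p f + lie_bracket A X Y p g"
      by (simp add: lie_bracket_apply fg smooth_near_add add X Y)
    show "lie_bracket A X Y p (\<lambda>q. f q * g q) = f p * lie_bracket A X Y p g + g p * lie_bracket A X Y p f"
      by (simp add: lie_bracket_apply fg smooth_near_mult mult X Y algebra_simps)
  next
    fix r f assume f: "smooth_near A p f"
    show "lie_bracket A X Y p (\<lambda>q. r * f q) = r * lie_bracket A X Y p f"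
      by (simp add: lie_bracket_apply f smooth_near_mult smooth_near_const scale X Y algebra_simps)
  qed (simp add: lie_bracket_def)
qed

end

text \<open>Constant coefficients in a coordinate frame give an extension. It keeps the description
  in \<open>lie_derivative\<close> from being vacuous.\<close>

lemma smooth_local_extension:
  assumes v: "v \<in> tangent_space A p"
  obtains V Y where "open V" "p \<in> V" "smooth_vector_field A V Y" "Y p = v"
proof -
  obtain c where c: "c \<in> A" "p \<in> fst c" by (rule chart_cover)
  let ?Y = "\<lambda>q. \<Sum>k\<in>UNIV. v (coord_fun c k) *\<^sub>R coord_vec A c k q"
  have "vf_near p ?Y"
    unfolding vf_near_iff[OF c]
  proof (intro conjI allI)
    show "\<forall>\<^sub>F q in nhds p. ?Y q \<in> tangent_space A q"
      using eventually_in_chart[OF c]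
      by eventually_elim (intro tangent_space_sum tangent_space_scaleR coord_vec_tangent c(1))
    show "smooth_near A p (\<lambda>q. ?Y q (coord_fun c k))" for k
      unfolding sum_fun_apply scaleR_fun_apply real_scaleR_def
      by (intro smooth_near_intros smooth_near_coord_vec smooth_near_coord_fun c)
  qed
  moreover have "?Y p = v"
    using tangent_eq_sum[OF v c] by simp
  ultimately show ?thesis
    using that unfolding vf_near_def by blast
qed

text \<open>In components, the derivatives of \<open>Y\<close> along \<open>X\<close> occur both in
  \<open>X(\<eta>(Y))\<close> and in \<open>\<eta>([X, Y])\<close> and cancel. What is left involves
  \<open>Y\<close> only through \<open>v\<close>, so the definite description is well
  defined.\<close>

lemma lie_derivative_apply:
  assumes c: "c \<in> A" "p \<in> fst c" and X: "vf_near p X" and \<eta>: "form_near p \<eta>"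
    and v: "v \<in> tangent_space A p"
  shows "lie_derivative A X \<eta> p v =
    (\<Sum>k\<in>UNIV. v (coord_fun c k) * X p (\<lambda>q. \<eta> q (coord_vec A c k q))
      + \<eta> p (coord_vec A c k p) * v (\<lambda>q. X q (coord_fun c k)))" (is "_ = ?r")
proof -
  have main: "X p (\<lambda>q. \<eta> q (Y q)) - \<eta> p (lie_bracket A X Y p) = ?r"
    if Y: "vf_near p Y" and Yv: "Y p = v" for Y
  proof -
    note Xp = vf_near_tangent[OF X]
    note sY = smooth_near_vf[OF Y smooth_near_coord_fun[OF c]]
    note s\<eta> = smooth_near_form[OF \<eta> vf_near_coord_vec[OF c]]
    have "\<forall>\<^sub>F q in nhds p. \<eta> q (Y q) = (\<Sum>k\<in>UNIV. Y q (coord_fun c k) * \<eta> q (coord_vec A c k q))"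
      using eventually_in_chart[OF c] form_near_eventually[OF \<eta>] vf_near_eventually[OF Y]
      by eventually_elim (intro cotangent_expand c(1) form_near_cotangent vf_near_tangent)
    then have "X p (\<lambda>q. \<eta> q (Y q)) =
        X p (\<lambda>q. \<Sum>k\<in>UNIV. Y q (coord_fun c k) * \<eta> q (coord_vec A c k q))"
      by (rule tangent_local[OF Xp])
    also have "\<dots> = (\<Sum>k\<in>UNIV. Y p (coord_fun c k) * X p (\<lambda>q. \<eta> q (coord_vec A c k q))
        + \<eta> p (coord_vec A c k p) * X p (\<lambda>q. Y q (coord_fun c k)))"
      by (simp add: tangent_sum[OF Xp smooth_near_mult[OF sY s\<eta>]] tangent_mult[OF Xp sY s\<eta>])
    finally have 1: "X p (\<lambda>q. \<eta> q (Y q)) = \<dots>" .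
    have "\<eta> p (lie_bracket A X Y p) =
       (\<Sum>k\<in>UNIV. (X p (\<lambda>q. Y q (coord_fun c k)) - Y p (\<lambda>q. X q (coord_fun c k))) * \<eta> p (coord_vec A c k p))"
      by (subst cotangent_expand[OF c form_near_cotangent[OF \<eta>] lie_bracket_tangent[OF X Y]])
        (simp add: lie_bracket_def smooth_near_coord_fun[OF c])
    with 1 Yv show ?thesis
      by (simp add: sum_subtractf[symmetric] algebra_simps)
  qed
  \<comment> \<open>Uniqueness of \<open>r\<close> needs an actual extension; otherwise every real
    would satisfy the universal condition.\<close>
  obtain V0 Y0 where V0: "open V0" "p \<in> V0" "smooth_vector_field A V0 Y0" "Y0 p = v"
    by (rule smooth_local_extension[OF v])
  have "(THE r. \<forall>V Y. open V \<and> p \<in> V \<and> smooth_vector_field A V Y \<and> Y p = v \<longrightarrow>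
      r = X p (\<lambda>q. \<eta> q (Y q)) - \<eta> p (lie_bracket A X Y p)) = ?r"
  proof (rule the_equality)
    show "\<forall>V Y. open V \<and> p \<in> V \<and> smooth_vector_field A V Y \<and> Y p = v \<longrightarrow>
      ?r = X p (\<lambda>q. \<eta> q (Y q)) - \<eta> p (lie_bracket A X Y p)"
    proof (intro allI impI; elim conjE)
      fix V Y assume "open V" "p \<in> V" "smooth_vector_field A V Y" and Yv: "Y p = v"
      then have "vf_near p Y"
        unfolding vf_near_def by blast
      from main[OF this Yv] show "?r = X p (\<lambda>q. \<eta> q (Y q)) - \<eta> p (lie_bracket A X Y p)"
        by (rule sym)
    qed
  next
    fix r assume "\<forall>V Y. open V \<and> p \<in> V \<and> smooth_vector_field A V Y \<and> Y p = v \<longrightarrow>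
      r = X p (\<lambda>q. \<eta> q (Y q)) - \<eta> p (lie_bracket A X Y p)"
    with V0 have "r = X p (\<lambda>q. \<eta> q (Y0 q)) - \<eta> p (lie_bracket A X Y0 p)"
      by blast
    also have "\<dots> = ?r"
      using V0 by (intro main) (auto simp: vf_near_def)
    finally show "r = ?r" .
  qed
  then show ?thesis
    using v by (simp add: lie_derivative_def)
qed

lemma lie_derivative_cotangent:
  assumes X: "vf_near p X" and \<eta>: "form_near p \<eta>"
  shows "lie_derivative A X \<eta> p \<in> cotangent_space A p"
proof -
  obtain c where c: "c \<in> A" "p \<in> fst c" by (rule chart_cover)
  show ?thesis
    unfolding cotangent_space_def
    by (auto simp: lie_derivative_apply[OF c X \<eta>] tangent_space_add tangent_space_scaleR
        sum.distrib[symmetric] sum_distrib_left algebra_simps)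
      (simp add: lie_derivative_def)
qed

lemma lie_derivative_comp:
  assumes c: "c \<in> A" "p \<in> fst c" and X: "vf_near p X" and \<eta>: "form_near p \<eta>"
  shows "lie_derivative A X \<eta> p (coord_vec A c k p) =
    X p (\<lambda>q. \<eta> q (coord_vec A c k q)) +
    (\<Sum>l\<in>UNIV. \<eta> p (coord_vec A c l p) * coord_vec A c k p (\<lambda>q. X q (coord_fun c l)))"
  by (simp add: lie_derivative_apply[OF c X \<eta> coord_vec_tangent[OF c]] coord_vec_coord_fun[OF c]
      sum.distrib if_distrib[of "\<lambda>x. x * _"] cong: if_cong)

subsection \<open>Sections of the generalized tangent bundle\<close>

definition section_near :: "'m \<Rightarrow> ('m \<Rightarrow> 'm gvec) \<Rightarrow> bool" where
  "section_near p s \<longleftrightarrow> vf_near p (\<lambda>q. fst (s q)) \<and> form_near p (\<lambda>q. snd (s q))"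

text \<open>Evaluating directly on the coordinate function agrees with \<open>vec_comp\<close> on
  tangent vectors and makes the components of sums and multiples of sections immediate.\<close>

definition vcoef :: "('m, 'n) chart \<Rightarrow> 'n \<Rightarrow> ('m \<Rightarrow> 'm gvec) \<Rightarrow> 'm \<Rightarrow> real" where
  "vcoef c k s q = fst (s q) (coord_fun c k)"

definition fcoef :: "('m, 'n) chart \<Rightarrow> 'n \<Rightarrow> ('m \<Rightarrow> 'm gvec) \<Rightarrow> 'm \<Rightarrow> real" where
  "fcoef c k s q = snd (s q) (coord_vec A c k q)"

lemma smooth_section_iff:
  "open U \<Longrightarrow> smooth_section A U s \<longleftrightarrow> (\<forall>p\<in>U. section_near p s)"
  by (auto simp: smooth_section_def section_near_def smooth_vector_field_iff smooth_one_form_iff)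

lemma section_near_eventually: "section_near p s \<Longrightarrow> \<forall>\<^sub>F q in nhds p. section_near q s"
  unfolding section_near_def by (intro eventually_conj vf_near_eventually form_near_eventually) auto

lemma section_near_open:
  assumes "section_near p s"
  obtains U where "open U" "p \<in> U" "smooth_section A U s"
proof -
  obtain U where U: "open U" "p \<in> U" "\<forall>q\<in>U. section_near q s"
    using section_near_eventually[OF assms] unfolding eventually_nhds by (elim exE conjE)
  with that show ?thesis by (simp add: smooth_section_iff)
qed

lemma section_near_gen: "section_near p s \<Longrightarrow> s p \<in> gen_tangent_space A p"
  unfolding section_near_def gen_tangent_space_def
  by (metis vf_near_tangent form_near_cotangent mem_Times_iff)

lemma section_near_iff:
  assumes c: "c \<in> A" "p \<in> fst c"
  shows "section_near p s \<longleftrightarrow> (\<forall>\<^sub>F q in nhds p. s q \<in> gen_tangent_space A q) \<and>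
    (\<forall>k. smooth_near A p (vcoef c k s)) \<and> (\<forall>k. smooth_near A p (fcoef c k s))"
  unfolding section_near_def vf_near_iff[OF c] form_near_iff[OF c] gen_tangent_space_def
    mem_Times_iff eventually_conj_iff vcoef_def[abs_def] fcoef_def[abs_def] by blast

context
  fixes c p assumes c: "c \<in> A" "p \<in> fst c"
begin

lemma section_near_vcoef: "section_near p s \<Longrightarrow> smooth_near A p (vcoef c k s)"
  by (simp add: section_near_iff[OF c])

lemma section_near_fcoef: "section_near p s \<Longrightarrow> smooth_near A p (fcoef c k s)"
  by (simp add: section_near_iff[OF c])

lemma section_near_cong:
  assumes s: "section_near p s" and eq: "\<forall>\<^sub>F q in nhds p. s q = t q"
  shows "section_near p t"
  unfolding section_near_iff[OF c]
proof (intro conjI allI)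
  show "\<forall>\<^sub>F q in nhds p. t q \<in> gen_tangent_space A q"
    using section_near_eventually[OF s] eq by eventually_elim (metis section_near_gen)
  show "smooth_near A p (vcoef c k t)" for k
    by (rule smooth_near_cong[OF section_near_vcoef[OF s]])
      (use eq in eventually_elim, simp add: vcoef_def)
  show "smooth_near A p (fcoef c k t)" for k
    by (rule smooth_near_cong[OF section_near_fcoef[OF s]])
      (use eq in eventually_elim, simp add: fcoef_def)
qed

lemma section_near_add:
  assumes s: "section_near p s" and t: "section_near p t"
  shows "section_near p (\<lambda>q. s q + t q)"
  unfolding section_near_iff[OF c]
proof (intro conjI allI)
  show "\<forall>\<^sub>F q in nhds p. s q + t q \<in> gen_tangent_space A q"
    using section_near_eventually[OF s] section_near_eventually[OF t]
    by eventually_elim (intro gen_tangent_space_add section_near_gen)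
  show "smooth_near A p (vcoef c k (\<lambda>q. s q + t q))" for k
    using smooth_near_add[OF section_near_vcoef[OF s] section_near_vcoef[OF t]]
    by (simp add: vcoef_def[abs_def])
  show "smooth_near A p (fcoef c k (\<lambda>q. s q + t q))" for k
    using smooth_near_add[OF section_near_fcoef[OF s] section_near_fcoef[OF t]]
    by (simp add: fcoef_def[abs_def])
qed

lemma section_near_scaleR:
  assumes f: "smooth_near A p f" and s: "section_near p s"
  shows "section_near p (\<lambda>q. f q *\<^sub>R s q)"
  unfolding section_near_iff[OF c]
proof (intro conjI allI)
  show "\<forall>\<^sub>F q in nhds p. f q *\<^sub>R s q \<in> gen_tangent_space A q"
    using section_near_eventually[OF s]
    by eventually_elim (intro gen_tangent_space_scaleR section_near_gen)
  show "smooth_near A p (vcoef c k (\<lambda>q. f q *\<^sub>R s q))" for k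
    using smooth_near_mult[OF f section_near_vcoef[OF s]]
    by (simp add: vcoef_def[abs_def])
  show "smooth_near A p (fcoef c k (\<lambda>q. f q *\<^sub>R s q))" for k
    using smooth_near_mult[OF f section_near_fcoef[OF s]]
    by (simp add: fcoef_def[abs_def])
qed

lemma section_near_zero: "section_near p (\<lambda>q. 0)"
  unfolding section_near_iff[OF c]
  by (simp add: gen_tangent_space_zero vcoef_def[abs_def] fcoef_def[abs_def] smooth_near_const)

lemma section_near_sum:
  assumes "\<And>i. i \<in> I \<Longrightarrow> section_near p (s i)"
  shows "section_near p (\<lambda>q. \<Sum>i\<in>I. s i q)"
  using assms
  by (induction I rule: infinite_finite_induct) (simp_all add: section_near_zero section_near_add)

lemma section_near_frame_vec: "section_near p (frame_vec A c i)"
  unfolding section_near_def frame_vec_def fst_conv snd_conv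
proof
  show "form_near p (\<lambda>q. 0)"
    unfolding form_near_iff[OF c] by (simp add: cotangent_space_zero smooth_near_const)
qed (rule vf_near_coord_vec[OF c])

lemma section_near_frame_form: "section_near p (frame_form A c i)"
  unfolding section_near_def frame_form_def fst_conv snd_conv
proof
  show "vf_near p (\<lambda>q. 0)"
    unfolding vf_near_iff[OF c] by (simp add: tangent_space_zero smooth_near_const)
  show "form_near p (coord_form A c i)"
    unfolding form_near_iff[OF c]
  proof (intro conjI allI)
    show "smooth_near A p (\<lambda>q. coord_form A c i q (coord_vec A c k q))" for k
      by (rule smooth_near_cong[OF smooth_near_vf[OF vf_near_coord_vec[OF c] smooth_near_coord_fun[OF c]]])
        (use eventually_in_chart[OF c] in eventually_elim,
          rule coord_form_apply[OF coord_vec_tangent[OF c(1)], symmetric])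
  qed (simp add: coord_form_cotangent)
qed

lemma vec_comp_eq: "X \<in> tangent_space A p \<Longrightarrow> vec_comp A c k p X = X (coord_fun c k)"
  by (simp add: vec_comp_def coord_form_apply)

lemma pairing_eq:
  assumes "s p \<in> gen_tangent_space A p" "t p \<in> gen_tangent_space A p"
  shows "pairing (s p) (t p) = (\<Sum>l\<in>UNIV. vcoef c l s p * fcoef c l t p + vcoef c l t p * fcoef c l s p)"
proof -
  have s: "fst (s p) \<in> tangent_space A p" "snd (s p) \<in> cotangent_space A p"
    and t: "fst (t p) \<in> tangent_space A p" "snd (t p) \<in> cotangent_space A p"
    using assms by (auto simp: gen_tangent_space_def)
  show ?thesis
    unfolding pairing_def sum.distrib vcoef_def fcoef_def
    by (simp only: cotangent_expand[OF c t(2) s(1)] cotangent_expand[OF c s(2) t(1)])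
qed

subsection \<open>The Courant bracket in coordinates\<close>

context
  fixes s t assumes s: "section_near p s" and t: "section_near p t"
begin

lemma courant_gen: "courant_bracket A s t p \<in> gen_tangent_space A p"
  using s t unfolding section_near_def
  by (auto simp: courant_bracket_def Let_def gen_tangent_space_def intro!: lie_bracket_tangent
    cotangent_space_diff cotangent_space_scaleR lie_derivative_cotangent exterior_d_cotangent)

lemma courant_vec:
  "fst (courant_bracket A s t p) (coord_fun c k) = fst (s p) (vcoef c k t) - fst (t p) (vcoef c k s)"
  by (simp add: courant_bracket_def lie_bracket_def smooth_near_coord_fun[OF c] vcoef_def[abs_def])

lemma courant_form:
  "snd (courant_bracket A s t p) (coord_vec A c k p) =
    fst (s p) (fcoef c k t) + (\<Sum>l\<in>UNIV. fcoef c l t p * coord_vec A c k p (vcoef c l s))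
    - fst (t p) (fcoef c k s) - (\<Sum>l\<in>UNIV. fcoef c l s p * coord_vec A c k p (vcoef c l t))
    - 1/2 * coord_vec A c k p
        (\<lambda>q. \<Sum>l\<in>UNIV. vcoef c l s q * fcoef c l t q - vcoef c l t q * fcoef c l s q)"
proof -
  have vs: "vf_near p (\<lambda>q. fst (s q))" and fs: "form_near p (\<lambda>q. snd (s q))"
    and vt: "vf_near p (\<lambda>q. fst (t q))" and ft: "form_near p (\<lambda>q. snd (t q))"
    using s t by (simp_all add: section_near_def)
  have "\<forall>\<^sub>F q in nhds p. snd (t q) (fst (s q)) - snd (s q) (fst (t q)) =
      (\<Sum>l\<in>UNIV. vcoef c l s q * fcoef c l t q - vcoef c l t q * fcoef c l s q)"
    using eventually_in_chart[OF c] section_near_eventually[OF s] section_near_eventually[OF t]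
  proof eventually_elim
    case (elim q)
    have sq: "fst (s q) \<in> tangent_space A q" "snd (s q) \<in> cotangent_space A q"
      and tq: "fst (t q) \<in> tangent_space A q" "snd (t q) \<in> cotangent_space A q"
      using elim(2,3)[THEN section_near_gen] by (auto simp: gen_tangent_space_def)
    show ?case
      unfolding sum_subtractf vcoef_def fcoef_def
      by (simp only: cotangent_expand[OF c(1) elim(1) tq(2) sq(1)] cotangent_expand[OF c(1) elim(1) sq(2) tq(1)])
  qed
  \<comment> \<open>The function under \<open>d\<close> is known in components only near
    \<open>p\<close>; locality of the tangent vector \<open>coord_vec A c k p\<close> is enough to
    differentiate it.\<close>
  then have ext: "exterior_d A (\<lambda>q. snd (t q) (fst (s q)) - snd (s q) (fst (t q))) p (coord_vec A c k p) =
      coord_vec A c k p (\<lambda>q. \<Sum>l\<in>UNIV. vcoef c l s q * fcoef c l t q - vcoef c l t q * fcoef c l s q)"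
    unfolding exterior_d_apply[OF coord_vec_tangent[OF c]]
    by (rule tangent_local[OF coord_vec_tangent[OF c]])
  show ?thesis
    unfolding courant_bracket_def Let_def snd_conv
    by (simp add: lie_derivative_comp[OF c vs ft] lie_derivative_comp[OF c vt fs] ext)
      (simp add: vcoef_def[abs_def] fcoef_def[abs_def])
qed

end

text \<open>In components the bracket at \<open>p\<close> uses only values at \<open>p\<close> and
  tangent vectors at \<open>p\<close> applied to component functions, and both depend on germs
  alone. This permits replacing a section by its frame expansion, which holds only near
  \<open>p\<close>.\<close>

lemma courant_cong:
  assumes s: "section_near p s" and t: "section_near p t"
    and s': "\<forall>\<^sub>F q in nhds p. s q = s' q" and t': "\<forall>\<^sub>F q in nhds p. t q = t' q"
  shows "courant_bracket A s t p = courant_bracket A s' t' p"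
proof (rule gvec_eqI[OF c])
  note S' = section_near_cong[OF s s'] and T' = section_near_cong[OF t t']
  show "courant_bracket A s t p \<in> gen_tangent_space A p" "courant_bracket A s' t' p \<in> gen_tangent_space A p"
    by (rule courant_gen[OF s t], rule courant_gen[OF S' T'])
  have p: "s p = s' p" "t p = t' p"
    using s' t' by (auto dest: eventually_nhds_x_imp_x)
  have v: "X (vcoef c k s) = X (vcoef c k s')" "X (vcoef c k t) = X (vcoef c k t')"
      "X (fcoef c k s) = X (fcoef c k s')" "X (fcoef c k t) = X (fcoef c k t')"
    if "X \<in> tangent_space A p" for X k
    by (rule tangent_local[OF that], use s' t' in eventually_elim, simp add: vcoef_def fcoef_def)+
  have w: "coord_vec A c k p (\<lambda>q. \<Sum>l\<in>UNIV. vcoef c l s q * fcoef c l t q - vcoef c l t q * fcoef c l s q) =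
     coord_vec A c k p (\<lambda>q. \<Sum>l\<in>UNIV. vcoef c l s' q * fcoef c l t' q - vcoef c l t' q * fcoef c l s' q)" for k
    by (rule tangent_local[OF coord_vec_tangent[OF c]], use s' t' in eventually_elim,
        simp add: vcoef_def fcoef_def)
  have T: "fst (s' p) \<in> tangent_space A p" "fst (t' p) \<in> tangent_space A p"
    using section_near_gen[OF S'] section_near_gen[OF T'] by (auto simp: gen_tangent_space_def)
  have f: "fcoef c k s p = fcoef c k s' p" "fcoef c k t p = fcoef c k t' p" for k
    by (simp_all add: fcoef_def p)
  show "fst (courant_bracket A s t p) (coord_fun c k) = fst (courant_bracket A s' t' p) (coord_fun c k)" for k
    by (simp only: courant_vec[OF s t] courant_vec[OF S' T'] p v[OF T(1)] v[OF T(2)])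
  show "snd (courant_bracket A s t p) (coord_vec A c k p) = snd (courant_bracket A s' t' p) (coord_vec A c k p)" for k
    by (simp only: courant_form[OF s t] courant_form[OF S' T'] p v[OF T(1)] v[OF T(2)]
        v[OF coord_vec_tangent[OF c]] w f)
qed

text \<open>Through its consequence for \<open>nijenhuis\<close>, this lets the later rules be
  stated for the second argument only.\<close>

lemma courant_antisym:
  assumes s: "section_near p s" and t: "section_near p t"
  shows "courant_bracket A t s p = - courant_bracket A s t p"
proof (rule gvec_eqI[OF c])
  show "courant_bracket A t s p \<in> gen_tangent_space A p"
    by (rule courant_gen[OF t s])
  show "- courant_bracket A s t p \<in> gen_tangent_space A p"
    using gen_tangent_space_scaleR[OF courant_gen[OF s t], of "-1"] by simp
  show "fst (courant_bracket A t s p) (coord_fun c k) = fst (- courant_bracket A s t p) (coord_fun c k)" for k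
    by (simp add: courant_vec[OF s t] courant_vec[OF t s])
  have "coord_vec A c k p (\<lambda>q. \<Sum>l\<in>UNIV. vcoef c l t q * fcoef c l s q - vcoef c l s q * fcoef c l t q) =
     coord_vec A c k p (\<lambda>q. - 1 * (\<Sum>l\<in>UNIV. vcoef c l s q * fcoef c l t q - vcoef c l t q * fcoef c l s q))" for k
    by (simp add: sum_negf[symmetric])
  also have "\<dots> k = - 1 * coord_vec A c k p
      (\<lambda>q. \<Sum>l\<in>UNIV. vcoef c l s q * fcoef c l t q - vcoef c l t q * fcoef c l s q)" for k
    by (intro tangent_scale[OF coord_vec_tangent[OF c]] smooth_near_intros
        section_near_vcoef section_near_fcoef s t)
  finally show "snd (courant_bracket A t s p) (coord_vec A c k p) =
      snd (- courant_bracket A s t p) (coord_vec A c k p)" for k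
    by (simp add: courant_form[OF s t] courant_form[OF t s])
qed

lemma courant_add_right:
  assumes s: "section_near p s" and t: "section_near p t" and u: "section_near p u"
  shows "courant_bracket A s (\<lambda>q. t q + u q) p = courant_bracket A s t p + courant_bracket A s u p"
proof (rule gvec_eqI[OF c])
  note tu = section_near_add[OF t u]
  note sm = section_near_vcoef[OF s] section_near_vcoef[OF t] section_near_vcoef[OF u]
    section_near_fcoef[OF s] section_near_fcoef[OF t] section_near_fcoef[OF u]
  have co: "vcoef c k (\<lambda>q. t q + u q) = (\<lambda>q. vcoef c k t q + vcoef c k u q)"
    "fcoef c k (\<lambda>q. t q + u q) = (\<lambda>q. fcoef c k t q + fcoef c k u q)" for k
    by (simp_all add: vcoef_def[abs_def] fcoef_def[abs_def])
  have sT: "fst (s p) \<in> tangent_space A p"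
    using section_near_gen[OF s] by (auto simp: gen_tangent_space_def)
  let ?D = "\<lambda>k. coord_vec A c k p"
  note D = coord_vec_tangent[OF c]
  show "courant_bracket A s (\<lambda>q. t q + u q) p \<in> gen_tangent_space A p"
    by (rule courant_gen[OF s tu])
  show "courant_bracket A s t p + courant_bracket A s u p \<in> gen_tangent_space A p"
    by (intro gen_tangent_space_add courant_gen s t u)
  show "fst (courant_bracket A s (\<lambda>q. t q + u q) p) (coord_fun c k) =
      fst (courant_bracket A s t p + courant_bracket A s u p) (coord_fun c k)" for k
    by (simp add: courant_vec[OF s t] courant_vec[OF s u] courant_vec[OF s tu] co tangent_add[OF sT] sm)
  have "?D k (\<lambda>q. \<Sum>l\<in>UNIV. vcoef c l s q * (fcoef c l t q + fcoef c l u q)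
        - (vcoef c l t q + vcoef c l u q) * fcoef c l s q) =
      ?D k (\<lambda>q. (\<Sum>l\<in>UNIV. vcoef c l s q * fcoef c l t q - vcoef c l t q * fcoef c l s q)
        + (\<Sum>l\<in>UNIV. vcoef c l s q * fcoef c l u q - vcoef c l u q * fcoef c l s q))" for k
    by (simp add: sum.distrib[symmetric] algebra_simps)
  also have "\<dots> k = ?D k (\<lambda>q. \<Sum>l\<in>UNIV. vcoef c l s q * fcoef c l t q - vcoef c l t q * fcoef c l s q)
      + ?D k (\<lambda>q. \<Sum>l\<in>UNIV. vcoef c l s q * fcoef c l u q - vcoef c l u q * fcoef c l s q)" for k
    by (intro tangent_add[OF D] smooth_near_intros sm)
  finally show "snd (courant_bracket A s (\<lambda>q. t q + u q) p) (coord_vec A c k p) =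
      snd (courant_bracket A s t p + courant_bracket A s u p) (coord_vec A c k p)" for k
    by (simp add: courant_form[OF s t] courant_form[OF s u] courant_form[OF s tu] co
        tangent_add[OF sT] tangent_add[OF D] sm sum.distrib algebra_simps)
qed

text \<open>Write \<open>s = X + \<xi>\<close> and \<open>t = Y + \<eta>\<close>. After multiplying
  \<open>t\<close> by \<open>f\<close>, the Lie derivative along \<open>f Y\<close> contributes
  \<open>- \<xi>(Y) df\<close>, and the exact term contributes
  \<open>- 1/2 (\<eta>(X) - \<xi>(Y)) df\<close>. Together they give minus half the pairing times
  \<open>df\<close>, the term that has no counterpart for the Lie bracket.\<close>

lemma courant_scaleR_right:
  assumes s: "section_near p s" and t: "section_near p t" and f: "smooth_near A p f"
  shows "courant_bracket A s (\<lambda>q. f q *\<^sub>R t q) p =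
    f p *\<^sub>R courant_bracket A s t p + fst (s p) f *\<^sub>R t p
      - (1/2 * pairing (s p) (t p)) *\<^sub>R (0, exterior_d A f p)"
proof (rule gvec_eqI[OF c])
  note ft = section_near_scaleR[OF f t]
  note sm = section_near_vcoef[OF s] section_near_vcoef[OF t] section_near_fcoef[OF s] section_near_fcoef[OF t] f
  have co: "vcoef c k (\<lambda>q. f q *\<^sub>R t q) = (\<lambda>q. f q * vcoef c k t q)"
    "fcoef c k (\<lambda>q. f q *\<^sub>R t q) = (\<lambda>q. f q * fcoef c k t q)" for k
    by (simp_all add: vcoef_def[abs_def] fcoef_def[abs_def])
  have sT: "fst (s p) \<in> tangent_space A p"
    using section_near_gen[OF s] by (auto simp: gen_tangent_space_def)
  let ?D = "\<lambda>k. coord_vec A c k p"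
  note D = coord_vec_tangent[OF c]
  have df: "(0, exterior_d A f p) \<in> gen_tangent_space A p"
    by (simp add: gen_tangent_space_def tangent_space_zero exterior_d_cotangent)
  show "courant_bracket A s (\<lambda>q. f q *\<^sub>R t q) p \<in> gen_tangent_space A p"
    by (rule courant_gen[OF s ft])
  show "f p *\<^sub>R courant_bracket A s t p + fst (s p) f *\<^sub>R t p
      - (1/2 * pairing (s p) (t p)) *\<^sub>R (0, exterior_d A f p) \<in> gen_tangent_space A p"
    by (intro gen_tangent_space_add gen_tangent_space_diff gen_tangent_space_scaleR
        courant_gen s t section_near_gen df)
  show "fst (courant_bracket A s (\<lambda>q. f q *\<^sub>R t q) p) (coord_fun c k) =
      fst (f p *\<^sub>R courant_bracket A s t p + fst (s p) f *\<^sub>R t p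
        - (1/2 * pairing (s p) (t p)) *\<^sub>R (0, exterior_d A f p)) (coord_fun c k)" for k
    by (simp add: courant_vec[OF s t] courant_vec[OF s ft] co tangent_mult[OF sT] sm)
      (simp add: vcoef_def[of c k t p] algebra_simps)
  \<comment> \<open>With \<open>f\<close> factored out of the whole sum, one application of the
    Leibniz rule handles the exact term.\<close>
  have G: "?D k (\<lambda>q. \<Sum>l\<in>UNIV. vcoef c l s q * (f q * fcoef c l t q) - f q * vcoef c l t q * fcoef c l s q) =
      f p * ?D k (\<lambda>q. \<Sum>l\<in>UNIV. vcoef c l s q * fcoef c l t q - vcoef c l t q * fcoef c l s q)
       + (\<Sum>l\<in>UNIV. vcoef c l s p * fcoef c l t p - vcoef c l t p * fcoef c l s p) * ?D k f" for k
  proof -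
    have "(\<lambda>q. \<Sum>l\<in>UNIV. vcoef c l s q * (f q * fcoef c l t q) - f q * vcoef c l t q * fcoef c l s q) =
      (\<lambda>q. f q * (\<Sum>l\<in>UNIV. vcoef c l s q * fcoef c l t q - vcoef c l t q * fcoef c l s q))"
      by (simp add: sum_distrib_left algebra_simps)
    then show ?thesis
      by (simp only:) (intro tangent_mult[OF D] smooth_near_intros sm)
  qed
  show "snd (courant_bracket A s (\<lambda>q. f q *\<^sub>R t q) p) (coord_vec A c k p) =
      snd (f p *\<^sub>R courant_bracket A s t p + fst (s p) f *\<^sub>R t p
        - (1/2 * pairing (s p) (t p)) *\<^sub>R (0, exterior_d A f p)) (coord_vec A c k p)" for k
  proof -
    have 1: "fst (s p) (\<lambda>q. f q * fcoef c k t q) = f p * fst (s p) (fcoef c k t) + fcoef c k t p * fst (s p) f"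
      by (rule tangent_mult[OF sT]) (intro sm)+
    have 2: "?D k (\<lambda>q. f q * vcoef c l t q) = f p * ?D k (vcoef c l t) + vcoef c l t p * ?D k f" for l
      by (rule tangent_mult[OF D]) (intro sm)+
    have tp: "snd (t p) (coord_vec A c k p) = fcoef c k t p"
      by (simp add: fcoef_def)
    have ft': "fst (f p *\<^sub>R t p) = f p *\<^sub>R fst (t p)" by simp
    show ?thesis
      unfolding courant_form[OF s ft] co 1 2 G snd_add snd_diff snd_scaleR snd_conv
        plus_fun_apply minus_apply scaleR_fun_apply courant_form[OF s t] tp
        exterior_d_apply[OF D] pairing_eq[of s t, OF section_near_gen[OF s] section_near_gen[OF t]]
        real_scaleR_def ft'
      by (simp add: algebra_simps sum.distrib sum_subtractf sum_distrib_left sum_distrib_right)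
  qed
qed

end

section \<open>The Nijenhuis tensor\<close>

lemma gen_eq_sum:
  assumes c: "c \<in> A" "p \<in> fst c" and u: "u \<in> gen_tangent_space A p"
  shows "u = (\<Sum>l\<in>UNIV. fst u (coord_fun c l) *\<^sub>R frame_vec A c l p) +
    (\<Sum>l\<in>UNIV. snd u (coord_vec A c l p) *\<^sub>R frame_form A c l p)" (is "u = ?r")
proof (rule prod_eqI)
  have u: "fst u \<in> tangent_space A p" "snd u \<in> cotangent_space A p"
    using u by (auto simp: gen_tangent_space_def)
  have "fst ?r = (\<Sum>l\<in>UNIV. fst u (coord_fun c l) *\<^sub>R coord_vec A c l p)"
    by (simp add: fst_sum frame_vec_def frame_form_def)
  also have "\<dots> = fst u"
    by (rule tangent_eq_sum[OF u(1) c, symmetric])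
  finally show "fst u = fst ?r" by (rule sym)
  have "snd ?r = (\<Sum>l\<in>UNIV. snd u (coord_vec A c l p) *\<^sub>R coord_form A c l p)"
    by (simp add: snd_sum frame_vec_def frame_form_def)
  also have "\<dots> = snd u"
    by (rule cotangent_eq_sum[OF c u(2), symmetric])
  finally show "snd u = snd ?r" by (rule sym)
qed

lemma section_frame_expansion:
  assumes c: "c \<in> A" "p \<in> fst c" and s: "section_near p s"
  shows "\<forall>\<^sub>F q in nhds p. s q = (\<Sum>l\<in>UNIV. vcoef c l s q *\<^sub>R frame_vec A c l q) +
    (\<Sum>l\<in>UNIV. fcoef c l s q *\<^sub>R frame_form A c l q)"
  using eventually_in_chart[OF c] section_near_eventually[OF s]
  by eventually_elim (unfold vcoef_def fcoef_def, rule gen_eq_sum[OF c(1) _ section_near_gen])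

text \<open>A coordinate bump is extended by zero. The compact set \<open>?K\<close> outside which
  it vanishes is closed because the manifold is Hausdorff, so the extension is zero near every point
  outside the chart, not merely at it, and hence smooth there.\<close>

lemma cutoff:
  assumes c: "c \<in> A" "p \<in> fst c"
  obtains h where "h p \<noteq> 0" "\<And>q. smooth_near A q h"
    "\<And>q. q \<notin> fst c \<Longrightarrow> \<forall>\<^sub>F q' in nhds q. h q' = (0::real)"
proof -
  have "snd c p \<in> snd c ` fst c" using c by simp
  then obtain r where r: "r > 0" "cball (snd c p) r \<subseteq> snd c ` fst c"
    using chart(2)[OF c(1)] open_contains_cball by metis
  obtain b :: "real^'n \<Rightarrow> real" where b: "\<And>S. smooth_on S b" "b (snd c p) \<noteq> 0"
      "\<And>x. x \<notin> cball (snd c p) r \<Longrightarrow> b x = 0"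
    using smooth_bump[OF r(1), of "snd c p"] by metis
  let ?h = "\<lambda>q. if q \<in> fst c then b (snd c q) else 0"
  let ?K = "chart_inv c ` cball (snd c p) r"
  have "continuous_on (cball (snd c p) r) (chart_inv c)"
    using chart(3)[OF c(1)] r(2) continuous_on_subset unfolding homeomorphism_def by metis
  then have "closed ?K"
    by (intro compact_imp_closed compact_continuous_image) auto
  have K: "?K \<subseteq> fst c"
    using r(2) by (auto intro: inv_into_into)
  have zero: "?h q = 0" if "q \<notin> ?K" for q
  proof (cases "q \<in> fst c")
    case True
    then have "snd c q \<notin> cball (snd c p) r"
      using that chart_inv_chart[OF c(1) True] by (metis image_eqI)
    with b(3) show ?thesis by simp
  qed simp
  have ev0: "\<forall>\<^sub>F q' in nhds q. ?h q' = 0" if "q \<notin> fst c" for q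
  proof -
    have "\<forall>\<^sub>F q' in nhds q. q' \<in> - ?K"
      using \<open>closed ?K\<close> K that by (intro eventually_nhds_in_open) auto
    then show ?thesis
      by eventually_elim (rule zero, simp)
  qed
  have "smooth_near A q ?h" for q
  proof (cases "q \<in> fst c")
    case True
    have "\<forall>\<^sub>F q' in nhds q. b (snd c q') = ?h q'"
      using eventually_in_chart[OF c(1) True] by eventually_elim simp
    with smooth_near_comp[OF c(1) True open_UNIV UNIV_I b(1)] show ?thesis
      by (rule smooth_near_cong)
  next
    case False
    have "\<forall>\<^sub>F q' in nhds q. 0 = ?h q'"
      using ev0[OF False] by eventually_elim (rule sym)
    with smooth_near_const[of q 0] show ?thesis
      by (rule smooth_near_cong)
  qed
  moreover have "?h p \<noteq> 0" using c b(2) by simp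
  ultimately show ?thesis using that[of ?h] ev0 by blast
qed

text \<open>Outside the chart \<open>s\<close> may take any value; near such a point the factor
  \<open>h\<close> is zero, and the product has the germ of the zero section.\<close>

lemma cutoff_section:
  assumes c: "c \<in> A" and s: "\<And>q. q \<in> fst c \<Longrightarrow> section_near q s"
    and h: "\<And>q. smooth_near A q h" "\<And>q. q \<notin> fst c \<Longrightarrow> \<forall>\<^sub>F q' in nhds q. h q' = 0"
  shows "section_near q (\<lambda>q. h q *\<^sub>R s q)"
proof (cases "q \<in> fst c")
  case True
  then show ?thesis by (intro section_near_scaleR[OF c] h(1) s)
next
  case False
  obtain d where d: "d \<in> A" "q \<in> fst d" by (rule chart_cover)
  have "\<forall>\<^sub>F q' in nhds q. 0 = h q' *\<^sub>R s q'"
    using h(2)[OF False] by eventually_elim simp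
  then show ?thesis
    by (rule section_near_cong[OF d section_near_zero[OF d]])
qed

text \<open>The component formula in a form ready for substitution: each component may be replaced
  by any function agreeing with it near \<open>p\<close>, such as a coefficient of \<open>J\<close>
  or a constant. The halves come from the exact term, expanded by the product rule.\<close>

lemma courant_coords:
  assumes c: "c \<in> A" "p \<in> fst c" and s: "section_near p s" and t: "section_near p t"
    and X: "\<And>k. \<forall>\<^sub>F q in nhds p. vcoef c k s q = X k q"
    and \<xi>: "\<And>k. \<forall>\<^sub>F q in nhds p. fcoef c k s q = \<xi> k q"
    and Y: "\<And>k. \<forall>\<^sub>F q in nhds p. vcoef c k t q = Y k q"
    and \<eta>: "\<And>k. \<forall>\<^sub>F q in nhds p. fcoef c k t q = \<eta> k q"
    and D: "\<And>l f. D l f = coord_vec A c l p f"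
  shows "fst (courant_bracket A s t p) (coord_fun c k) = (\<Sum>l\<in>UNIV. X l p * D l (Y k) - Y l p * D l (X k))"
    and "snd (courant_bracket A s t p) (coord_vec A c k p) =
      (\<Sum>l\<in>UNIV. X l p * D l (\<eta> k) + \<eta> l p * D k (X l) - Y l p * D l (\<xi> k) - \<xi> l p * D k (Y l)
        - 1/2 * (X l p * D k (\<eta> l) + \<eta> l p * D k (X l) - Y l p * D k (\<xi> l) - \<xi> l p * D k (Y l)))"
proof -
  note sm = section_near_vcoef[OF c s] section_near_vcoef[OF c t]
    section_near_fcoef[OF c s] section_near_fcoef[OF c t]
  note DT = coord_vec_tangent[OF c]
  have D': "coord_vec A c l p (vcoef c k s) = D l (X k)" "coord_vec A c l p (vcoef c k t) = D l (Y k)"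
    "coord_vec A c l p (fcoef c k s) = D l (\<xi> k)" "coord_vec A c l p (fcoef c k t) = D l (\<eta> k)" for k l
    unfolding D using X[of k] Y[of k] \<xi>[of k] \<eta>[of k] by (auto intro: tangent_local[OF DT])
  have p: "vcoef c k s p = X k p" "vcoef c k t p = Y k p" "fcoef c k s p = \<xi> k p" "fcoef c k t p = \<eta> k p" for k
    using X[of k] Y[of k] \<xi>[of k] \<eta>[of k] by (auto dest: eventually_nhds_x_imp_x)
  have sT: "fst (s p) \<in> tangent_space A p" and tT: "fst (t p) \<in> tangent_space A p"
    using section_near_gen[OF s] section_near_gen[OF t] by (auto simp: gen_tangent_space_def)
  have sf: "fst (s p) f = (\<Sum>l\<in>UNIV. X l p * coord_vec A c l p f)" if "smooth_near A p f" for f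
    using tangent_expand[OF sT c that] by (simp add: p[symmetric] vcoef_def)
  have tf: "fst (t p) f = (\<Sum>l\<in>UNIV. Y l p * coord_vec A c l p f)" if "smooth_near A p f" for f
    using tangent_expand[OF tT c that] by (simp add: p[symmetric] vcoef_def)
  show "fst (courant_bracket A s t p) (coord_fun c k) = (\<Sum>l\<in>UNIV. X l p * D l (Y k) - Y l p * D l (X k))"
    by (simp add: courant_vec[OF c s t] sf tf sm D' sum_subtractf)
  have "coord_vec A c k p (\<lambda>q. \<Sum>l\<in>UNIV. vcoef c l s q * fcoef c l t q - vcoef c l t q * fcoef c l s q) =
      (\<Sum>l\<in>UNIV. coord_vec A c k p (\<lambda>q. vcoef c l s q * fcoef c l t q - vcoef c l t q * fcoef c l s q))"
    by (rule tangent_sum[OF DT]) (intro smooth_near_intros sm)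
  also have "\<dots> = (\<Sum>l\<in>UNIV. X l p * D k (\<eta> l) + \<eta> l p * D k (X l) - (Y l p * D k (\<xi> l) + \<xi> l p * D k (Y l)))"
    by (simp add: tangent_diff[OF DT] tangent_mult[OF DT] smooth_near_mult sm D' p)
  finally have prod: "coord_vec A c k p (\<lambda>q. \<Sum>l\<in>UNIV. vcoef c l s q * fcoef c l t q - vcoef c l t q * fcoef c l s q) =
      (\<Sum>l\<in>UNIV. X l p * D k (\<eta> l) + \<eta> l p * D k (X l) - (Y l p * D k (\<xi> l) + \<xi> l p * D k (Y l)))" .
  show "snd (courant_bracket A s t p) (coord_vec A c k p) =
      (\<Sum>l\<in>UNIV. X l p * D l (\<eta> k) + \<eta> l p * D k (X l) - Y l p * D l (\<xi> k) - \<xi> l p * D k (Y l)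
        - 1/2 * (X l p * D k (\<eta> l) + \<eta> l p * D k (X l) - Y l p * D k (\<xi> l) - \<xi> l p * D k (Y l)))"
    unfolding courant_form[OF c s t] prod sf[OF sm(4)] tf[OF sm(3)] D' p
    by (simp add: sum_subtractf sum.distrib sum_distrib_left algebra_simps)
qed

end

section \<open>Algebra of an orthogonal complex structure on the fibres\<close>

locale gen_almost_complex = smooth_manifold A
  for A :: "('m::{t2_space, second_countable_topology}, 'n::finite) chart set" +
  fixes J :: "'m \<Rightarrow> 'm gvec \<Rightarrow> 'm gvec"
  assumes strong: "strong_gen_almost_complex A J"
begin

lemma endo: "smooth_bundle_endo A J"
  using strong by (simp add: strong_gen_almost_complex_def)

lemma J_gen: "v \<in> gen_tangent_space A p \<Longrightarrow> J p v \<in> gen_tangent_space A p"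
  using endo unfolding smooth_bundle_endo_def by blast

lemma J_add:
  "v \<in> gen_tangent_space A p \<Longrightarrow> w \<in> gen_tangent_space A p \<Longrightarrow> J p (v + w) = J p v + J p w"
  using endo unfolding smooth_bundle_endo_def by blast

lemma J_scaleR: "v \<in> gen_tangent_space A p \<Longrightarrow> J p (r *\<^sub>R v) = r *\<^sub>R J p v"
  using endo unfolding smooth_bundle_endo_def by blast

lemma J_zero: "J p 0 = 0"
  using J_scaleR[OF gen_tangent_space_zero, of p 0] by simp

lemma J_minus: "v \<in> gen_tangent_space A p \<Longrightarrow> J p (- v) = - J p v"
  using J_scaleR[of v p "-1"] by simp

lemma J_diff:
  assumes "v \<in> gen_tangent_space A p" "w \<in> gen_tangent_space A p"
  shows "J p (v - w) = J p v - J p w"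
  using J_add[OF assms(1) gen_tangent_space_scaleR[OF assms(2), of "-1"]] J_scaleR[OF assms(2), of "-1"]
  by simp

lemma J_sum_scaleR:
  assumes "\<And>i. i \<in> I \<Longrightarrow> v i \<in> gen_tangent_space A p"
  shows "J p (\<Sum>i\<in>I. r i *\<^sub>R v i) = (\<Sum>i\<in>I. r i *\<^sub>R J p (v i))"
  using assms
proof (induction I rule: infinite_finite_induct)
  case (insert i I)
  then show ?case
    by (simp add: J_add J_scaleR gen_tangent_space_scaleR gen_tangent_space_sum)
qed (simp_all add: J_zero)

lemma J_J: "v \<in> gen_tangent_space A p \<Longrightarrow> J p (J p v) = - v"
  using strong unfolding strong_gen_almost_complex_def by blast

lemma J_pairing:
  "v \<in> gen_tangent_space A p \<Longrightarrow> w \<in> gen_tangent_space A p \<Longrightarrow> pairing (J p v) (J p w) = pairing v w"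
  using strong unfolding strong_gen_almost_complex_def by blast

text \<open>Orthogonality is applied to \<open>J p v\<close> and \<open>w\<close>, followed by
  \<open>J p (J p v) = - v\<close>.\<close>

lemma J_skew:
  assumes v: "v \<in> gen_tangent_space A p" and w: "w \<in> gen_tangent_space A p"
  shows "pairing (J p v) w = - pairing v (J p w)"
proof -
  have neg: "pairing (- v) (J p w) = - pairing v (J p w)"
    using v J_gen[OF w] cotangent_scaleR[of "snd (J p w)" p "fst v" "-1"]
    by (simp add: pairing_def gen_tangent_space_def mem_Times_iff)
  have "pairing (J p v) w = pairing (J p (J p v)) (J p w)"
    by (rule J_pairing[OF J_gen[OF v] w, symmetric])
  then show ?thesis
    by (simp add: J_J[OF v] neg)
qed

lemma section_near_J:
  assumes "section_near p s"
  shows "section_near p (\<lambda>q. J q (s q))"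
proof -
  obtain U where U: "open U" "p \<in> U" "smooth_section A U s"
    by (rule section_near_open[OF assms])
  then have "smooth_section A U (\<lambda>q. J q (s q))"
    using endo unfolding smooth_bundle_endo_def by blast
  then show ?thesis
    using U by (simp add: smooth_section_iff)
qed

section \<open>Tensoriality of the Nijenhuis expression\<close>

context
  fixes c p assumes c: "c \<in> A" "p \<in> fst c"
begin

lemma nijenhuis_gen:
  "section_near p s \<Longrightarrow> section_near p t \<Longrightarrow> nijenhuis A J s t p \<in> gen_tangent_space A p"
  unfolding nijenhuis_def
  by (intro gen_tangent_space_diff courant_gen[OF c] J_gen section_near_J)

lemma nijenhuis_antisym:
  assumes s: "section_near p s" and t: "section_near p t"
  shows "nijenhuis A J t s p = - nijenhuis A J s t p"
  unfolding nijenhuis_def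
  by (simp add: courant_antisym[OF c s t] courant_antisym[OF c section_near_J[OF s] section_near_J[OF t]]
      courant_antisym[OF c section_near_J[OF s] t] courant_antisym[OF c s section_near_J[OF t]]
      J_minus courant_gen[OF c] s t section_near_J)

lemma nijenhuis_cong:
  assumes s: "section_near p s" and t: "section_near p t" and t': "\<forall>\<^sub>F q in nhds p. t q = t' q"
  shows "nijenhuis A J s t p = nijenhuis A J s t' p"
proof -
  have Jt': "\<forall>\<^sub>F q in nhds p. J q (t q) = J q (t' q)"
    using t' by eventually_elim simp
  have refl: "\<forall>\<^sub>F q in nhds p. u q = u q" for u :: "'m \<Rightarrow> 'm gvec"
    by simp
  show ?thesis
    unfolding nijenhuis_def
    by (simp only: courant_cong[OF c s t refl t'] courant_cong[OF c section_near_J[OF s] t refl t']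
        courant_cong[OF c s section_near_J[OF t] refl Jt']
        courant_cong[OF c section_near_J[OF s] section_near_J[OF t] refl Jt'])
qed

lemma nijenhuis_add_right:
  assumes s: "section_near p s" and t: "section_near p t" and u: "section_near p u"
  shows "nijenhuis A J s (\<lambda>q. t q + u q) p = nijenhuis A J s t p + nijenhuis A J s u p"
proof -
  note Js = section_near_J[OF s] and Jt = section_near_J[OF t] and Ju = section_near_J[OF u]
  have "\<forall>\<^sub>F q in nhds p. J q (t q + u q) = J q (t q) + J q (u q)"
    using section_near_eventually[OF t] section_near_eventually[OF u]
    by eventually_elim (intro J_add section_near_gen)
  note ev = this section_near_J[OF section_near_add[OF c t u]]
  have refl: "\<forall>\<^sub>F q in nhds p. w q = w q" for w :: "'m \<Rightarrow> 'm gvec"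
    by simp
  have *: "courant_bracket A w (\<lambda>q. J q (t q + u q)) p =
      courant_bracket A w (\<lambda>q. J q (t q)) p + courant_bracket A w (\<lambda>q. J q (u q)) p"
    if w: "section_near p w" for w
    using courant_cong[OF c w ev(2) refl ev(1)] courant_add_right[OF c w Jt Ju] by simp
  show ?thesis
    unfolding nijenhuis_def *[OF s] *[OF Js] courant_add_right[OF c s t u] courant_add_right[OF c Js t u]
    by (simp add: J_add courant_gen[OF c] s t u Js Jt Ju)
qed

text \<open>In the Leibniz rule of the Courant bracket the terms in \<open>df\<close> cancel because
  \<open>J\<close> is orthogonal and skew for the pairing.\<close>

lemma nijenhuis_scaleR_right:
  assumes s: "section_near p s" and t: "section_near p t" and f: "smooth_near A p f"
  shows "nijenhuis A J s (\<lambda>q. f q *\<^sub>R t q) p = f p *\<^sub>R nijenhuis A J s t p"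
proof -
  note Js = section_near_J[OF s] and Jt = section_near_J[OF t]
  note sp = section_near_gen[OF s] and tp = section_near_gen[OF t]
  have "\<forall>\<^sub>F q in nhds p. J q (f q *\<^sub>R t q) = f q *\<^sub>R J q (t q)"
    using section_near_eventually[OF t]
    by eventually_elim (intro J_scaleR section_near_gen)
  note ev = this section_near_J[OF section_near_scaleR[OF c f t]]
  have refl: "\<forall>\<^sub>F q in nhds p. w q = w q" for w :: "'m \<Rightarrow> 'm gvec"
    by simp
  let ?e = "(0, exterior_d A f p) :: 'm gvec"
  have e: "?e \<in> gen_tangent_space A p"
    by (simp add: gen_tangent_space_def tangent_space_zero exterior_d_cotangent)
  have 1: "courant_bracket A w (\<lambda>q. J q (f q *\<^sub>R t q)) p =
      f p *\<^sub>R courant_bracket A w (\<lambda>q. J q (t q)) p + fst (w p) f *\<^sub>R J p (t p)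
       - (1/2 * pairing (w p) (J p (t p))) *\<^sub>R ?e"
    if w: "section_near p w" for w
    using courant_cong[OF c w ev(2) refl ev(1)] courant_scaleR_right[OF c w Jt f] by simp
  have "J p (r *\<^sub>R u + a *\<^sub>R v - b *\<^sub>R e) = r *\<^sub>R J p u + a *\<^sub>R J p v - b *\<^sub>R J p e"
    if "u \<in> gen_tangent_space A p" "v \<in> gen_tangent_space A p" "e \<in> gen_tangent_space A p"
    for r a b u v e
    using that
    by (simp add: J_diff J_add J_scaleR gen_tangent_space_add gen_tangent_space_scaleR)
  note 2 = this[OF _ _ e]
  \<comment> \<open>By \<open>J_J\<close> the terms
    \<open>fst (J p (s p)) f *\<^sub>R J p (t p)\<close> and
    \<open>fst (s p) f *\<^sub>R t p\<close> each occur with both signs. The coefficient of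
    \<open>df\<close> is half the difference of the pairings of \<open>s, t\<close> and of
    \<open>J s, J t\<close>; that of \<open>J df\<close> is half the sum of the pairings of
    \<open>J s, t\<close> and of \<open>s, J t\<close>. Both vanish.\<close>
  show ?thesis
    unfolding nijenhuis_def 1[OF s] 1[OF Js] courant_scaleR_right[OF c s t f] courant_scaleR_right[OF c Js t f]
      2[OF courant_gen[OF c s Jt] J_gen[OF tp]] 2[OF courant_gen[OF c Js t] tp] J_J[OF tp]
      J_pairing[OF sp tp] J_skew[OF sp tp]
    by (simp add: algebra_simps)
qed

lemma nijenhuis_sum_right:
  assumes s: "section_near p s" and t: "\<And>i. i \<in> I \<Longrightarrow> section_near p (t i)"
    and f: "\<And>i. i \<in> I \<Longrightarrow> smooth_near A p (f i)" and "finite I"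
  shows "nijenhuis A J s (\<lambda>q. \<Sum>i\<in>I. f i q *\<^sub>R t i q) p = (\<Sum>i\<in>I. f i p *\<^sub>R nijenhuis A J s (t i) p)"
  using \<open>finite I\<close> t f
proof (induction I)
  case empty
  show ?case
    \<comment> \<open>The zero section is 0 times itself, so homogeneity settles the empty
      sum.\<close>
    using nijenhuis_scaleR_right[OF s section_near_zero[OF c] smooth_near_const, of 0] by simp
next
  case (insert i I)
  have "nijenhuis A J s (\<lambda>q. f i q *\<^sub>R t i q + (\<Sum>i\<in>I. f i q *\<^sub>R t i q)) p =
      nijenhuis A J s (\<lambda>q. f i q *\<^sub>R t i q) p + nijenhuis A J s (\<lambda>q. \<Sum>i\<in>I. f i q *\<^sub>R t i q) p"
    by (intro nijenhuis_add_right s section_near_scaleR[OF c] section_near_sum[OF c] insert.prems) auto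
  also have "\<dots> = f i p *\<^sub>R nijenhuis A J s (t i) p + (\<Sum>i\<in>I. f i p *\<^sub>R nijenhuis A J s (t i) p)"
    using insert.IH insert.prems by (simp add: nijenhuis_scaleR_right s)
  finally show ?case
    using insert.hyps by simp
qed

text \<open>Linearity over smooth functions is applied to the frame expansion of \<open>t\<close>.
  Keeping \<open>s\<close> arbitrary allows the lemma to be used for each argument in turn.\<close>

lemma nijenhuis_zero_right:
  assumes s: "section_near p s" and t: "section_near p t"
    and "\<And>l. nijenhuis A J s (frame_vec A c l) p = 0" "\<And>l. nijenhuis A J s (frame_form A c l) p = 0"
  shows "nijenhuis A J s t p = 0"
proof -
  note fv = section_near_frame_vec[OF c] and ff = section_near_frame_form[OF c]
  note sm = section_near_vcoef[OF c t] section_near_fcoef[OF c t]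
  have "nijenhuis A J s t p = nijenhuis A J s (\<lambda>q. (\<Sum>l\<in>UNIV. vcoef c l t q *\<^sub>R frame_vec A c l q) +
      (\<Sum>l\<in>UNIV. fcoef c l t q *\<^sub>R frame_form A c l q)) p"
    by (rule nijenhuis_cong[OF s t section_frame_expansion[OF c t]])
  also have "\<dots> = nijenhuis A J s (\<lambda>q. \<Sum>l\<in>UNIV. vcoef c l t q *\<^sub>R frame_vec A c l q) p +
      nijenhuis A J s (\<lambda>q. \<Sum>l\<in>UNIV. fcoef c l t q *\<^sub>R frame_form A c l q) p"
    by (intro nijenhuis_add_right s section_near_sum[OF c] section_near_scaleR[OF c] fv ff sm)
  also have "\<dots> = 0"
    by (simp add: nijenhuis_sum_right s fv ff sm assms(3,4))
  finally show ?thesis .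
qed

end

lemma courant_integrable_iff:
  "courant_integrable A J \<longleftrightarrow> (\<forall>c\<in>A. \<forall>p\<in>fst c. \<forall>i j.
     nijenhuis A J (frame_vec A c i) (frame_vec A c j) p = 0 \<and>
     nijenhuis A J (frame_form A c i) (frame_form A c j) p = 0 \<and>
     nijenhuis A J (frame_vec A c i) (frame_form A c j) p = 0)" (is "_ \<longleftrightarrow> ?R")
proof
  assume int: "courant_integrable A J"
  have zero: "nijenhuis A J s t p = 0"
    if c: "c \<in> A" "p \<in> fst c" and s: "\<And>q. q \<in> fst c \<Longrightarrow> section_near q s"
      and t: "\<And>q. q \<in> fst c \<Longrightarrow> section_near q t" for c p s t
  proof -
    obtain h where h: "h p \<noteq> 0" "\<And>q. smooth_near A q h"
      "\<And>q. q \<notin> fst c \<Longrightarrow> \<forall>\<^sub>F q' in nhds q. h q' = (0::real)"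
      by (rule cutoff[OF c]) (rule that)
    let ?s = "\<lambda>q. h q *\<^sub>R s q" and ?t = "\<lambda>q. h q *\<^sub>R t q"
    have S: "section_near q ?s" for q by (rule cutoff_section[OF c(1) s h(2,3)])
    have T: "section_near q ?t" for q by (rule cutoff_section[OF c(1) t h(2,3)])
    have "nijenhuis A J ?s ?t p = 0"
      using int S T unfolding courant_integrable_def by (simp add: smooth_section_iff)
    \<comment> \<open>One factor leaves the second argument directly, the other leaves the first
      after the arguments are exchanged and exchanged back.\<close>
    moreover have "nijenhuis A J ?s ?t p = (h p * h p) *\<^sub>R nijenhuis A J s t p"
      using nijenhuis_scaleR_right[OF c S t[OF c(2)] h(2)] nijenhuis_antisym[OF c t[OF c(2)] S]
        nijenhuis_scaleR_right[OF c t[OF c(2)] s[OF c(2)] h(2)]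
        nijenhuis_antisym[OF c t[OF c(2)] s[OF c(2)]] by simp
    ultimately show ?thesis using h(1) by simp
  qed
  show ?R
    by (intro ballI allI conjI zero section_near_frame_vec section_near_frame_form)
next
  assume R: ?R
  show "courant_integrable A J"
    unfolding courant_integrable_def
  proof (intro allI impI, elim conjE)
    fix v w p assume "smooth_section A UNIV v" "smooth_section A UNIV w"
    then have v: "section_near p v" and w: "section_near p w"
      by (simp_all add: smooth_section_iff)
    obtain c where c: "c \<in> A" "p \<in> fst c" by (rule chart_cover)
    note fv = section_near_frame_vec[OF c] and ff = section_near_frame_form[OF c]
    \<comment> \<open>With a frame section in the first argument, \<open>w\<close> is expanded in
      the second; after an exchange of arguments \<open>v\<close> is expanded in the same
      way.\<close>
    have 1: "nijenhuis A J (frame_vec A c i) w p = 0" for i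
      using R c by (intro nijenhuis_zero_right[OF c fv w]) auto
    have 2: "nijenhuis A J (frame_form A c i) w p = 0" for i
      \<comment> \<open>The pair of a form and a vector is absent from \<open>?R\<close>;
        antisymmetry obtains it from the pair of a vector and a form.\<close>
      using R c nijenhuis_antisym[OF c fv ff] by (intro nijenhuis_zero_right[OF c ff w]) auto
    have "nijenhuis A J w v p = 0"
      using 1 2 nijenhuis_antisym[OF c fv w] nijenhuis_antisym[OF c ff w]
      by (intro nijenhuis_zero_right[OF c w v]) auto
    then show "nijenhuis A J v w p = 0"
      using nijenhuis_antisym[OF c w v] by simp
  qed
qed

section \<open>The coordinate matrix of \<open>J\<close>\<close>

context
  fixes c p and H \<alpha> \<beta> K :: "'n \<Rightarrow> 'n \<Rightarrow> 'm \<Rightarrow> real"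
  assumes c: "c \<in> A" "p \<in> fst c"
  defines H: "H \<equiv> coeff_H A J c" and \<alpha>: "\<alpha> \<equiv> coeff_alpha A J c"
    and \<beta>: "\<beta> \<equiv> coeff_beta A J c" and K: "K \<equiv> coeff_K A J c"
begin

lemma J_frame_gen:
  "J p (frame_vec A c i p) \<in> gen_tangent_space A p" "J p (frame_form A c i p) \<in> gen_tangent_space A p"
  by (intro J_gen section_near_gen section_near_frame_vec[OF c],
      intro J_gen section_near_gen section_near_frame_form[OF c])

lemma J_frame_tangent:
  "fst (J p (frame_vec A c i p)) \<in> tangent_space A p" "snd (J p (frame_vec A c i p)) \<in> cotangent_space A p"
  "fst (J p (frame_form A c i p)) \<in> tangent_space A p" "snd (J p (frame_form A c i p)) \<in> cotangent_space A p"
  using J_frame_gen[of i] by (auto simp: gen_tangent_space_def mem_Times_iff)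

lemma coeff_eq:
  "H i k p = fst (J p (frame_vec A c i p)) (coord_fun c k)"
  "\<alpha> i k p = fst (J p (frame_form A c i p)) (coord_fun c k)"
  "\<beta> i k p = snd (J p (frame_vec A c i p)) (coord_vec A c k p)"
  "K i k p = snd (J p (frame_form A c i p)) (coord_vec A c k p)"
  using vec_comp_eq[OF c J_frame_tangent(1)] vec_comp_eq[OF c J_frame_tangent(3)]
  by (simp_all add: H \<alpha> \<beta> K coeff_H_def coeff_alpha_def coeff_beta_def coeff_K_def block_H_def
      block_alpha_def block_beta_def block_K_def frame_vec_def frame_form_def form_comp_def)

text \<open>\<open>J\<close> acts on components by its block matrix. Applied to the mixed brackets,
  this produces the outer factors \<open>H l k\<close>, \<open>\<alpha> l k\<close>,
  \<open>\<beta> l k\<close> and \<open>K l k\<close> of the six expressions.\<close>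

lemma J_comp:
  assumes u: "u \<in> gen_tangent_space A p"
  shows "fst (J p u) (coord_fun c k) =
      (\<Sum>l\<in>UNIV. fst u (coord_fun c l) * H l k p + snd u (coord_vec A c l p) * \<alpha> l k p)"
    and "snd (J p u) (coord_vec A c k p) =
      (\<Sum>l\<in>UNIV. fst u (coord_fun c l) * \<beta> l k p + snd u (coord_vec A c l p) * K l k p)"
proof -
  note fv = section_near_gen[OF section_near_frame_vec[OF c]]
    and ff = section_near_gen[OF section_near_frame_form[OF c]]
  have "J p u = J p ((\<Sum>l\<in>UNIV. fst u (coord_fun c l) *\<^sub>R frame_vec A c l p) +
      (\<Sum>l\<in>UNIV. snd u (coord_vec A c l p) *\<^sub>R frame_form A c l p))"
    by (rule arg_cong[OF gen_eq_sum[OF c u]])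
  also have "\<dots> = (\<Sum>l\<in>UNIV. fst u (coord_fun c l) *\<^sub>R J p (frame_vec A c l p)) +
      (\<Sum>l\<in>UNIV. snd u (coord_vec A c l p) *\<^sub>R J p (frame_form A c l p))"
    by (simp add: J_add J_sum_scaleR gen_tangent_space_sum gen_tangent_space_scaleR fv ff)
  finally have Ju: "J p u = \<dots>" .
  show "fst (J p u) (coord_fun c k) =
      (\<Sum>l\<in>UNIV. fst u (coord_fun c l) * H l k p + snd u (coord_vec A c l p) * \<alpha> l k p)"
    unfolding Ju by (simp add: fst_sum sum_fun_apply coeff_eq sum.distrib)
  show "snd (J p u) (coord_vec A c k p) =
      (\<Sum>l\<in>UNIV. fst u (coord_fun c l) * \<beta> l k p + snd u (coord_vec A c l p) * K l k p)"
    unfolding Ju by (simp add: snd_sum sum_fun_apply coeff_eq sum.distrib)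
qed

text \<open>\<open>vec_comp\<close> agrees with evaluation on a coordinate function only at tangent
  vectors, so membership of \<open>N\<close> in the fibre comes before the comparison of
  components.\<close>

lemma nijenhuis_eq_0_iff:
  assumes s: "section_near p s" and t: "section_near p t"
  shows "nijenhuis A J s t p = 0 \<longleftrightarrow> (\<forall>k. vec_comp A c k p (fst (nijenhuis A J s t p)) = 0 \<and>
    form_comp A c k p (snd (nijenhuis A J s t p)) = 0)"
proof -
  note N = nijenhuis_gen[OF c s t]
  then have T: "fst (nijenhuis A J s t p) \<in> tangent_space A p"
    by (auto simp: gen_tangent_space_def mem_Times_iff)
  show ?thesis
  proof
    assume "nijenhuis A J s t p = 0"
    then show "\<forall>k. vec_comp A c k p (fst (nijenhuis A J s t p)) = 0 \<and>
        form_comp A c k p (snd (nijenhuis A J s t p)) = 0"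
      using vec_comp_eq[OF c tangent_space_zero] by (simp add: form_comp_def)
  next
    assume "\<forall>k. vec_comp A c k p (fst (nijenhuis A J s t p)) = 0 \<and>
        form_comp A c k p (snd (nijenhuis A J s t p)) = 0"
    then show "nijenhuis A J s t p = 0"
      by (intro gvec_eqI[OF c N gen_tangent_space_zero]) (simp_all add: vec_comp_eq[OF c T] form_comp_def)
  qed
qed

lemma block_expansions:
  "block_H J p (coord_vec A c i p) = (\<Sum>j\<in>UNIV. H i j p *\<^sub>R coord_vec A c j p)"
  "block_alpha J p (coord_form A c i p) = (\<Sum>j\<in>UNIV. \<alpha> i j p *\<^sub>R coord_vec A c j p)"
  "block_beta J p (coord_vec A c i p) = (\<Sum>j\<in>UNIV. \<beta> i j p *\<^sub>R coord_form A c j p)"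
  "block_K J p (coord_form A c i p) = (\<Sum>j\<in>UNIV. K i j p *\<^sub>R coord_form A c j p)"
  unfolding coeff_eq block_H_def block_alpha_def block_beta_def block_K_def
    frame_vec_def[symmetric] frame_form_def[symmetric]
  by (rule tangent_eq_sum[OF J_frame_tangent(1) c] tangent_eq_sum[OF J_frame_tangent(3) c]
      cotangent_eq_sum[OF c J_frame_tangent(2)] cotangent_eq_sum[OF c J_frame_tangent(4)])+

end

section \<open>The Nijenhuis tensor on coordinate frames\<close>

context
  fixes c p and H \<alpha> \<beta> K :: "'n \<Rightarrow> 'n \<Rightarrow> 'm \<Rightarrow> real" and D :: "'n \<Rightarrow> ('m \<Rightarrow> real) \<Rightarrow> 'm \<Rightarrow> real"
  assumes c: "c \<in> A" "p \<in> fst c"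
  defines H: "H \<equiv> coeff_H A J c" and \<alpha>: "\<alpha> \<equiv> coeff_alpha A J c"
    and \<beta>: "\<beta> \<equiv> coeff_beta A J c" and K: "K \<equiv> coeff_K A J c"
  assumes D: "\<And>l f q. D l f q = coord_vec A c l q f"
begin

text \<open>Equality near \<open>p\<close>, not just at \<open>p\<close>, is what the bracket needs,
  since it differentiates these components.\<close>

lemma coeff_eventually:
  "\<forall>\<^sub>F q in nhds p. vcoef c k (\<lambda>q. J q (frame_vec A c i q)) q = H i k q"
  "\<forall>\<^sub>F q in nhds p. vcoef c k (\<lambda>q. J q (frame_form A c i q)) q = \<alpha> i k q"
  "\<forall>\<^sub>F q in nhds p. fcoef c k (\<lambda>q. J q (frame_vec A c i q)) q = \<beta> i k q"
  "\<forall>\<^sub>F q in nhds p. fcoef c k (\<lambda>q. J q (frame_form A c i q)) q = K i k q"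
  by (use eventually_in_chart[OF c] in eventually_elim,
      simp add: vcoef_def fcoef_def H \<alpha> \<beta> K coeff_eq[OF c(1)])+

text \<open>The components of the frame are constant near \<open>p\<close>, so only derivatives of
  the coefficients of \<open>J\<close> survive in the brackets.\<close>

lemma frame_eventually:
  "\<forall>\<^sub>F q in nhds p. vcoef c k (frame_vec A c i) q = (if k = i then 1 else 0)"
  "\<forall>\<^sub>F q in nhds p. fcoef c k (frame_vec A c i) q = 0"
  "\<forall>\<^sub>F q in nhds p. vcoef c k (frame_form A c i) q = 0"
  "\<forall>\<^sub>F q in nhds p. fcoef c k (frame_form A c i) q = (if k = i then 1 else 0)"
  by (use eventually_in_chart[OF c] in eventually_elim, 
      simp add: vcoef_def fcoef_def frame_vec_def frame_form_def coord_vec_coord_fun[OF c(1)]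
        coord_form_apply[OF coord_vec_tangent[OF c(1)]])+

lemma coeff_smooth:
  "smooth_near A p (H i k)" "smooth_near A p (\<alpha> i k)" "smooth_near A p (\<beta> i k)" "smooth_near A p (K i k)"
  by (rule smooth_near_cong[OF section_near_vcoef[OF c section_near_J[OF section_near_frame_vec[OF c]]] coeff_eventually(1)],
      rule smooth_near_cong[OF section_near_vcoef[OF c section_near_J[OF section_near_frame_form[OF c]]] coeff_eventually(2)],
      rule smooth_near_cong[OF section_near_fcoef[OF c section_near_J[OF section_near_frame_vec[OF c]]] coeff_eventually(3)],
      rule smooth_near_cong[OF section_near_fcoef[OF c section_near_J[OF section_near_frame_form[OF c]]] coeff_eventually(4)])

lemma
  shows D_const: "D l (\<lambda>q. r) p = 0"
    and D_diff: "smooth_near A p f \<Longrightarrow> smooth_near A p g \<Longrightarrow> D l (\<lambda>q. f q - g q) p = D l f p - D l g p"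
    and D_mult: "smooth_near A p f \<Longrightarrow> smooth_near A p g \<Longrightarrow> D l (\<lambda>q. f q * g q) p = f p * D l g p + g p * D l f p"
    and D_sum: "(\<And>i. i \<in> I \<Longrightarrow> smooth_near A p (u i)) \<Longrightarrow> D l (\<lambda>q. \<Sum>i\<in>I. u i q) p = (\<Sum>i\<in>I. D l (u i) p)"
  unfolding D
  by (rule tangent_const[OF coord_vec_tangent[OF c]], rule tangent_diff[OF coord_vec_tangent[OF c]], assumption+,
      rule tangent_mult[OF coord_vec_tangent[OF c]], assumption+, rule tangent_sum[OF coord_vec_tangent[OF c]])

lemma nijenhuis_comp:
  assumes s: "section_near p s" and t: "section_near p t"
  shows "vec_comp A c k p (fst (nijenhuis A J s t p)) =
      fst (courant_bracket A (\<lambda>q. J q (s q)) (\<lambda>q. J q (t q)) p) (coord_fun c k)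
      - fst (J p (courant_bracket A (\<lambda>q. J q (s q)) t p)) (coord_fun c k)
      - fst (J p (courant_bracket A s (\<lambda>q. J q (t q)) p)) (coord_fun c k)
      - fst (courant_bracket A s t p) (coord_fun c k)"
    and "form_comp A c k p (snd (nijenhuis A J s t p)) =
      snd (courant_bracket A (\<lambda>q. J q (s q)) (\<lambda>q. J q (t q)) p) (coord_vec A c k p)
      - snd (J p (courant_bracket A (\<lambda>q. J q (s q)) t p)) (coord_vec A c k p)
      - snd (J p (courant_bracket A s (\<lambda>q. J q (t q)) p)) (coord_vec A c k p)
      - snd (courant_bracket A s t p) (coord_vec A c k p)"
proof -
  have "fst (nijenhuis A J s t p) \<in> tangent_space A p"
    using nijenhuis_gen[OF c s t] by (auto simp: gen_tangent_space_def mem_Times_iff)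
  then show "vec_comp A c k p (fst (nijenhuis A J s t p)) =
      fst (courant_bracket A (\<lambda>q. J q (s q)) (\<lambda>q. J q (t q)) p) (coord_fun c k)
      - fst (J p (courant_bracket A (\<lambda>q. J q (s q)) t p)) (coord_fun c k)
      - fst (J p (courant_bracket A s (\<lambda>q. J q (t q)) p)) (coord_fun c k)
      - fst (courant_bracket A s t p) (coord_fun c k)"
    by (simp add: vec_comp_eq[OF c] nijenhuis_def)
qed (simp add: form_comp_def nijenhuis_def)

lemmas fv = section_near_frame_vec[OF c] and ff = section_near_frame_form[OF c]
lemmas jv = section_near_J[OF fv] and jf = section_near_J[OF ff]
lemmas Jc = J_comp[OF c, folded H \<alpha> \<beta> K]

text \<open>Products with Kronecker deltas are brought into the conditional form in which a finite
  sum collapses to one term.\<close>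

lemma mult_delta:
  fixes x r :: real
  shows "(if b then 1 else 0) * x = (if b then x else 0)" "x * (if b then 1 else 0) = (if b then x else 0)"
    "r * (if b then x else 0) = (if b then r * x else 0)"
  by simp_all

lemmas delta_simps = D_const sum_subtractf sum.distrib sum_negf mult_delta algebra_simps

text \<open>The six expressions contain derivatives of differences and of sums of products.
  Expanding these turns both sides into the same polynomial in the coefficients and their first
  derivatives.\<close>

lemmas expand_simps = D_diff D_sum D_mult coeff_smooth smooth_near_intros sum.distrib sum_subtractf
  sum_negf sum_distrib_left sum_divide_distrib algebra_simps

lemma nijenhuis_vec_vec:
  "vec_comp A c k p (fst (nijenhuis A J (frame_vec A c i) (frame_vec A c j) p)) = lhs1 D H \<alpha> \<beta> i j k p"
  "form_comp A c k p (snd (nijenhuis A J (frame_vec A c i) (frame_vec A c j) p)) = lhs2 D H \<beta> K i j k p"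
proof -
  let ?D = "\<lambda>l f. D l f p"
  have D': "\<And>l f. ?D l f = coord_vec A c l p f" by (rule D)
  \<comment> \<open>The two letters record, argument by argument, whether \<open>J\<close> is
    applied (\<open>J\<close>) or not (\<open>I\<close>).\<close>
  note JJ = courant_coords[OF c jv[of i] jv[of j] coeff_eventually(1,3) coeff_eventually(1,3), of ?D, OF D']
  note JI = courant_coords[OF c jv[of i] fv[of j] coeff_eventually(1,3) frame_eventually(1,2), of ?D, OF D']
  note IJ = courant_coords[OF c fv[of i] jv[of j] frame_eventually(1,2) coeff_eventually(1,3), of ?D, OF D']
  note II = courant_coords[OF c fv[of i] fv[of j] frame_eventually(1,2) frame_eventually(1,2), of ?D, OF D']
  \<comment> \<open>The Lie derivative along the field of index \<open>j\<close> gives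
    \<open>- ?D j (\<beta> i k)\<close>; the exact term returns half the derivative of the
    contraction \<open>\<beta> i j\<close>.\<close>
  have JI': "fst (courant_bracket A (\<lambda>q. J q (frame_vec A c i q)) (frame_vec A c j) p) (coord_fun c k) = - ?D j (H i k)"
    "snd (courant_bracket A (\<lambda>q. J q (frame_vec A c i q)) (frame_vec A c j) p) (coord_vec A c k p) = 1/2 * ?D k (\<beta> i j) - ?D j (\<beta> i k)" for k
    unfolding JI by (simp_all add: delta_simps)
  have IJ': "fst (courant_bracket A (frame_vec A c i) (\<lambda>q. J q (frame_vec A c j q)) p) (coord_fun c k) = ?D i (H j k)"
    "snd (courant_bracket A (frame_vec A c i) (\<lambda>q. J q (frame_vec A c j q)) p) (coord_vec A c k p) = ?D i (\<beta> j k) - 1/2 * ?D k (\<beta> j i)" for k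
    unfolding IJ by (simp_all add: delta_simps)
  have II': "fst (courant_bracket A (frame_vec A c i) (frame_vec A c j) p) (coord_fun c k) = 0"
    "snd (courant_bracket A (frame_vec A c i) (frame_vec A c j) p) (coord_vec A c k p) = 0" for k
    unfolding II by (simp_all add: D_const)
  show "vec_comp A c k p (fst (nijenhuis A J (frame_vec A c i) (frame_vec A c j) p)) = lhs1 D H \<alpha> \<beta> i j k p"
    unfolding nijenhuis_comp(1)[OF fv fv] JJ Jc(1)[OF courant_gen[OF c jv fv]]
      Jc(1)[OF courant_gen[OF c fv jv]] JI' IJ' II' lhs1_def
    by (simp add: expand_simps)
  show "form_comp A c k p (snd (nijenhuis A J (frame_vec A c i) (frame_vec A c j) p)) = lhs2 D H \<beta> K i j k p"
    unfolding nijenhuis_comp(2)[OF fv fv] JJ Jc(2)[OF courant_gen[OF c jv fv]]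
      Jc(2)[OF courant_gen[OF c fv jv]] JI' IJ' II' lhs2_def
    by (simp add: expand_simps)
qed

lemma nijenhuis_form_form:
  "vec_comp A c k p (fst (nijenhuis A J (frame_form A c i) (frame_form A c j) p)) = lhs3 D \<alpha> i j k p"
  "form_comp A c k p (snd (nijenhuis A J (frame_form A c i) (frame_form A c j) p)) = lhs4 D \<alpha> K i j k p"
proof -
  let ?D = "\<lambda>l f. D l f p"
  have D': "\<And>l f. ?D l f = coord_vec A c l p f" by (rule D)
  note JJ = courant_coords[OF c jf[of i] jf[of j] coeff_eventually(2,4) coeff_eventually(2,4), of ?D, OF D']
  note JI = courant_coords[OF c jf[of i] ff[of j] coeff_eventually(2,4) frame_eventually(3,4), of ?D, OF D']
  note IJ = courant_coords[OF c ff[of i] jf[of j] frame_eventually(3,4) coeff_eventually(2,4), of ?D, OF D']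
  note II = courant_coords[OF c ff[of i] ff[of j] frame_eventually(3,4) frame_eventually(3,4), of ?D, OF D']
  \<comment> \<open>The Lie derivative of the form of index \<open>j\<close> along the field part
    \<open>\<alpha> i\<close> is the differential of \<open>\<alpha> i j\<close>, and the exact term
    takes away half of it.\<close>
  have JI': "fst (courant_bracket A (\<lambda>q. J q (frame_form A c i q)) (frame_form A c j) p) (coord_fun c k) = 0"
    "snd (courant_bracket A (\<lambda>q. J q (frame_form A c i q)) (frame_form A c j) p) (coord_vec A c k p) = 1/2 * ?D k (\<alpha> i j)" for k
    unfolding JI by (simp_all add: delta_simps)
  have IJ': "fst (courant_bracket A (frame_form A c i) (\<lambda>q. J q (frame_form A c j q)) p) (coord_fun c k) = 0"
    "snd (courant_bracket A (frame_form A c i) (\<lambda>q. J q (frame_form A c j q)) p) (coord_vec A c k p) = - (1/2 * ?D k (\<alpha> j i))" for k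
    unfolding IJ by (simp_all add: delta_simps)
  have II': "fst (courant_bracket A (frame_form A c i) (frame_form A c j) p) (coord_fun c k) = 0"
    "snd (courant_bracket A (frame_form A c i) (frame_form A c j) p) (coord_vec A c k p) = 0" for k
    unfolding II by (simp_all add: D_const)
  show "vec_comp A c k p (fst (nijenhuis A J (frame_form A c i) (frame_form A c j) p)) = lhs3 D \<alpha> i j k p"
    unfolding nijenhuis_comp(1)[OF ff ff] JJ Jc(1)[OF courant_gen[OF c jf ff]]
      Jc(1)[OF courant_gen[OF c ff jf]] JI' IJ' II' lhs3_def
    by (simp add: expand_simps)
  show "form_comp A c k p (snd (nijenhuis A J (frame_form A c i) (frame_form A c j) p)) = lhs4 D \<alpha> K i j k p"
    unfolding nijenhuis_comp(2)[OF ff ff] JJ Jc(2)[OF courant_gen[OF c jf ff]]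
      Jc(2)[OF courant_gen[OF c ff jf]] JI' IJ' II' lhs4_def
    by (simp add: expand_simps)
qed

lemma nijenhuis_vec_form:
  "vec_comp A c k p (fst (nijenhuis A J (frame_vec A c i) (frame_form A c j) p)) = lhs5 D H \<alpha> K i j k p"
  "form_comp A c k p (snd (nijenhuis A J (frame_vec A c i) (frame_form A c j) p)) = lhs6 D H \<alpha> \<beta> K i j k p"
proof -
  let ?D = "\<lambda>l f. D l f p"
  have D': "\<And>l f. ?D l f = coord_vec A c l p f" by (rule D)
  note JJ = courant_coords[OF c jv[of i] jf[of j] coeff_eventually(1,3) coeff_eventually(2,4), of ?D, OF D']
  note JI = courant_coords[OF c jv[of i] ff[of j] coeff_eventually(1,3) frame_eventually(3,4), of ?D, OF D']
  note IJ = courant_coords[OF c fv[of i] jf[of j] frame_eventually(1,2) coeff_eventually(2,4), of ?D, OF D']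
  note II = courant_coords[OF c fv[of i] ff[of j] frame_eventually(1,2) frame_eventually(3,4), of ?D, OF D']
  \<comment> \<open>The form part \<open>\<beta> i\<close> meets only a zero field and drops out;
    the differential of \<open>H i j\<close> is halved by the exact term.\<close>
  have JI': "fst (courant_bracket A (\<lambda>q. J q (frame_vec A c i q)) (frame_form A c j) p) (coord_fun c k) = 0"
    "snd (courant_bracket A (\<lambda>q. J q (frame_vec A c i q)) (frame_form A c j) p) (coord_vec A c k p) = 1/2 * ?D k (H i j)" for k
    unfolding JI by (simp_all add: delta_simps)
  \<comment> \<open>The Lie derivative differentiates \<open>K j k\<close>; the half belongs to the
    contraction \<open>K j i\<close> inside the exact term.\<close>
  have IJ': "fst (courant_bracket A (frame_vec A c i) (\<lambda>q. J q (frame_form A c j q)) p) (coord_fun c k) = ?D i (\<alpha> j k)"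
    "snd (courant_bracket A (frame_vec A c i) (\<lambda>q. J q (frame_form A c j q)) p) (coord_vec A c k p) = ?D i (K j k) - 1/2 * ?D k (K j i)" for k
    unfolding IJ by (simp_all add: delta_simps)
  have II': "fst (courant_bracket A (frame_vec A c i) (frame_form A c j) p) (coord_fun c k) = 0"
    "snd (courant_bracket A (frame_vec A c i) (frame_form A c j) p) (coord_vec A c k p) = 0" for k
    unfolding II by (simp_all add: D_const)
  show "vec_comp A c k p (fst (nijenhuis A J (frame_vec A c i) (frame_form A c j) p)) = lhs5 D H \<alpha> K i j k p"
    unfolding nijenhuis_comp(1)[OF fv ff] JJ Jc(1)[OF courant_gen[OF c jv ff]]
      Jc(1)[OF courant_gen[OF c fv jf]] JI' IJ' II' lhs5_def
    by (simp add: expand_simps)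
  show "form_comp A c k p (snd (nijenhuis A J (frame_vec A c i) (frame_form A c j) p)) = lhs6 D H \<alpha> \<beta> K i j k p"
    unfolding nijenhuis_comp(2)[OF fv ff] JJ Jc(2)[OF courant_gen[OF c jv ff]]
      Jc(2)[OF courant_gen[OF c fv jf]] JI' IJ' II' lhs6_def
    by (simp add: expand_simps)
qed

end

end

section \<open>The six expressions and the integrability criterion\<close>

theorem lemma4p0p3:
  fixes A :: "('m::{t2_space, second_countable_topology}, 'n::finite) chart set"
    and J :: "'m \<Rightarrow> 'm gvec \<Rightarrow> 'm gvec"
    and D :: "('m, 'n) chart \<Rightarrow> 'n \<Rightarrow> ('m \<Rightarrow> real) \<Rightarrow> 'm \<Rightarrow> real"
    and H \<alpha> \<beta> K :: "('m, 'n) chart \<Rightarrow> 'n \<Rightarrow> 'n \<Rightarrow> 'm \<Rightarrow> real"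
  assumes M: "smooth_structure A"
    and J: "strong_gen_almost_complex A J"
    and D: "\<And>c l f p. D c l f p = coord_vec A c l p f"
    and H: "H = coeff_H A J" and \<alpha>: "\<alpha> = coeff_alpha A J"
    and \<beta>: "\<beta> = coeff_beta A J" and K: "K = coeff_K A J"
  shows
    "(\<forall>c\<in>A. \<forall>p\<in>fst c. \<forall>i.
       block_H J p (coord_vec A c i p) = (\<Sum>j\<in>UNIV. H c i j p *\<^sub>R coord_vec A c j p) \<and>
       block_alpha J p (coord_form A c i p) = (\<Sum>j\<in>UNIV. \<alpha> c i j p *\<^sub>R coord_vec A c j p) \<and>
       block_beta J p (coord_vec A c i p) = (\<Sum>j\<in>UNIV. \<beta> c i j p *\<^sub>R coord_form A c j p) \<and>
       block_K J p (coord_form A c i p) = (\<Sum>j\<in>UNIV. K c i j p *\<^sub>R coord_form A c j p))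
     \<and>
     (\<forall>c\<in>A. \<forall>p\<in>fst c. \<forall>i j k.
       vec_comp A c k p (fst (nijenhuis A J (frame_vec A c i) (frame_vec A c j) p))
         = lhs1 (D c) (H c) (\<alpha> c) (\<beta> c) i j k p \<and>
       form_comp A c k p (snd (nijenhuis A J (frame_vec A c i) (frame_vec A c j) p))
         = lhs2 (D c) (H c) (\<beta> c) (K c) i j k p \<and>
       vec_comp A c k p (fst (nijenhuis A J (frame_form A c i) (frame_form A c j) p))
         = lhs3 (D c) (\<alpha> c) i j k p \<and>
       form_comp A c k p (snd (nijenhuis A J (frame_form A c i) (frame_form A c j) p))
         = lhs4 (D c) (\<alpha> c) (K c) i j k p \<and>
       vec_comp A c k p (fst (nijenhuis A J (frame_vec A c i) (frame_form A c j) p))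
         = lhs5 (D c) (H c) (\<alpha> c) (K c) i j k p \<and>
       form_comp A c k p (snd (nijenhuis A J (frame_vec A c i) (frame_form A c j) p))
         = lhs6 (D c) (H c) (\<alpha> c) (\<beta> c) (K c) i j k p)
     \<and>
     (courant_integrable A J \<longleftrightarrow>
       (\<forall>c\<in>A. \<forall>p\<in>fst c. \<forall>i j k.
          lhs1 (D c) (H c) (\<alpha> c) (\<beta> c) i j k p = 0 \<and>
          lhs2 (D c) (H c) (\<beta> c) (K c) i j k p = 0 \<and>
          lhs3 (D c) (\<alpha> c) i j k p = 0 \<and>
          lhs4 (D c) (\<alpha> c) (K c) i j k p = 0 \<and>
          lhs5 (D c) (H c) (\<alpha> c) (K c) i j k p = 0 \<and>
          lhs6 (D c) (H c) (\<alpha> c) (\<beta> c) (K c) i j k p = 0))"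
proof -
  interpret gen_almost_complex A J
    by unfold_locales (rule M, rule J)
  note fv = section_near_frame_vec and ff = section_near_frame_form
  have comps: "vec_comp A c k p (fst (nijenhuis A J (frame_vec A c i) (frame_vec A c j) p))
         = lhs1 (D c) (H c) (\<alpha> c) (\<beta> c) i j k p"
      "form_comp A c k p (snd (nijenhuis A J (frame_vec A c i) (frame_vec A c j) p))
         = lhs2 (D c) (H c) (\<beta> c) (K c) i j k p"
      "vec_comp A c k p (fst (nijenhuis A J (frame_form A c i) (frame_form A c j) p))
         = lhs3 (D c) (\<alpha> c) i j k p"
      "form_comp A c k p (snd (nijenhuis A J (frame_form A c i) (frame_form A c j) p))
         = lhs4 (D c) (\<alpha> c) (K c) i j k p"
      "vec_comp A c k p (fst (nijenhuis A J (frame_vec A c i) (frame_form A c j) p))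
         = lhs5 (D c) (H c) (\<alpha> c) (K c) i j k p"
      "form_comp A c k p (snd (nijenhuis A J (frame_vec A c i) (frame_form A c j) p))
         = lhs6 (D c) (H c) (\<alpha> c) (\<beta> c) (K c) i j k p"
    if "c \<in> A" "p \<in> fst c" for c p i j k
    unfolding H \<alpha> \<beta> K
    by (rule nijenhuis_vec_vec[OF that D] nijenhuis_form_form[OF that D] nijenhuis_vec_form[OF that D])+
  \<comment> \<open>Each of the three kinds of frame pairs accounts for two of the six expressions,
    one per component type, and the quantifiers over \<open>k\<close> merge into one.\<close>
  have zero: "(nijenhuis A J (frame_vec A c i) (frame_vec A c j) p = 0 \<and>
        nijenhuis A J (frame_form A c i) (frame_form A c j) p = 0 \<and>
        nijenhuis A J (frame_vec A c i) (frame_form A c j) p = 0) \<longleftrightarrow>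
      (\<forall>k. lhs1 (D c) (H c) (\<alpha> c) (\<beta> c) i j k p = 0 \<and>
          lhs2 (D c) (H c) (\<beta> c) (K c) i j k p = 0 \<and>
          lhs3 (D c) (\<alpha> c) i j k p = 0 \<and>
          lhs4 (D c) (\<alpha> c) (K c) i j k p = 0 \<and>
          lhs5 (D c) (H c) (\<alpha> c) (K c) i j k p = 0 \<and>
          lhs6 (D c) (H c) (\<alpha> c) (\<beta> c) (K c) i j k p = 0)"
    if cp: "c \<in> A" "p \<in> fst c" for c p i j
    unfolding nijenhuis_eq_0_iff[OF cp fv[OF cp] fv[OF cp]] nijenhuis_eq_0_iff[OF cp ff[OF cp] ff[OF cp]]
      nijenhuis_eq_0_iff[OF cp fv[OF cp] ff[OF cp]] comps[OF cp]
    by blast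
  have "courant_integrable A J \<longleftrightarrow>
       (\<forall>c\<in>A. \<forall>p\<in>fst c. \<forall>i j k.
          lhs1 (D c) (H c) (\<alpha> c) (\<beta> c) i j k p = 0 \<and>
          lhs2 (D c) (H c) (\<beta> c) (K c) i j k p = 0 \<and>
          lhs3 (D c) (\<alpha> c) i j k p = 0 \<and>
          lhs4 (D c) (\<alpha> c) (K c) i j k p = 0 \<and>
          lhs5 (D c) (H c) (\<alpha> c) (K c) i j k p = 0 \<and>
          lhs6 (D c) (H c) (\<alpha> c) (\<beta> c) (K c) i j k p = 0)"
    unfolding courant_integrable_iff by (intro ball_cong refl all_cong1) (rule zero)
  then show ?thesis
    using block_expansions comps unfolding H \<alpha> \<beta> K by simp
qed

end
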